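(* Let $M$ be $\mathbb R^2$, the unit sphere $\mathbb S^2$, or the hyperbolic plane $\mathbb H^2$, and let $P\subset M$ be a connected geodesic polygon with universal covering space $\mathfrak C=\bigcup_{g\in G}P_g$ and canonical map $\varphi:\mathfrak C\to M$. Let $x\in P$ and let $v\in T_xP$ be a unit tangent vector. Identify $P$ with $P_e\subset\mathfrak C$, so that also $x\in P_e$, $v\in T_x\mathfrak C$. Let $U_x$ denote the unfolding operator for billiard orbits in $P$ emanating from $x$. Then for all $t\in\mathbb R_+$ (for which the billiard orbit of $v$ is defined) $$U_x(\exp_P(v,t))=\varphi(\exp_{\mathfrak C}(v,t)).$$
   Context: Coxeter system: let $A$ be the set of sides of $P$ and, for $a\in A$, let $s_a\in\mathrm{Iso}(M)$ be the geodesic reflection in $a$. $G$ is the Coxeter group with generators $\sigma_a$, $a\in A$, and relations $\sigma_a^2=1$ and $(\sigma_a\sigma_b)^{n(a,b)}=1$, the latter only for sides $a,b$ with a common corner whose angle $\theta(a,b)$ is a rational multiple of $\pi$, in which case $n(a,b)$ is the denominator of $\theta(a,b)/\pi$. $G$ acts on $M$ by letting $\sigma_a$ act as $s_a$; write this action as $g(x)$. Universal covering space: $\mathfrak C$ is the quotient of $G\times P$ by the relation $(g,x)\sim(h,x)$ iff $g^{-1}h$ lies in the subgroup generated by those $\sigma_a$ with $x\in a$; $P_g$ is the image of $\{g\}\times P$, $P_e$ is identified with $P$, and $G$ acts by $g\cdot P_h=P_{gh}$. $\mathfrak C$ carries the unique $G$-invariant Riemannian structure (with cone singularities at vertices of the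 tiling) extending that of $P_e=P\subset M$. The map $\varphi:\mathfrak C\to M$ is defined by $\varphi(g\cdot x)=g(x)$ for $x\in P_e$, $g\in G$. For $X=P$, $M$ or $\mathfrak C$, $T_xX$ is the set of unit tangent vectors at $x$ ($T_xP$ consists of those directed into $P$), and $\exp_X(v,t)$ is the position at time $t$ of the unit-speed geodesic in $X$ with initial vector $v$; for $X=P$ this is the billiard orbit $\beta_v$ with the usual reflection law at sides. Orbits in $P$ and geodesics in $\mathfrak C$ are not extended past corners, respectively vertices. Unfolding: the unfolding operator replaces successive reflections of the orbit in the sides of $P$ by reflections of the current copy of the table across the side being hit: if $\beta_v$ hits the sides $a_1,a_2,\dots$ in succession, the part of $\beta_v$ between the $k$-th and $(k+1)$-st hits is mapped to $M$ by the isometry $s_{a_1}s_{a_2}\cdots s_{a_k}$. The result is the geodesic $\gamma_v$ of $M$ emanating from $x$ in direction $v$; $U_x:\beta_v\mapsto\gamma_v$ preserves parametrizations, and $U_x(\exp_P(v,t))$ denotes the point of the unfolded orbit at time $t$. *)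

theory Defs
  imports "HOL-Analysis.Analysis" "HOL-Algebra.Generated_Groups"
begin

section \<open>The three model surfaces\<close>

datatype geometry = Euclidean | Spherical | Hyperbolic

type_synonym point = "real^3"
type_synonym side = "point set"

text \<open>
  All three surfaces are placed in \<open>real^3\<close>: the Euclidean plane as the affine plane
  of height 1, the sphere as the unit sphere, the hyperbolic plane as the upper sheet of the
  hyperboloid. The Riemannian metric is in each case the restriction of \<open>form\<close> to tangent
  vectors, and isometries are restrictions of linear maps of \<open>real^3\<close>, so that
  such a map is also its own differential.
\<close>

definition curvature :: "geometry \<Rightarrow> real" where
  "curvature X = (case X of Euclidean \<Rightarrow> 0 | Spherical \<Rightarrow> 1 | Hyperbolic \<Rightarrow> -1)"

definition form :: "geometry \<Rightarrow> point \<Rightarrow> point \<Rightarrow> real" where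
  "form X v w = v$1 * w$1 + v$2 * w$2 + curvature X * (v$3 * w$3)"

definition surface :: "geometry \<Rightarrow> point set" where
  "surface X = (case X of
      Euclidean \<Rightarrow> {x. x$3 = 1}
    | Spherical \<Rightarrow> sphere 0 1
    | Hyperbolic \<Rightarrow> {x. form Hyperbolic x x = -1 \<and> x$3 > 0})"

definition unit_tangents :: "geometry \<Rightarrow> point \<Rightarrow> point set" where
  "unit_tangents X x = {v. form X v v = 1 \<and>
     (case X of Euclidean \<Rightarrow> v$3 = 0 | Spherical \<Rightarrow> form X x v = 0 | Hyperbolic \<Rightarrow> form X x v = 0)}"

definition exp_M :: "geometry \<Rightarrow> point \<Rightarrow> point \<Rightarrow> real \<Rightarrow> point" where
  "exp_M X x v t = (case X of
      Euclidean \<Rightarrow> x + t *\<^sub>R v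
    | Spherical \<Rightarrow> cos t *\<^sub>R x + sin t *\<^sub>R v
    | Hyperbolic \<Rightarrow> cosh t *\<^sub>R x + sinh t *\<^sub>R v)"

definition velocity :: "geometry \<Rightarrow> point \<Rightarrow> point \<Rightarrow> real \<Rightarrow> point" where
  "velocity X x v t = (case X of
      Euclidean \<Rightarrow> v
    | Spherical \<Rightarrow> - sin t *\<^sub>R x + cos t *\<^sub>R v
    | Hyperbolic \<Rightarrow> sinh t *\<^sub>R x + cosh t *\<^sub>R v)"

text \<open>
  For \<open>S = P\<close> this is the set \<open>T\<^sub>xP\<close> of unit vectors at \<open>x\<close> directed into \<open>P\<close>,
  vectors along a side included.
\<close>

definition directions :: "geometry \<Rightarrow> point set \<Rightarrow> point \<Rightarrow> point set" where
  "directions X S x = {v \<in> unit_tangents X x. \<exists>e>0. \<forall>t\<in>{0..e}. exp_M X x v t \<in> S}"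

section \<open>Geodesic polygons\<close>

definition geodesic_segment :: "geometry \<Rightarrow> point set \<Rightarrow> point \<Rightarrow> point \<Rightarrow> bool" where
  "geodesic_segment X a p q \<longleftrightarrow> p \<in> surface X \<and>
     (\<exists>u\<in>unit_tangents X p. \<exists>l>0. (X = Spherical \<longrightarrow> l < 2 * pi) \<and>
        a = exp_M X p u ` {0..l} \<and> q = exp_M X p u l)"

definition endpoints :: "geometry \<Rightarrow> point set \<Rightarrow> point set" where
  "endpoints X a = {p. \<exists>q. geodesic_segment X a p q}"

definition corners :: "geometry \<Rightarrow> side set \<Rightarrow> point set" where
  "corners X A = (\<Union>a\<in>A. endpoints X a)"

definition geodesic_polygon :: "geometry \<Rightarrow> point set \<Rightarrow> side set \<Rightarrow> bool" where
  "geodesic_polygon X P A \<longleftrightarrow>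
     P \<subseteq> surface X \<and> compact P \<and>
     top_of_set (surface X) closure_of (top_of_set (surface X) interior_of P) = P \<and>
     top_of_set (surface X) frontier_of P = \<Union>A \<and>
     finite A \<and> A \<noteq> {} \<and>
     (\<forall>a\<in>A. \<exists>p q. geodesic_segment X a p q) \<and>
     (\<forall>a\<in>A. \<forall>b\<in>A. a \<noteq> b \<longrightarrow> a \<inter> b \<subseteq> endpoints X a \<inter> endpoints X b) \<and>
     (\<forall>p\<in>corners X A. card {a\<in>A. p \<in> a} = 2)"

text \<open>
  \<open>has_interior_angle X P p a b \<theta>\<close>: the directions from \<open>p\<close> into \<open>P\<close> are swept out by
  turning through \<open>\<theta>\<close> from the direction of \<open>a\<close> to that of \<open>b\<close>.
\<close>

definition has_interior_angle ::
    "geometry \<Rightarrow> point set \<Rightarrow> point \<Rightarrow> point set \<Rightarrow> point set \<Rightarrow> real \<Rightarrow> bool" where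
  "has_interior_angle X P p a b \<theta> \<longleftrightarrow> 0 < \<theta> \<and> \<theta> < 2 * pi \<and>
     (\<exists>u\<in>unit_tangents X p. \<exists>w\<in>unit_tangents X p. form X u w = 0 \<and>
        u \<in> directions X a p \<and>
        cos \<theta> *\<^sub>R u + sin \<theta> *\<^sub>R w \<in> directions X b p \<and>
        directions X P p = (\<lambda>\<alpha>. cos \<alpha> *\<^sub>R u + sin \<alpha> *\<^sub>R w) ` {0..\<theta>})"

definition normals :: "geometry \<Rightarrow> point set \<Rightarrow> point \<Rightarrow> point set" where
  "normals X a p = {w \<in> unit_tangents X p. \<forall>u\<in>directions X a p. form X u w = 0}"

text \<open>
  The reflection in the geodesic through \<open>a\<close> reverses the geodesics perpendicular to \<open>a\<close>;
  among linear maps it is determined by this, see \<open>side_reflection_eq\<close> below.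
\<close>

definition side_reflection :: "geometry \<Rightarrow> point set \<Rightarrow> point \<Rightarrow> point" where
  "side_reflection X a = (THE f. linear f \<and>
     (\<forall>p\<in>a. \<forall>w\<in>normals X a p. \<forall>t. f (exp_M X p w t) = exp_M X p (- w) t))"

section \<open>Groups given by generators and relators\<close>

text \<open>The letter \<open>(s, True)\<close> stands for the generator \<open>s\<close> and \<open>(s, False)\<close> for its inverse.\<close>

inductive presentation_eq ::
    "'a set \<Rightarrow> ('a \<times> bool) list set \<Rightarrow> ('a \<times> bool) list \<Rightarrow> ('a \<times> bool) list \<Rightarrow> bool"
  for S R where
  pres_refl: "w \<in> lists (S \<times> UNIV) \<Longrightarrow> presentation_eq S R w w"
| pres_sym: "presentation_eq S R u w \<Longrightarrow> presentation_eq S R w u"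
| pres_trans: "presentation_eq S R u v \<Longrightarrow> presentation_eq S R v w \<Longrightarrow> presentation_eq S R u w"
| pres_cancel: "u \<in> lists (S \<times> UNIV) \<Longrightarrow> w \<in> lists (S \<times> UNIV) \<Longrightarrow> s \<in> S \<Longrightarrow>
    presentation_eq S R (u @ [(s, b), (s, \<not> b)] @ w) (u @ w)"
| pres_relator: "u \<in> lists (S \<times> UNIV) \<Longrightarrow> w \<in> lists (S \<times> UNIV) \<Longrightarrow>
    r \<in> R \<Longrightarrow> r \<in> lists (S \<times> UNIV) \<Longrightarrow> presentation_eq S R (u @ r @ w) (u @ w)"

definition word_class ::
    "'a set \<Rightarrow> ('a \<times> bool) list set \<Rightarrow> ('a \<times> bool) list \<Rightarrow> ('a \<times> bool) list set" where
  "word_class S R w = {u. presentation_eq S R w u}"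

definition presented_group ::
    "'a set \<Rightarrow> ('a \<times> bool) list set \<Rightarrow> ('a \<times> bool) list set monoid" where
  "presented_group S R =
     \<lparr>carrier = word_class S R ` lists (S \<times> UNIV),
      mult = (\<lambda>g h. \<Union>u\<in>g. \<Union>w\<in>h. word_class S R (u @ w)),
      one = word_class S R []\<rparr>"

section \<open>The Coxeter group of a polygon and its action\<close>

type_synonym group_elem = "(side \<times> bool) list set"

definition coxeter_relators ::
    "geometry \<Rightarrow> point set \<Rightarrow> side set \<Rightarrow> (side \<times> bool) list set" where
  "coxeter_relators X P A =
     {[(a, True), (a, True)] | a. a \<in> A} \<union>
     {concat (replicate (nat (snd (quotient_of r))) [(a, True), (b, True)]) | a b r.
        a \<in> A \<and> b \<in> A \<and> a \<noteq> b \<and>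
        (\<exists>p\<in>endpoints X a \<inter> endpoints X b. has_interior_angle X P p a b (of_rat r * pi))}"

definition coxeter_group ::
    "geometry \<Rightarrow> point set \<Rightarrow> side set \<Rightarrow> group_elem monoid" where
  "coxeter_group X P A = presented_group A (coxeter_relators X P A)"

definition coxeter_gen ::
    "geometry \<Rightarrow> point set \<Rightarrow> side set \<Rightarrow> point set \<Rightarrow> group_elem" where
  "coxeter_gen X P A a = word_class A (coxeter_relators X P A) [(a, True)]"

definition letter_act :: "geometry \<Rightarrow> side \<times> bool \<Rightarrow> point \<Rightarrow> point" where
  "letter_act X l =
     (if snd l then side_reflection X (fst l) else Hilbert_Choice.inv (side_reflection X (fst l)))"

definition act :: "geometry \<Rightarrow> group_elem \<Rightarrow> point \<Rightarrow> point" where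
  "act X g y = the_elem ((\<lambda>w. foldr (letter_act X) w y) ` g)"

section \<open>The universal covering space\<close>

type_synonym cover_point = "(group_elem \<times> point) set"

definition cover_rel ::
    "geometry \<Rightarrow> point set \<Rightarrow> side set \<Rightarrow>
     ((group_elem \<times> point) \<times> (group_elem \<times> point)) set" where
  "cover_rel X P A = {((g, x), (h, y)). g \<in> carrier (coxeter_group X P A) \<and>
     h \<in> carrier (coxeter_group X P A) \<and> x \<in> P \<and> y = x \<and>
     inv\<^bsub>coxeter_group X P A\<^esub> g \<otimes>\<^bsub>coxeter_group X P A\<^esub> h
       \<in> generate (coxeter_group X P A) (coxeter_gen X P A ` {a\<in>A. x \<in> a})}"

definition cover :: "geometry \<Rightarrow> point set \<Rightarrow> side set \<Rightarrow> cover_point set" where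
  "cover X P A = (carrier (coxeter_group X P A) \<times> P) // cover_rel X P A"

definition tile_point ::
    "geometry \<Rightarrow> point set \<Rightarrow> side set \<Rightarrow> group_elem \<Rightarrow> point \<Rightarrow> cover_point" where
  "tile_point X P A g x = cover_rel X P A `` {(g, x)}"

definition base_point ::
    "geometry \<Rightarrow> point set \<Rightarrow> side set \<Rightarrow> point \<Rightarrow> cover_point" where
  "base_point X P A x = tile_point X P A \<one>\<^bsub>coxeter_group X P A\<^esub> x"

definition cover_vertices :: "geometry \<Rightarrow> point set \<Rightarrow> side set \<Rightarrow> cover_point set" where
  "cover_vertices X P A =
     (\<Union>g\<in>carrier (coxeter_group X P A). tile_point X P A g ` corners X A)"

definition cover_map :: "geometry \<Rightarrow> cover_point \<Rightarrow> point" where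
  "cover_map X q = the_elem ((\<lambda>(g, x). act X g x) ` q)"

text \<open>
  The Riemannian structure of the covering space enters through its distance function, the
  infimum of the lengths of curves. Since every tile is isometric to \<open>P\<close>, it is enough to
  consider curves composed of finitely many geodesic segments, each inside one tile.
\<close>

inductive broken_geodesic ::
    "geometry \<Rightarrow> point set \<Rightarrow> side set \<Rightarrow> cover_point \<Rightarrow> cover_point \<Rightarrow> real \<Rightarrow> bool"
  for X P A p where
  broken_refl: "p \<in> cover X P A \<Longrightarrow> broken_geodesic X P A p p 0"
| broken_step: "broken_geodesic X P A p (tile_point X P A g y) L \<Longrightarrow>
    g \<in> carrier (coxeter_group X P A) \<Longrightarrow> y \<in> P \<Longrightarrow> u \<in> unit_tangents X y \<Longrightarrow> 0 \<le> l \<Longrightarrow>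
    (\<forall>s\<in>{0..l}. exp_M X y u s \<in> P) \<Longrightarrow>
    broken_geodesic X P A p (tile_point X P A g (exp_M X y u l)) (L + l)"

definition cover_dist ::
    "geometry \<Rightarrow> point set \<Rightarrow> side set \<Rightarrow> cover_point \<Rightarrow> cover_point \<Rightarrow> real" where
  "cover_dist X P A p q = Inf {L. broken_geodesic X P A p q L}"

text \<open>
  Unit-speed geodesics on \<open>[0, T]\<close> are the locally distance-preserving curves. Vertices are
  admitted only at the two ends.
\<close>

definition cover_geodesic ::
    "geometry \<Rightarrow> point set \<Rightarrow> side set \<Rightarrow> real \<Rightarrow> (real \<Rightarrow> cover_point) \<Rightarrow> bool" where
  "cover_geodesic X P A T c \<longleftrightarrow>
     (\<forall>s\<in>{0..T}. c s \<in> cover X P A) \<and>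
     (\<forall>s\<in>{0<..<T}. c s \<notin> cover_vertices X P A) \<and>
     (\<forall>s\<in>{0..T}. \<exists>e>0. \<forall>r\<in>{0..T} \<inter> ball s e. \<forall>r'\<in>{0..T} \<inter> ball s e.
        cover_dist X P A (c r) (c r') = \<bar>r - r'\<bar>)"

text \<open>
  As \<open>P\<close> is identified with the base tile, a geodesic has the initial vector
  \<open>v \<in> T\<^sub>xP\<close> if it starts along the geodesic of \<open>P\<close> with that vector.
\<close>

definition cover_initial ::
    "geometry \<Rightarrow> point set \<Rightarrow> side set \<Rightarrow> point \<Rightarrow> point \<Rightarrow> real \<Rightarrow> (real \<Rightarrow> cover_point) \<Rightarrow> bool" where
  "cover_initial X P A x v T c \<longleftrightarrow>
     (\<exists>e>0. \<forall>s\<in>{0..e} \<inter> {0..T}. exp_M X x v s \<in> P \<and> c s = base_point X P A (exp_M X x v s))"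

definition exp_C ::
    "geometry \<Rightarrow> point set \<Rightarrow> side set \<Rightarrow> point \<Rightarrow> point \<Rightarrow> real \<Rightarrow> cover_point" where
  "exp_C X P A x v t =
     (SOME q. \<exists>c. cover_geodesic X P A t c \<and> cover_initial X P A x v t c \<and> q = c t)"

section \<open>Billiards and unfolding\<close>

definition free_segment ::
    "geometry \<Rightarrow> point set \<Rightarrow> side set \<Rightarrow> point \<Rightarrow> point \<Rightarrow> real \<Rightarrow> bool" where
  "free_segment X P A y w s \<longleftrightarrow> 0 < s \<and> (\<forall>r\<in>{0..s}. exp_M X y w r \<in> P) \<and>
     (\<forall>r\<in>{0<..<s}. exp_M X y w r \<notin> corners X A)"

text \<open>
  \<open>billiard X P A x v t y w as\<close>: at time \<open>t\<close> the orbit of \<open>v\<close> is at \<open>y\<close>, arriving with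
  velocity \<open>w\<close>, and \<open>as\<close> lists the sides hit strictly before time \<open>t\<close>. A side is hit when
  the velocity points out of \<open>P\<close>; an orbit may run along a side, and it may start or end,
  but not continue, at a corner.
\<close>

inductive billiard ::
    "geometry \<Rightarrow> point set \<Rightarrow> side set \<Rightarrow> point \<Rightarrow> point \<Rightarrow>
     real \<Rightarrow> point \<Rightarrow> point \<Rightarrow> side list \<Rightarrow> bool"
  for X P A x v where
  billiard_start: "x \<in> P \<Longrightarrow> v \<in> directions X P x \<Longrightarrow> billiard X P A x v 0 x v []"
| billiard_move: "billiard X P A x v t y w as \<Longrightarrow> t = 0 \<or> y \<notin> corners X A \<Longrightarrow>
    free_segment X P A y w s \<Longrightarrow>
    billiard X P A x v (t + s) (exp_M X y w s) (velocity X y w s) as"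
| billiard_hit: "billiard X P A x v t y w as \<Longrightarrow> y \<notin> corners X A \<Longrightarrow>
    w \<notin> directions X P y \<Longrightarrow> a \<in> A \<Longrightarrow> y \<in> a \<Longrightarrow> w' = side_reflection X a w \<Longrightarrow>
    free_segment X P A y w' s \<Longrightarrow>
    billiard X P A x v (t + s) (exp_M X y w' s) (velocity X y w' s) (as @ [a])"

definition billiard_defined ::
    "geometry \<Rightarrow> point set \<Rightarrow> side set \<Rightarrow> point \<Rightarrow> point \<Rightarrow> real \<Rightarrow> bool" where
  "billiard_defined X P A x v t \<longleftrightarrow> (\<exists>y w as. billiard X P A x v t y w as)"

definition billiard_state ::
    "geometry \<Rightarrow> point set \<Rightarrow> side set \<Rightarrow> point \<Rightarrow> point \<Rightarrow> real \<Rightarrow>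
     point \<times> point \<times> side list" where
  "billiard_state X P A x v t = (SOME (y, w, as). billiard X P A x v t y w as)"

definition exp_P ::
    "geometry \<Rightarrow> point set \<Rightarrow> side set \<Rightarrow> point \<Rightarrow> point \<Rightarrow> real \<Rightarrow> point" where
  "exp_P X P A x v t = fst (billiard_state X P A x v t)"

definition sides_hit ::
    "geometry \<Rightarrow> point set \<Rightarrow> side set \<Rightarrow> point \<Rightarrow> point \<Rightarrow> real \<Rightarrow> side list" where
  "sides_hit X P A x v t = snd (snd (billiard_state X P A x v t))"

text \<open>
  \<open>foldr\<close> composes the reflections in the order \<open>s\<^sub>a\<^sub>1 \<circ> s\<^sub>a\<^sub>2 \<circ> \<dots> \<circ> s\<^sub>a\<^sub>k\<close>.
\<close>

definition unfold_op ::
    "geometry \<Rightarrow> point set \<Rightarrow> side set \<Rightarrow> point \<Rightarrow> point \<Rightarrow> real \<Rightarrow> point \<Rightarrow> point" where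
  "unfold_op X P A x v t y = foldr (side_reflection X) (sides_hit X P A x v t) y"

section \<open>Basic facts\<close>

lemma form_commute: "form X x y = form X y x"
  by (simp add: form_def mult.commute)

lemma form_simps:
  "form X z (x + y) = form X z x + form X z y" "form X (x + y) z = form X x z + form X y z"
  "form X z (x - y) = form X z x - form X z y" "form X (x - y) z = form X x z - form X y z"
  "form X z (a *\<^sub>R x) = a * form X z x" "form X (a *\<^sub>R x) z = a * form X x z"
  "form X z (- x) = - form X z x" "form X (- x) z = - form X x z"
  "form X z 0 = 0" "form X 0 z = 0"
  by (simp_all add: form_def algebra_simps)

lemma surface_Spherical: "surface Spherical = {x. form Spherical x x = 1}"
  by (auto simp: surface_def form_def curvature_def norm_eq_1 inner_vec_def sum_3)

lemmas exp_M_unfold = exp_M_def velocity_def unit_tangents_def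
lemmas surface_Euclidean = surface_def[of Euclidean, simplified]
lemmas surface_Hyperbolic = surface_def[of Hyperbolic, simplified]

lemma hyperbolic_forward:
  assumes "x \<in> surface Hyperbolic" "v \<in> unit_tangents Hyperbolic x"
  shows "(cosh t *\<^sub>R x + sinh t *\<^sub>R v)$3 > 0"
proof -
  have x: "(x$3)\<^sup>2 = 1 + (x$1)\<^sup>2 + (x$2)\<^sup>2" "x$3 > 0"
    and v: "(v$3)\<^sup>2 = (v$1)\<^sup>2 + (v$2)\<^sup>2 - 1" and xv: "x$1 * v$1 + x$2 * v$2 = x$3 * v$3"
    using assms by (auto simp: surface_Hyperbolic unit_tangents_def form_def curvature_def power2_eq_square)
  have "(x$1 * v$1 + x$2 * v$2)\<^sup>2 + (x$1 * v$2 - x$2 * v$1)\<^sup>2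
      = ((x$1)\<^sup>2 + (x$2)\<^sup>2) * ((v$1)\<^sup>2 + (v$2)\<^sup>2)"
    by (simp add: power2_eq_square algebra_simps)
  then have "(x$1 * v$1 + x$2 * v$2)\<^sup>2 \<le> ((x$1)\<^sup>2 + (x$2)\<^sup>2) * ((v$1)\<^sup>2 + (v$2)\<^sup>2)"
    by (rule order.trans[rotated, OF eq_refl]) simp
  then have "(x$3 * v$3)\<^sup>2 \<le> ((x$3)\<^sup>2 - 1) * ((v$3)\<^sup>2 + 1)"
    unfolding xv x(1) v by simp
  then have "(v$3)\<^sup>2 < (x$3)\<^sup>2" by (simp add: power_mult_distrib algebra_simps)
  then have "\<bar>v$3\<bar> < x$3" using x(2) power2_less_imp_less[of "\<bar>v$3\<bar>" "x$3"] by simp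
  moreover have "\<bar>sinh t\<bar> < cosh t"
    using sinh_less_cosh_real[of t] sinh_less_cosh_real[of "- t"] by (simp add: abs_if)
  ultimately have "\<bar>sinh t\<bar> * \<bar>v$3\<bar> < cosh t * x$3"
    using x(2) by (intro mult_strict_mono') auto
  then have "\<bar>sinh t * v$3\<bar> < cosh t * x$3" by (simp add: abs_mult)
  then show ?thesis by simp
qed

lemma exp_M_surface:
  assumes "x \<in> surface X" "v \<in> unit_tangents X x"
  shows "exp_M X x v t \<in> surface X" "velocity X x v t \<in> unit_tangents X (exp_M X x v t)"
proof -
  have sc: "sin t * sin t + cos t * cos t = 1"
    using sin_cos_squared_add[of t] by (simp add: power2_eq_square)
  have ch: "cosh t * cosh t = 1 + sinh t * sinh t"
    using cosh_square_eq[of t] by (simp add: power2_eq_square)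
  show "velocity X x v t \<in> unit_tangents X (exp_M X x v t)"
  proof (cases X)
    case Spherical
    then have "form X x x = 1" "form X v v = 1" "form X x v = 0" "form X v x = 0"
      using assms by (auto simp: surface_Spherical unit_tangents_def form_commute[of _ v x])
    then show ?thesis using Spherical sc by (simp add: exp_M_unfold form_simps algebra_simps)
  next
    case Hyperbolic
    then have "form X x x = -1" "form X v v = 1" "form X x v = 0" "form X v x = 0"
      using assms by (auto simp: surface_Hyperbolic unit_tangents_def form_commute[of _ v x])
    then show ?thesis using Hyperbolic ch by (simp add: exp_M_unfold form_simps algebra_simps)
  qed (use assms in \<open>simp add: exp_M_unfold\<close>)
  show "exp_M X x v t \<in> surface X"
  proof (cases X)
    case Euclidean
    then show ?thesis using assms by (simp add: exp_M_unfold surface_Euclidean)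
  next
    case Spherical
    then have "form X x x = 1" "form X v v = 1" "form X x v = 0" "form X v x = 0"
      using assms by (auto simp: surface_Spherical unit_tangents_def form_commute[of _ v x])
    then show ?thesis using Spherical sc
      by (simp add: exp_M_unfold form_simps algebra_simps surface_Spherical)
  next
    case Hyperbolic
    then have "form X x x = -1" "form X v v = 1" "form X x v = 0" "form X v x = 0"
      using assms by (auto simp: surface_Hyperbolic unit_tangents_def form_commute[of _ v x])
    then show ?thesis using Hyperbolic ch hyperbolic_forward assms
      by (simp add: exp_M_unfold form_simps algebra_simps surface_Hyperbolic)
  qed
qed

lemma frame_spans:
  assumes p: "p \<in> surface X" and u: "u \<in> unit_tangents X p" and w: "w \<in> unit_tangents X p"
    and uw: "form X u w = 0"
  obtains a b c where "y = a *\<^sub>R p + b *\<^sub>R u + c *\<^sub>R w"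
proof -
  have key: "a = 0 \<and> b = 0 \<and> c = 0" if 0: "a *\<^sub>R p + b *\<^sub>R u + c *\<^sub>R w = 0" for a b c
  proof -
    have wu: "form X w u = 0" using uw form_commute by metis
    have uu: "form X u u = 1" "form X w w = 1" using u w by (auto simp: unit_tangents_def)
    have a: "a = 0"
    proof (cases X)
      case Euclidean
      have "(a *\<^sub>R p + b *\<^sub>R u + c *\<^sub>R w) $ 3 = 0" using 0 by simp
      then show ?thesis using Euclidean p u w by (simp add: surface_Euclidean unit_tangents_def)
    next
      case Spherical
      have "form X p (a *\<^sub>R p + b *\<^sub>R u + c *\<^sub>R w) = 0" using 0 by (simp add: form_simps)
      then show ?thesis using Spherical p u w by (simp add: surface_Spherical unit_tangents_def form_simps)
    next
      case Hyperbolic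
      have "form X p (a *\<^sub>R p + b *\<^sub>R u + c *\<^sub>R w) = 0" using 0 by (simp add: form_simps)
      then show ?thesis using Hyperbolic p u w by (simp add: surface_Hyperbolic unit_tangents_def form_simps)
    qed
    have "form X u (b *\<^sub>R u + c *\<^sub>R w) = 0" "form X w (b *\<^sub>R u + c *\<^sub>R w) = 0"
      using 0 a by (simp_all add: form_simps)
    then show ?thesis using a uu uw wu by (simp add: form_simps)
  qed
  define f where "f z = (z$1) *\<^sub>R p + (z$2) *\<^sub>R u + (z$3) *\<^sub>R w" for z :: "real^3"
  have lin: "linear f" by (auto intro!: linearI simp: f_def algebra_simps)
  have "inj f"
    unfolding linear_injective_0[OF lin]
  proof (intro allI impI)
    fix z assume "f z = 0"
    then show "z = 0" using key[of "z$1" "z$2" "z$3"] by (simp add: f_def vec_eq_iff forall_3)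
  qed
  then have "surj f" using lin linear_injective_imp_surjective by blast
  then obtain z where "y = f z" by (metis surjE)
  then show thesis using that f_def by blast
qed

definition frame_reflection :: "geometry \<Rightarrow> point \<Rightarrow> point \<Rightarrow> point \<Rightarrow> point" where
  "frame_reflection X p w y = y - (2 * form X (y - (y$3) *\<^sub>R p) w) *\<^sub>R w"

lemma frame_reflection_props:
  assumes p: "p \<in> surface X" and u: "u \<in> unit_tangents X p" and w: "w \<in> unit_tangents X p"
    and uw: "form X u w = 0"
  shows "linear (frame_reflection X p w)" "frame_reflection X p w p = p"
    "frame_reflection X p w u = u" "frame_reflection X p w w = - w"
proof -
  have lin: "linear (\<lambda>y. y - (2 * form X (y - (y$3) *\<^sub>R p) w) *\<^sub>R w)"
    by (rule linearI) (simp_all add: form_simps scaleR_add_left algebra_simps)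
  then show "linear (frame_reflection X p w)" by (simp add: frame_reflection_def[abs_def])
  have z: "form X (z - (z$3) *\<^sub>R p) w = form X z w" if "z \<in> unit_tangents X p" for z
    using w that by (cases X) (simp_all add: form_simps unit_tangents_def)
  have "form X (p - (p$3) *\<^sub>R p) w = 0"
    using p w by (cases X) (simp_all add: form_simps surface_Euclidean unit_tangents_def)
  then show "frame_reflection X p w p = p" by (simp add: frame_reflection_def)
  show "frame_reflection X p w u = u" by (simp add: frame_reflection_def z[OF u] uw)
  have "form X w w = 1" using w by (simp add: unit_tangents_def)
  then show "frame_reflection X p w w = - w"
    by (simp add: frame_reflection_def z[OF w] scaleR_2)
qed

lemma exp_M_add:
  shows "exp_M X (exp_M X x u s) (velocity X x u s) r = exp_M X x u (s + r)"
    "exp_M X (exp_M X x u s) (- velocity X x u s) r = exp_M X x u (s - r)"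
proof -
  show "exp_M X (exp_M X x u s) (velocity X x u s) r = exp_M X x u (s + r)"
    by (cases X) (simp_all add: exp_M_def velocity_def vec_eq_iff cos_add sin_add cosh_add sinh_add algebra_simps)
  show "exp_M X (exp_M X x u s) (- velocity X x u s) r = exp_M X x u (s - r)"
    by (cases X) (simp_all add: exp_M_def velocity_def vec_eq_iff cos_diff sin_diff cosh_diff sinh_diff algebra_simps)
qed

lemma side_reflection_eq:
  assumes p: "p \<in> surface X" and u: "u \<in> unit_tangents X p" and w: "w \<in> unit_tangents X p"
    and uw: "form X u w = 0" and l: "0 < l"
  shows "side_reflection X (exp_M X p u ` {0..l}) = frame_reflection X p w"
proof -
  let ?a = "exp_M X p u ` {0..l}"
  note R = frame_reflection_props[OF p u w uw]
  have Rlin: "frame_reflection X p w (a *\<^sub>R x + b *\<^sub>R y) = a *\<^sub>R frame_reflection X p w x + b *\<^sub>R frame_reflection X p w y" for a b x y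
    using R(1) by (simp add: linear_add linear_scale)
  have fr: "w \<in> unit_tangents X (exp_M X p u s)" "form X (velocity X p u s) w = 0" for s
    using w uw p u by (cases X; auto simp: exp_M_unfold form_simps form_commute[of X u w])+
  have Ra: "frame_reflection X p w q = q" if q: "q = exp_M X p u s" for q s
    using R by (cases X) (auto simp: q exp_M_def Rlin linear_add linear_scale)
  have wn: "w \<in> normals X ?a (exp_M X p u s)" for s
  proof -
    have "form X z w = 0" if z: "z \<in> directions X ?a (exp_M X p u s)" for z
    proof -
      from z obtain e where e: "e > 0" "\<forall>t\<in>{0..e}. exp_M X (exp_M X p u s) z t \<in> ?a"
        and zu: "z \<in> unit_tangents X (exp_M X p u s)"
        by (auto simp: directions_def)
      define t where "t = min e 1"
      have t: "0 < t" "t \<le> 1" "t \<le> e" using e by (auto simp: t_def)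
      have "frame_reflection X p w (exp_M X (exp_M X p u s) z t) = exp_M X (exp_M X p u s) z t"
        using e t Ra by fastforce
      moreover have "sin t \<noteq> 0" using t sin_gt_zero[of t] pi_gt3 by simp
      ultimately have Rz: "frame_reflection X p w z = z"
        using t Ra[OF refl, of s] R(1)
        by (cases X) (auto simp: exp_M_def[of _ "exp_M _ _ _ _"] Rlin linear_add linear_scale)
      have "w \<noteq> 0" using w by (auto simp: unit_tangents_def form_simps)
      with Rz have "form X (z - (z$3) *\<^sub>R p) w = 0" by (simp add: frame_reflection_def)
      then show ?thesis using zu w by (cases X) (auto simp: exp_M_unfold form_simps)
    qed
    then show ?thesis using fr by (auto simp: normals_def form_commute[of X w])
  qed
  have n: "w' = w \<or> w' = - w" if s: "s \<in> {0..l}" and w': "w' \<in> normals X ?a (exp_M X p u s)" for w' s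
  proof -
    let ?q = "exp_M X p u s" and ?v = "velocity X p u s"
    note q = exp_M_surface[OF p u, of s]
    have w't: "w' \<in> unit_tangents X ?q" using w' by (simp add: normals_def)
    have mv: "- ?v \<in> unit_tangents X ?q" using q by (auto simp: unit_tangents_def form_simps split: geometry.splits)
    have "?v \<in> directions X ?a ?q \<or> - ?v \<in> directions X ?a ?q"
    proof (cases "s < l")
      case True
      then have "\<forall>t\<in>{0..l - s}. exp_M X ?q ?v t \<in> ?a" using s by (auto simp: exp_M_add)
      then have "?v \<in> directions X ?a ?q" using True q unfolding directions_def
        by (intro CollectI conjI exI[of _ "l - s"]) auto
      then show ?thesis ..
    next
      case False
      then have "\<forall>t\<in>{0..l}. exp_M X ?q (- ?v) t \<in> ?a" using s by (auto simp: exp_M_add)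
      then have "- ?v \<in> directions X ?a ?q" using l mv unfolding directions_def
        by (intro CollectI conjI exI[of _ l]) auto
      then show ?thesis ..
    qed
    then have "form X ?v w' = 0 \<or> form X (- ?v) w' = 0" using w' unfolding normals_def by blast
    then have w'v: "form X w' ?v = 0" by (simp add: form_simps form_commute[of X w'])
    obtain a b c where abc: "w' = a *\<^sub>R ?q + b *\<^sub>R ?v + c *\<^sub>R w"
      using frame_spans[OF q fr[of s]] .
    have wv: "form X w ?v = 0" using fr form_commute by metis
    have a: "a = 0"
    proof (cases X)
      case Euclidean
      have "w' $ 3 = a" using abc q(1) q(2) fr(1)[of s] Euclidean by (simp add: surface_Euclidean unit_tangents_def)
      then show ?thesis using w't Euclidean by (simp add: unit_tangents_def)
    next
      case Spherical
      have "form X ?q w' = a" using abc q fr(1)[of s] Spherical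
        by (simp add: surface_Spherical unit_tangents_def form_simps)
      then show ?thesis using w't Spherical by (simp add: unit_tangents_def)
    next
      case Hyperbolic
      have "form X ?q w' = - a" using abc q fr(1)[of s] Hyperbolic
        by (simp add: surface_Hyperbolic unit_tangents_def form_simps)
      then show ?thesis using w't Hyperbolic by (simp add: unit_tangents_def)
    qed
    have "form X ?v ?v = 1" using q by (simp add: unit_tangents_def)
    then have b: "b = 0" using w'v abc a wv by (simp add: form_simps)
    have "form X w' w' = 1" "form X w w = 1" using w't w by (auto simp: unit_tangents_def)
    then have "c * c = 1" using abc a b by (simp add: form_simps)
    then have "c = 1 \<or> c = -1" by (simp add: square_eq_1_iff)
    then show ?thesis using abc a b by auto
  qed
  show ?thesis
    unfolding side_reflection_def
  proof (rule the_equality, intro conjI ballI allI R(1))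
    fix q w' t assume q: "q \<in> ?a" and w': "w' \<in> normals X ?a q"
    then have "frame_reflection X p w w' = - w'" "frame_reflection X p w q = q"
      using n Ra R(4) linear_neg[OF R(1)] by fastforce+
    then show "frame_reflection X p w (exp_M X q w' t) = exp_M X q (- w') t"
      using Rlin[of 1 q t w'] Rlin[of "cos t" q "sin t" w'] Rlin[of "cosh t" q "sinh t" w']
      by (cases X) (auto simp: exp_M_def)
  next
    fix f assume f: "linear f \<and> (\<forall>q\<in>?a. \<forall>w\<in>normals X ?a q. \<forall>t. f (exp_M X q w t) = exp_M X q (- w) t)"
    then have lf: "linear f" by blast
    have e0: "exp_M X q w 0 = q" for q w by (cases X) (auto simp: exp_M_def)
    have fa: "f (exp_M X p u s) = exp_M X p u s" if "s \<in> {0..l}" for s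
      using f wn[of s] that e0 by (metis imageI)
    have fp: "f p = p" using fa[of 0] l e0 by simp
    define s where "s = min l 1"
    have s: "0 < s" "s \<le> 1" "s \<le> l" using l by (auto simp: s_def)
    have sin: "sin r \<noteq> 0" if "0 < r" "r \<le> 1" for r :: real using that sin_gt_zero[of r] pi_gt3 by simp
    have fu: "f u = u"
      using fa[of s] s sin[of s] fp
      by (cases X) (auto simp: exp_M_def linear_add[OF lf] linear_scale[OF lf])
    have "f (exp_M X p w 1) = exp_M X p (- w) 1"
      using f wn[of 0] l e0 by (metis atLeastAtMost_iff imageI less_imp_le order_refl)
    then have "(if X = Euclidean then 1 else if X = Spherical then sin 1 else sinh 1) *\<^sub>R (f w + w) = 0"
      using fp by (cases X) (auto simp: exp_M_def linear_add[OF lf] linear_scale[OF lf] scaleR_add_right)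
    then have fw: "f w = - w" using sin[of 1] by (auto simp: add_eq_0_iff2 split: if_splits)
    show "f = frame_reflection X p w"
    proof
      fix y
      obtain a b c where "y = a *\<^sub>R p + b *\<^sub>R u + c *\<^sub>R w" using frame_spans[OF p u w uw] .
      then show "f y = frame_reflection X p w y"
        using fp fu fw R by (simp add: linear_add[OF lf] linear_scale[OF lf] linear_add[OF R(1)] linear_scale[OF R(1)])
    qed
  qed
qed

lemma pres_words:
  assumes "presentation_eq S R u w"
  shows "u \<in> lists (S \<times> UNIV) \<and> w \<in> lists (S \<times> UNIV)"
  using assms by induction auto

lemma pres_context:
  assumes "presentation_eq S R u w" "a \<in> lists (S \<times> UNIV)" "b \<in> lists (S \<times> UNIV)"
  shows "presentation_eq S R (a @ u @ b) (a @ w @ b)"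
  using assms
proof (induction rule: presentation_eq.induct)
  case (pres_refl w)
  then show ?case by (intro presentation_eq.pres_refl) (simp add: append_in_lists_conv)
next
  case (pres_cancel u w s c)
  then show ?case
    using presentation_eq.pres_cancel[of "a @ u" S "w @ b" s R c] by simp
next
  case (pres_relator u w r)
  then show ?case
    using presentation_eq.pres_relator[of "a @ u" S "w @ b" r R] by simp
next
  case (pres_trans u v w)
  then show ?case by (meson presentation_eq.pres_trans)
qed (simp add: presentation_eq.pres_sym)

lemma pres_append:
  assumes "presentation_eq S R u u'" "presentation_eq S R w w'"
  shows "presentation_eq S R (u @ w) (u' @ w')"
proof -
  have "presentation_eq S R (u @ w) (u' @ w)" "presentation_eq S R (u' @ w) (u' @ w')"
    using pres_context[OF assms(1), of "[]" w] pres_context[OF assms(2), of u' "[]"]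
      pres_words[OF assms(1)] pres_words[OF assms(2)] by auto
  then show ?thesis by (rule pres_trans)
qed

lemma word_class_eq_iff:
  assumes "u \<in> lists (S \<times> UNIV)"
  shows "word_class S R u = word_class S R w \<longleftrightarrow> presentation_eq S R u w"
proof
  assume "word_class S R u = word_class S R w"
  then have "u \<in> word_class S R w" using assms by (auto simp: word_class_def intro: pres_refl)
  then show "presentation_eq S R u w" by (auto simp: word_class_def intro: pres_sym)
next
  assume "presentation_eq S R u w"
  then show "word_class S R u = word_class S R w"
    unfolding word_class_def using pres_sym pres_trans by blast
qed

lemma presented_mult:
  assumes "u \<in> lists (S \<times> UNIV)" "w \<in> lists (S \<times> UNIV)"
  shows "word_class S R u \<otimes>\<^bsub>presented_group S R\<^esub> word_class S R w = word_class S R (u @ w)"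
proof -
  have "word_class S R (u' @ w') = word_class S R (u @ w)"
    if "u' \<in> word_class S R u" "w' \<in> word_class S R w" for u' w'
  proof -
    have "presentation_eq S R (u @ w) (u' @ w')"
      using that pres_append by (auto simp: word_class_def)
    then show ?thesis using word_class_eq_iff[of "u @ w" S R "u' @ w'"] assms by simp
  qed
  moreover have "u \<in> word_class S R u" "w \<in> word_class S R w"
    using assms by (auto simp: word_class_def intro: pres_refl)
  ultimately have "(\<Union>u'\<in>word_class S R u. \<Union>w'\<in>word_class S R w. word_class S R (u' @ w'))
      = word_class S R (u @ w)"
    by blast
  then show ?thesis by (simp add: presented_group_def)
qed

lemma presented_inverse:
  assumes "w \<in> lists (S \<times> UNIV)"
  shows "presentation_eq S R (rev (map (\<lambda>(s, b). (s, \<not> b)) w) @ w) []"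
  using assms
proof (induction w)
  case (Cons l w)
  obtain s b where l: "l = (s, b)" by force
  let ?i = "rev (map (\<lambda>(s, b). (s, \<not> b)) w)"
  have s: "s \<in> S" and w: "w \<in> lists (S \<times> UNIV)" using Cons.hyps l by auto
  have "?i \<in> lists (S \<times> UNIV)" using w by (auto simp: in_lists_conv_set)
  then have "presentation_eq S R (?i @ [(s, \<not> b), (s, \<not> \<not> b)] @ w) (?i @ w)"
    using w s by (rule pres_cancel)
  from pres_trans[OF this Cons.IH] show ?case by (simp add: l)
qed (simp add: pres_refl)

lemma carrier_presented_group: "carrier (presented_group S R) = word_class S R ` lists (S \<times> UNIV)"
  and one_presented_group: "\<one>\<^bsub>presented_group S R\<^esub> = word_class S R []"
  by (simp_all add: presented_group_def)

lemma group_presented_group: "group (presented_group S R)"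
proof (rule groupI)
  fix g assume "g \<in> carrier (presented_group S R)"
  then obtain a where a: "a \<in> lists (S \<times> UNIV)" "g = word_class S R a"
    unfolding carrier_presented_group by blast
  let ?i = "rev (map (\<lambda>(s, b). (s, \<not> b)) a)"
  have i: "?i \<in> lists (S \<times> UNIV)" using a(1) by (auto simp: in_lists_conv_set)
  have "word_class S R ?i \<otimes>\<^bsub>presented_group S R\<^esub> g = word_class S R (?i @ a)"
    unfolding a(2) by (rule presented_mult[OF i a(1)])
  also have "\<dots> = word_class S R []"
    by (subst word_class_eq_iff) (use i a(1) presented_inverse[OF a(1)] in auto)
  finally show "\<exists>h\<in>carrier (presented_group S R). h \<otimes>\<^bsub>presented_group S R\<^esub> g = \<one>\<^bsub>presented_group S R\<^esub>"
    unfolding carrier_presented_group one_presented_group using i by blast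
next
  fix g h assume "g \<in> carrier (presented_group S R)" "h \<in> carrier (presented_group S R)"
  then obtain a b where w: "a \<in> lists (S \<times> UNIV)" "b \<in> lists (S \<times> UNIV)"
    and gh: "g = word_class S R a" "h = word_class S R b"
    unfolding carrier_presented_group by blast
  have "a @ b \<in> lists (S \<times> UNIV)" using w by simp
  then show "g \<otimes>\<^bsub>presented_group S R\<^esub> h \<in> carrier (presented_group S R)"
    unfolding gh presented_mult[OF w] carrier_presented_group by (rule imageI)
next
  fix g h k assume "g \<in> carrier (presented_group S R)" "h \<in> carrier (presented_group S R)"
    "k \<in> carrier (presented_group S R)"
  then obtain a b c where w: "a \<in> lists (S \<times> UNIV)" "b \<in> lists (S \<times> UNIV)" "c \<in> lists (S \<times> UNIV)"
    and ghk: "g = word_class S R a" "h = word_class S R b" "k = word_class S R c"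
    unfolding carrier_presented_group by blast
  have ab: "a @ b \<in> lists (S \<times> UNIV)" and bc: "b @ c \<in> lists (S \<times> UNIV)" using w by simp_all
  show "g \<otimes>\<^bsub>presented_group S R\<^esub> h \<otimes>\<^bsub>presented_group S R\<^esub> k
      = g \<otimes>\<^bsub>presented_group S R\<^esub> (h \<otimes>\<^bsub>presented_group S R\<^esub> k)"
    unfolding ghk presented_mult[OF w(1,2)] presented_mult[OF w(2,3)] presented_mult[OF ab w(3)]
      presented_mult[OF w(1) bc] by simp
next
  fix g assume "g \<in> carrier (presented_group S R)"
  then obtain a where a: "a \<in> lists (S \<times> UNIV)" "g = word_class S R a"
    unfolding carrier_presented_group by blast
  show "\<one>\<^bsub>presented_group S R\<^esub> \<otimes>\<^bsub>presented_group S R\<^esub> g = g"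
    unfolding a(2) one_presented_group using presented_mult[OF lists.Nil a(1)] by simp
qed (simp add: carrier_presented_group one_presented_group)

corollary group_coxeter_group: "group (coxeter_group X P A)"
  by (simp add: coxeter_group_def group_presented_group)

end

theory Submission
  imports Defs
begin

text \<open>
  The canonical map \<open>\<phi>\<close> does not increase distances, because a curve inside a tile is moved by an
  isometry of \<open>M\<close>. A billiard orbit lifts to a curve in the covering space by passing from the tile
  \<open>P\<^sub>g\<close> to \<open>P\<^sub>g\<^sub>\<sigma>\<close> at each reflection; its image under \<open>\<phi>\<close> is the unfolded orbit, which is the geodesic
  of \<open>M\<close>, so the lift is locally shortest and hence a geodesic of the covering space. Conversely
  \<open>\<phi>\<close> is a local isometry away from the vertices, so it maps every geodesic of the covering space
  with the given initial vector to the geodesic of \<open>M\<close> with that vector. Hence the point chosen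
  by \<open>exp_C\<close> has the same image as the end of the lift.
\<close>

section \<open>Geodesics of the model surfaces\<close>

text \<open>\<open>exp_C\<close> and \<open>billiard_state\<close> are choices, so nothing may
  depend on which geodesic or which orbit state is picked. Uniqueness is therefore sought not in the
  covering space but in \<open>M\<close>: every admissible choice is shown to land on
  \<open>exp_M X x v t\<close>. The distance of the covering space is an infimum over broken curves.
  Upper bounds for it come from exhibiting curves, lower bounds from projecting to \<open>M\<close>,
  where the distance has a closed formula; the latter require that the points are joined at all.
  That a projected geodesic does not turn is read off from equality in the triangle inequality of
  \<open>M\<close>, that is, from the law of cosines, without any differential calculus. The
  geometry at vertices is never analysed: they are excluded inside the time interval, at the start
  the initial vector prescribes the curve, and at the end a Lipschitz bound suffices. Away from the
  corners the shape of \<open>P\<close> near a side reduces to the sign of one linear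
  function.\<close>

definition cs :: "geometry \<Rightarrow> real \<Rightarrow> real" where
  "cs X t = (case X of Euclidean \<Rightarrow> 1 | Spherical \<Rightarrow> cos t | Hyperbolic \<Rightarrow> cosh t)"

definition sn :: "geometry \<Rightarrow> real \<Rightarrow> real" where
  "sn X t = (case X of Euclidean \<Rightarrow> t | Spherical \<Rightarrow> sin t | Hyperbolic \<Rightarrow> sinh t)"

text \<open>\<open>cs X\<close> and \<open>sn X\<close> solve f'' = - \<open>curvature X\<close> f
  with initial data (1, 0) and (0, 1). In these terms the geodesics of all three surfaces obey one
  formula, so that many later computations need no case distinction.\<close>

lemma exp_M_eq: "exp_M X x v t = cs X t *\<^sub>R x + sn X t *\<^sub>R v"
  by (cases X) (simp_all add: exp_M_def cs_def sn_def)

lemma velocity_eq: "velocity X x v t = (- curvature X * sn X t) *\<^sub>R x + cs X t *\<^sub>R v"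
  by (cases X) (simp_all add: velocity_def cs_def sn_def curvature_def)

lemma cs_sn_0 [simp]: "cs X 0 = 1" "sn X 0 = 0"
  by (cases X; simp add: cs_def sn_def)+

lemma cs_sn_square: "cs X t * cs X t + curvature X * (sn X t * sn X t) = 1"
  using sin_cos_squared_add2[of t] cosh_square_eq[of t]
  by (cases X) (simp_all add: cs_def sn_def curvature_def power2_eq_square)

lemma sn_diff: "sn X (a - b) = sn X a * cs X b - cs X a * sn X b"
  by (cases X) (simp_all add: cs_def sn_def sin_diff sinh_diff)

lemma sn_pos: "0 < t \<Longrightarrow> t < pi \<Longrightarrow> 0 < sn X t"
  by (cases X) (simp_all add: sn_def sin_gt_zero)

lemma sn_nonneg: "0 \<le> t \<Longrightarrow> t < pi \<Longrightarrow> 0 \<le> sn X t"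
  using sn_pos[of t X] by (cases "t = 0") auto

lemma continuous_on_cs [continuous_intros]:
  assumes "continuous_on S f" shows "continuous_on S (\<lambda>t. cs X (f t))"
proof -
  have "cs Euclidean = (\<lambda>t. 1)" "cs Spherical = cos" "cs Hyperbolic = cosh"
    by (auto simp: cs_def)
  then have "continuous_on UNIV (cs X)"
    by (cases X) (simp_all add: continuous_on_cos continuous_on_cosh continuous_on_id)
  from continuous_on_compose2[OF this assms] show ?thesis by simp
qed

lemma continuous_on_sn [continuous_intros]:
  assumes "continuous_on S f" shows "continuous_on S (\<lambda>t. sn X (f t))"
proof -
  have "sn Euclidean = (\<lambda>t. t)" "sn Spherical = sin" "sn Hyperbolic = sinh"
    by (auto simp: sn_def)
  then have "continuous_on UNIV (sn X)"
    by (cases X) (simp_all add: continuous_on_sin continuous_on_sinh continuous_on_id)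
  from continuous_on_compose2[OF this assms] show ?thesis by simp
qed

lemma continuous_on_exp_M [continuous_intros]:
  assumes "continuous_on S f" "continuous_on S g"
  shows "continuous_on S (\<lambda>t. exp_M X z (f t) (g t))"
  unfolding exp_M_eq by (intro continuous_intros assms)

lemma exp_M_0 [simp]: "exp_M X x v 0 = x"
  by (simp add: exp_M_eq)

lemma velocity_0 [simp]: "velocity X x v 0 = v"
  by (simp add: velocity_eq)

lemma exp_M_linear: "linear f \<Longrightarrow> f (exp_M X x v t) = exp_M X (f x) (f v) t"
  by (simp add: exp_M_eq linear_add linear_scale)

lemma velocity_linear: "linear f \<Longrightarrow> f (velocity X x v t) = velocity X (f x) (f v) t"
  by (simp add: velocity_eq linear_add linear_scale linear_diff)

text \<open>Multiplied by \<open>sn X d\<close>, a point of a geodesic is a combination of two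
  others, with coefficients that are nonnegative for 0 \<le> s \<le> d < pi. This is the source of
  the convexity of half planes.\<close>

lemma exp_M_interpolate:
  "sn X d *\<^sub>R exp_M X x v s = sn X (d - s) *\<^sub>R x + sn X s *\<^sub>R exp_M X x v d"
  by (simp add: exp_M_eq sn_diff algebra_simps)

lemma velocity_add: "velocity X (exp_M X x u s) (velocity X x u s) r = velocity X x u (s + r)"
  by (cases X) (simp_all add: exp_M_def velocity_def vec_eq_iff cos_add sin_add cosh_add sinh_add algebra_simps)

section \<open>Unit tangent vectors\<close>

lemma unit_tangents_minus: "u \<in> unit_tangents X x \<Longrightarrow> - u \<in> unit_tangents X x"
  by (auto simp: unit_tangents_def form_simps split: geometry.splits)

lemma form_unit_tangent: "u \<in> unit_tangents X x \<Longrightarrow> form X u u = 1"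
  by (simp add: unit_tangents_def)

text \<open>The witness is a quarter turn in the plane, the cross product of \<open>p\<close> and
  \<open>u\<close> on the sphere, and the cross product with negated third coordinate on the
  hyperboloid. Lagrange's identity gives its length in the last two cases.\<close>

lemma ex_orthogonal_tangent:
  assumes p: "p \<in> surface X" and u: "u \<in> unit_tangents X p"
  obtains w where "w \<in> unit_tangents X p" "form X u w = 0"
proof (cases X)
  case Euclidean
  have "vector [- u$2, u$1, 0] \<in> unit_tangents X p" "form X u (vector [- u$2, u$1, 0]) = 0"
    using u Euclidean by (auto simp: unit_tangents_def form_def curvature_def vector_3 algebra_simps)
  then show thesis by (rule that)
next
  case Spherical
  let ?w = "vector [p$2 * u$3 - p$3 * u$2, p$3 * u$1 - p$1 * u$3, p$1 * u$2 - p$2 * u$1] :: real^3"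
  have "form X ?w ?w = form X p p * form X u u - (form X p u)\<^sup>2"
    by (simp add: form_def curvature_def vector_3 power2_eq_square algebra_simps Spherical)
  moreover have "form X p p = 1" "form X u u = 1" "form X p u = 0"
    using p u by (auto simp: Spherical surface_Spherical unit_tangents_def)
  ultimately have "form X ?w ?w = 1" by simp
  moreover have "form X p ?w = 0" "form X u ?w = 0"
    by (simp_all add: form_def curvature_def vector_3 algebra_simps Spherical)
  ultimately show thesis by (intro that[of ?w]) (auto simp: unit_tangents_def Spherical)
next
  case Hyperbolic
  let ?w = "vector [p$2 * u$3 - p$3 * u$2, p$3 * u$1 - p$1 * u$3, - (p$1 * u$2 - p$2 * u$1)] :: real^3"
  have "form X ?w ?w = (form X p u)\<^sup>2 - form X p p * form X u u"
    by (simp add: form_def curvature_def vector_3 power2_eq_square algebra_simps Hyperbolic)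
  moreover have "form X p p = -1" "form X u u = 1" "form X p u = 0"
    using p u by (auto simp: Hyperbolic surface_Hyperbolic unit_tangents_def)
  ultimately have "form X ?w ?w = 1" by simp
  moreover have "form X p ?w = 0" "form X u ?w = 0"
    by (simp_all add: form_def curvature_def vector_3 algebra_simps Hyperbolic)
  ultimately show thesis by (intro that[of ?w]) (auto simp: unit_tangents_def Hyperbolic)
qed

lemma spherical_form: "form Spherical a b = a \<bullet> b"
  by (simp add: form_def curvature_def inner_vec_def sum_3)

lemma ex_unit_tangent:
  assumes p: "p \<in> surface X"
  obtains u where "u \<in> unit_tangents X p"
proof (cases X)
  case Euclidean
  have "vector [1, 0, 0] \<in> unit_tangents X p"
    by (auto simp: unit_tangents_def form_def curvature_def vector_3 Euclidean)
  then show thesis by (rule that)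
next
  case Spherical
  obtain y where y: "y \<noteq> 0" "orthogonal p y"
    using orthogonal_to_vector_exists[of p] by auto
  let ?u = "(1 / norm y) *\<^sub>R y"
  have "?u \<bullet> ?u = 1" "p \<bullet> ?u = 0"
    using y by (simp_all add: orthogonal_def dot_square_norm power2_eq_square)
  then have "?u \<in> unit_tangents X p"
    unfolding unit_tangents_def Spherical spherical_form by simp
  then show thesis by (rule that)
next
  case Hyperbolic
  \<comment> \<open>Velocity of the Lorentz boost in the first and third coordinates; since
    \<open>p\<close> lies on the hyperboloid, its square (p$3)^2 - (p$1)^2 equals \<open>?n\<close>,
    which is positive.\<close>
  let ?v = "vector [p$3, 0, p$1] :: real^3"
  let ?n = "1 + (p$2)\<^sup>2"
  have n: "?n > 0" by (smt (verit) zero_le_power2)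
  have "form X p p = -1" using p by (auto simp: Hyperbolic surface_Hyperbolic)
  then have "form X ?v ?v = ?n"
    by (simp add: form_def curvature_def vector_3 Hyperbolic power2_eq_square algebra_simps)
  moreover have "form X p ?v = 0"
    by (simp add: form_def curvature_def vector_3 Hyperbolic)
  ultimately have "(1 / sqrt ?n) *\<^sub>R ?v \<in> unit_tangents X p"
    using n by (simp add: unit_tangents_def form_simps Hyperbolic real_sqrt_mult_self)
  then show thesis by (rule that)
qed

lemma unit_tangent_polar:
  assumes p: "p \<in> surface X" and u: "u \<in> unit_tangents X p" and w: "w \<in> unit_tangents X p"
    and uw: "form X u w = 0" and z: "z \<in> unit_tangents X p"
  obtains \<alpha> where "z = cos \<alpha> *\<^sub>R u + sin \<alpha> *\<^sub>R w"
proof -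
  obtain a b c where abc: "z = a *\<^sub>R p + b *\<^sub>R u + c *\<^sub>R w" using frame_spans[OF p u w uw] .
  have "a = 0"
  proof (cases X)
    case Euclidean
    then show ?thesis using p u w z by (simp add: abc surface_Euclidean unit_tangents_def)
  next
    case Spherical
    then show ?thesis using p u w z by (simp add: abc surface_Spherical unit_tangents_def form_simps)
  next
    case Hyperbolic
    then show ?thesis using p u w z by (simp add: abc surface_Hyperbolic unit_tangents_def form_simps)
  qed
  moreover have "form X w u = 0" using uw by (simp add: form_commute)
  ultimately have "form X z z = b * b + c * c"
    using u w uw by (simp add: abc form_simps unit_tangents_def)
  then have "b\<^sup>2 + c\<^sup>2 = 1" using z by (simp add: unit_tangents_def power2_eq_square)
  then obtain \<alpha> where "b = cos \<alpha>" "c = sin \<alpha>" using sincos_total_2pi by metis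
  then show thesis using that[of \<alpha>] abc \<open>a = 0\<close> by simp
qed

lemma polar_unit_tangent:
  assumes "u \<in> unit_tangents X p" "w \<in> unit_tangents X p" "form X u w = 0"
  shows "cos \<alpha> *\<^sub>R u + sin \<alpha> *\<^sub>R w \<in> unit_tangents X p"
proof -
  have "form X w u = 0" using assms(3) by (simp add: form_commute)
  then show ?thesis using assms sin_cos_squared_add2[of \<alpha>]
    by (auto simp: unit_tangents_def form_simps power2_eq_square split: geometry.splits)
qed

text \<open>Cauchy-Schwarz inequality with its equality cases. The form is not definite on all of
  \<open>real^3\<close> in every geometry, so the argument goes through the polar angle in the
  tangent plane.\<close>

lemma unit_tangents_form:
  assumes "p \<in> surface X" "u \<in> unit_tangents X p" "z \<in> unit_tangents X p"
  shows "\<bar>form X u z\<bar> \<le> 1" "form X u z = 1 \<Longrightarrow> z = u" "form X u z = -1 \<Longrightarrow> z = - u"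
proof -
  obtain w where w: "w \<in> unit_tangents X p" "form X u w = 0"
    using ex_orthogonal_tangent assms by metis
  obtain \<alpha> where z: "z = cos \<alpha> *\<^sub>R u + sin \<alpha> *\<^sub>R w"
    using unit_tangent_polar[OF assms(1,2) w assms(3)] .
  have f: "form X u z = cos \<alpha>" using w assms(2) by (simp add: z form_simps unit_tangents_def)
  show "\<bar>form X u z\<bar> \<le> 1" by (simp add: f)
  show "z = u" if "form X u z = 1"
    using that sin_cos_squared_add[of \<alpha>] by (simp add: z f[unfolded z])
  show "z = - u" if "form X u z = -1"
    using that sin_cos_squared_add[of \<alpha>] by (simp add: z f[unfolded z])
qed

section \<open>The distance of the model surfaces\<close>

text \<open>The intrinsic distance of \<open>M\<close>, encoded by its closed formula instead of an
  infimum of lengths; it has this meaning only for points of the surface, where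
  \<open>geodesic_to\<close> realises it as the length of a geodesic.\<close>

definition mdist :: "geometry \<Rightarrow> point \<Rightarrow> point \<Rightarrow> real" where
  "mdist X p q = (case X of
      Euclidean \<Rightarrow> sqrt (form X (p - q) (p - q))
    | Spherical \<Rightarrow> arccos (form X p q)
    | Hyperbolic \<Rightarrow> arcosh (- form X p q))"

lemma mdist_commute: "mdist X p q = mdist X q p"
  by (cases X) (simp_all add: mdist_def form_commute[of _ p q] form_simps algebra_simps)

lemma surface_form:
  assumes "p \<in> surface X" "X \<noteq> Euclidean"
  shows "form X p p = curvature X"
  using assms by (cases X) (auto simp: surface_Spherical surface_Hyperbolic curvature_def)

lemma unit_tangent_orthogonal:
  "u \<in> unit_tangents X p \<Longrightarrow> X \<noteq> Euclidean \<Longrightarrow> form X p u = 0"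
  by (cases X) (auto simp: unit_tangents_def)

text \<open>The length of the third side of a triangle with sides \<open>a\<close>, \<open>b\<close> enclosing an angle of cosine \<open>c\<close>.\<close>

definition cosine_rule :: "geometry \<Rightarrow> real \<Rightarrow> real \<Rightarrow> real \<Rightarrow> real" where
  "cosine_rule X a b c = (case X of
      Euclidean \<Rightarrow> sqrt (a\<^sup>2 + b\<^sup>2 - 2 * a * b * c)
    | Spherical \<Rightarrow> arccos (cos a * cos b + sin a * sin b * c)
    | Hyperbolic \<Rightarrow> arcosh (cosh a * cosh b - sinh a * sinh b * c))"

lemma mdist_exp_M:
  assumes m: "m \<in> surface X" and u: "u \<in> unit_tangents X m" and v: "v \<in> unit_tangents X m"
  shows "mdist X (exp_M X m u a) (exp_M X m v b) = cosine_rule X a b (form X u v)"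
proof -
  have f: "form X u u = 1" "form X v v = 1" "form X v u = form X u v"
    using u v by (auto simp: unit_tangents_def form_commute)
  have g: "form X m m = curvature X" "form X m u = 0" "form X m v = 0" "form X u m = 0" "form X v m = 0"
    if "X \<noteq> Euclidean"
    using that m u v surface_form unit_tangent_orthogonal form_commute by metis+
  show ?thesis
    using f g
    by (cases X; simp add: mdist_def cosine_rule_def exp_M_def form_simps curvature_def
      power2_eq_square algebra_simps)
qed

lemma cosine_rule_0: "0 \<le> b \<Longrightarrow> X = Spherical \<longrightarrow> b \<le> pi \<Longrightarrow> cosine_rule X 0 b c = b"
  by (cases X) (simp_all add: cosine_rule_def arccos_cos arcosh_cosh_real)

text \<open>Compared with the straight angle c = -1, where the rule gives a + b, the expressions
  under root, arccos and arcosh differ by a nonnegative multiple of 1 + c. On the sphere this works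
  only for a + b \<le> pi; beyond that the range of arccos gives the bound.\<close>

lemma cosine_rule_le:
  assumes "0 \<le> a" "0 \<le> b" "\<bar>c\<bar> \<le> 1"
  shows "cosine_rule X a b c \<le> a + b"
proof (cases X)
  case Euclidean
  have "a\<^sup>2 + b\<^sup>2 - 2 * a * b * c = (a + b)\<^sup>2 - 2 * (a * b) * (1 + c)"
    by (simp add: power2_eq_square algebra_simps)
  also have "\<dots> \<le> (a + b)\<^sup>2" using assms by simp
  finally show ?thesis using assms Euclidean real_le_lsqrt by (simp add: cosine_rule_def)
next
  case Spherical
  let ?d = "cos a * cos b + sin a * sin b * c"
  have d: "\<bar>?d\<bar> \<le> 1"
  proof -
    have "\<bar>sin a * sin b * c\<bar> \<le> \<bar>sin a * sin b\<bar>"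
      using assms(3) mult_left_le[of "\<bar>c\<bar>" "\<bar>sin a * sin b\<bar>"] by (simp add: abs_mult)
    moreover have "\<bar>cos a * cos b\<bar> + \<bar>sin a * sin b\<bar> \<le> 1"
      using abs_cos_le_one[of "a + b"] abs_cos_le_one[of "a - b"] unfolding cos_add cos_diff by linarith
    ultimately show ?thesis by linarith
  qed
  show ?thesis
  proof (cases "a + b \<le> pi")
    case True
    have "sin a * sin b * (1 + c) \<ge> 0"
      using assms True by (intro mult_nonneg_nonneg sin_ge_zero) auto
    then have "cos (a + b) \<le> ?d" by (simp add: cos_add algebra_simps)
    then have "arccos ?d \<le> arccos (cos (a + b))" using d by (intro arccos_le_mono[THEN iffD2]) auto
    then show ?thesis using True assms Spherical by (simp add: cosine_rule_def arccos_cos)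
  next
    case False
    have "arccos ?d \<le> pi" using d by (intro arccos_ubound) auto
    then show ?thesis using False Spherical by (simp add: cosine_rule_def)
  qed
next
  case Hyperbolic
  let ?d = "cosh a * cosh b - sinh a * sinh b * c"
  have s: "0 \<le> sinh a * sinh b" using assms by simp
  have "sinh a * sinh b * c \<le> sinh a * sinh b * 1" "sinh a * sinh b * (-1) \<le> sinh a * sinh b * c"
    using s assms(3) by (intro mult_left_mono; simp)+
  then have d: "cosh (a - b) \<le> ?d" "?d \<le> cosh (a + b)" by (simp_all add: cosh_add cosh_diff)
  then have "1 \<le> ?d" using cosh_real_ge_1[of "a - b"] by linarith
  then have "arcosh ?d \<le> arcosh (cosh (a + b))" using d cosh_real_ge_1[of "a + b"]
    by (metis arcosh_less_iff_real not_le)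
  then show ?thesis using assms Hyperbolic by (simp add: cosine_rule_def arcosh_cosh_real)
qed

text \<open>The same difference must now vanish. The bound a + b < pi makes both sines positive, so
  the factor 1 + c is zero.\<close>

lemma cosine_rule_eq:
  assumes "0 < a" "0 < b" "a + b < pi" "\<bar>c\<bar> \<le> 1" and eq: "cosine_rule X a b c = a + b"
  shows "c = -1"
proof (cases X)
  case Euclidean
  then have "sqrt (a\<^sup>2 + b\<^sup>2 - 2 * a * b * c) = a + b" using eq by (simp add: cosine_rule_def)
  then have "a\<^sup>2 + b\<^sup>2 - 2 * a * b * c = (a + b)\<^sup>2"
    using assms by (metis add_pos_pos real_sqrt_eq_iff real_sqrt_abs abs_of_pos)
  then have "a * b * (1 + c) = 0" by (simp add: power2_eq_square algebra_simps)
  then show ?thesis using assms by simp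
next
  case Spherical
  let ?d = "cos a * cos b + sin a * sin b * c"
  have "\<bar>sin a * sin b * c\<bar> \<le> \<bar>sin a * sin b\<bar>"
    using assms(4) mult_left_le[of "\<bar>c\<bar>" "\<bar>sin a * sin b\<bar>"] by (simp add: abs_mult)
  moreover have "\<bar>cos a * cos b\<bar> + \<bar>sin a * sin b\<bar> \<le> 1"
    using abs_cos_le_one[of "a + b"] abs_cos_le_one[of "a - b"] unfolding cos_add cos_diff by linarith
  ultimately have "cos (arccos ?d) = ?d" by (intro cos_arccos_abs) linarith
  then have "cos (a + b) = ?d" using eq Spherical by (simp add: cosine_rule_def)
  then have "sin a * sin b * (1 + c) = 0" by (simp add: cos_add algebra_simps)
  moreover have "sin a > 0" "sin b > 0" using assms by (auto intro: sin_gt_zero)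
  ultimately show ?thesis by simp
next
  case Hyperbolic
  let ?d = "cosh a * cosh b - sinh a * sinh b * c"
  have s: "0 \<le> sinh a * sinh b" using assms by simp
  have "sinh a * sinh b * c \<le> sinh a * sinh b * 1"
    using s assms(4) by (intro mult_left_mono; simp)
  then have d: "cosh (a - b) \<le> ?d" by (simp add: cosh_diff)
  then have "1 \<le> ?d" using cosh_real_ge_1[of "a - b"] by linarith
  then have "cosh (arcosh ?d) = ?d" by (simp add: cosh_arcosh_real)
  then have "cosh (a + b) = ?d" using eq Hyperbolic by (simp add: cosine_rule_def)
  then have "sinh a * sinh b * (1 + c) = 0" by (simp add: cosh_add algebra_simps)
  then show ?thesis using assms by simp
qed

lemma mdist_exp_M_base:
  assumes m: "m \<in> surface X" and u: "u \<in> unit_tangents X m" and b: "0 \<le> b" "X = Spherical \<longrightarrow> b \<le> pi"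
  shows "mdist X m (exp_M X m u b) = b"
  using mdist_exp_M[OF m u u, of 0 b] cosine_rule_0[OF b] by simp

text \<open>Reversed Cauchy-Schwarz inequality for timelike vectors: the square of
  \<open>p$3 * q$3\<close> exceeds that of \<open>1 + ?s\<close> by a sum of three squares, and
  positive third coordinates fix the sign of the root.\<close>

lemma hyperbolic_form_le:
  assumes "p \<in> surface Hyperbolic" "q \<in> surface Hyperbolic"
  shows "form Hyperbolic p q \<le> -1" "form Hyperbolic p q = -1 \<Longrightarrow> q = p"
proof -
  let ?s = "p$1 * q$1 + p$2 * q$2"
  have p: "(p$3)\<^sup>2 = 1 + (p$1)\<^sup>2 + (p$2)\<^sup>2" "p$3 > 0"
    and q: "(q$3)\<^sup>2 = 1 + (q$1)\<^sup>2 + (q$2)\<^sup>2" "q$3 > 0"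
    using assms by (auto simp: surface_Hyperbolic form_def curvature_def power2_eq_square)
  have "(p$3 * q$3)\<^sup>2 = (p$3)\<^sup>2 * (q$3)\<^sup>2" by (simp add: power_mult_distrib)
  also have "\<dots> = (1 + (p$1)\<^sup>2 + (p$2)\<^sup>2) * (1 + (q$1)\<^sup>2 + (q$2)\<^sup>2)" by (simp add: p q)
  also have "\<dots> = (1 + ?s)\<^sup>2 + (p$1 - q$1)\<^sup>2 + (p$2 - q$2)\<^sup>2 + (p$1 * q$2 - p$2 * q$1)\<^sup>2"
    by (simp add: power2_eq_square algebra_simps)
  finally have key: "(p$3 * q$3)\<^sup>2 = (1 + ?s)\<^sup>2 + ((p$1 - q$1)\<^sup>2 + (p$2 - q$2)\<^sup>2 + (p$1 * q$2 - p$2 * q$1)\<^sup>2)"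
    by simp
  have pq: "p$3 * q$3 > 0" using p q by simp
  have "(1 + ?s)\<^sup>2 \<le> (p$3 * q$3)\<^sup>2" unfolding key by simp
  then have "1 + ?s \<le> p$3 * q$3" by (rule power2_le_imp_le) (use pq in simp)
  then show "form Hyperbolic p q \<le> -1" by (simp add: form_def curvature_def)
  assume "form Hyperbolic p q = -1"
  then have "p$3 * q$3 = 1 + ?s" by (simp add: form_def curvature_def)
  then have "(p$1 - q$1)\<^sup>2 + (p$2 - q$2)\<^sup>2 + (p$1 * q$2 - p$2 * q$1)\<^sup>2 = 0" using key by simp
  then have e: "p$1 = q$1" "p$2 = q$2"
    by (smt (verit) zero_le_power2 power2_eq_iff_nonneg zero_eq_power2)+
  then have "(p$3)\<^sup>2 = (q$3)\<^sup>2" using p q by simp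
  then have "p$3 = q$3" using p(2) q(2) by (simp add: power2_eq_iff)
  then show "q = p" using e by (simp add: vec_eq_iff forall_3)
qed

text \<open>Gram-Schmidt: the difference of \<open>q\<close> and \<open>cs X d *\<^sub>R p\<close>,
  divided by \<open>sn X d\<close>, is the initial direction, where \<open>d\<close> is the
  distance. If \<open>sn X d\<close> vanishes, the points coincide or are antipodal, and every
  direction leads to \<open>q\<close>.\<close>

lemma geodesic_to:
  assumes p: "p \<in> surface X" and q: "q \<in> surface X"
  obtains u where "u \<in> unit_tangents X p" "q = exp_M X p u (mdist X p q)"
    "0 \<le> mdist X p q" "X = Spherical \<longrightarrow> mdist X p q \<le> pi"
proof -
  let ?d = "mdist X p q"
  have 1: "0 \<le> ?d \<and> (X = Spherical \<longrightarrow> ?d \<le> pi)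
    \<and> (X \<noteq> Euclidean \<longrightarrow> cs X ?d = curvature X * form X p q)
    \<and> (sn X ?d = 0 \<longrightarrow> q = cs X ?d *\<^sub>R p)"
  proof (cases X)
    case Euclidean
    have f: "form X (p - q) (p - q) = (p$1 - q$1)\<^sup>2 + (p$2 - q$2)\<^sup>2"
      by (simp add: Euclidean form_def curvature_def power2_eq_square)
    have "q = p" if "?d = 0"
    proof -
      have "(p$1 - q$1)\<^sup>2 + (p$2 - q$2)\<^sup>2 = 0" using that f by (simp add: mdist_def Euclidean)
      then have "p$1 = q$1" "p$2 = q$2" by (auto simp: sum_power2_eq_zero_iff)
      moreover have "p$3 = q$3" using p q by (simp add: Euclidean surface_Euclidean)
      ultimately show ?thesis by (simp add: vec_eq_iff forall_3)
    qed
    moreover have "0 \<le> ?d" using f by (simp add: mdist_def Euclidean)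
    ultimately show ?thesis by (simp add: Euclidean sn_def cs_def)
  next
    case Spherical
    have n: "norm p = 1" "norm q = 1" using p q by (auto simp: Spherical surface_def)
    then have b: "\<bar>p \<bullet> q\<bar> \<le> 1" using Cauchy_Schwarz_ineq2[of p q] by simp
    have d: "?d = arccos (p \<bullet> q)" by (simp add: mdist_def Spherical spherical_form)
    have c: "cos ?d = p \<bullet> q" using b by (simp add: d cos_arccos_abs)
    have "q = cos ?d *\<^sub>R p" if "sin ?d = 0"
    proof -
      have "(p \<bullet> q)\<^sup>2 = 1" using that sin_cos_squared_add[of ?d] c by simp
      moreover have "(norm (q - (p \<bullet> q) *\<^sub>R p))\<^sup>2 = 1 - (p \<bullet> q)\<^sup>2"
        using n unfolding power2_norm_eq_inner norm_eq_1
        by (simp add: inner_diff_left inner_diff_right inner_commute[of q p] power2_eq_square)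
      ultimately show ?thesis by (simp add: c)
    qed
    then show ?thesis using b c arccos_lbound[of "p \<bullet> q"] arccos_ubound[of "p \<bullet> q"]
      by (simp add: Spherical cs_def sn_def curvature_def spherical_form d[unfolded Spherical] abs_le_iff)
  next
    case Hyperbolic
    have f: "form X p q \<le> -1" "form X p q = -1 \<Longrightarrow> q = p"
      using hyperbolic_form_le p q by (auto simp: Hyperbolic)
    have d: "?d = arcosh (- form X p q)" by (simp add: mdist_def Hyperbolic)
    have "0 \<le> ?d" "cosh ?d = - form X p q" using f(1) by (auto simp: d)
    moreover have "q = cosh ?d *\<^sub>R p" if "sinh ?d = 0"
      using that f(2) calculation by simp
    ultimately show ?thesis by (simp add: Hyperbolic cs_def sn_def curvature_def)
  qed
  obtain u0 where u0: "u0 \<in> unit_tangents X p" using ex_unit_tangent[OF p] .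
  show thesis
  proof (cases "sn X ?d = 0")
    case True
    then have "q = exp_M X p u0 ?d" using 1 by (simp add: exp_M_eq)
    then show thesis using that[OF u0] 1 by blast
  next
    case False
    let ?r = "q - cs X ?d *\<^sub>R p"
    have "form X ?r ?r = (sn X ?d)\<^sup>2 \<and> (if X = Euclidean then ?r$3 = 0 else form X p ?r = 0)"
    proof (cases "X = Euclidean")
      case True
      have "0 \<le> form X (p - q) (p - q)" by (simp add: True form_def curvature_def)
      then have "(sn X ?d)\<^sup>2 = form X (p - q) (p - q)" by (simp add: True sn_def mdist_def)
      then show ?thesis using p q
        by (simp add: True cs_def form_def surface_Euclidean algebra_simps)
    next
      case False
      have k: "curvature X * curvature X = 1" using False by (cases X) (auto simp: curvature_def)
      have c: "cs X ?d = curvature X * form X p q" using 1 False by blast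
      have pp: "form X p p = curvature X" "form X q q = curvature X"
        using surface_form False p q by auto
      have f: "form X p q = curvature X * cs X ?d" using c k by (simp add: mult.assoc[symmetric])
      have "form X ?r ?r = curvature X * (1 - cs X ?d * cs X ?d)"
        using pp f by (simp add: form_simps form_commute[of X q p] algebra_simps)
      also have "1 - cs X ?d * cs X ?d = curvature X * (sn X ?d * sn X ?d)"
        using cs_sn_square[of X ?d] by simp
      also have "curvature X * \<dots> = (sn X ?d)\<^sup>2" using k by (simp add: mult.assoc[symmetric] power2_eq_square)
      finally have "form X ?r ?r = (sn X ?d)\<^sup>2" .
      moreover have "form X p ?r = 0" using pp f by (simp add: form_simps)
      ultimately show ?thesis using False by simp
    qed
    then obtain r where r: "r = ?r" "form X r r = (sn X ?d)\<^sup>2"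
      "if X = Euclidean then r$3 = 0 else form X p r = 0" by blast
    have "(1 / sn X ?d) *\<^sub>R r \<in> unit_tangents X p"
      using False r(2,3) by (cases X) (simp_all add: unit_tangents_def form_simps power2_eq_square)
    moreover have "q = exp_M X p ((1 / sn X ?d) *\<^sub>R r) ?d" using False by (simp add: exp_M_eq r(1))
    ultimately show thesis using that 1 by blast
  qed
qed

section \<open>Metric axioms and shortest arcs\<close>

lemma mdist_self: "p \<in> surface X \<Longrightarrow> mdist X p p = 0"
  by (metis ex_unit_tangent exp_M_0 mdist_exp_M_base order_refl pi_ge_zero)

lemma mdist_nonneg: "p \<in> surface X \<Longrightarrow> q \<in> surface X \<Longrightarrow> 0 \<le> mdist X p q"
  by (metis geodesic_to)

lemma mdist_0_eq: "p \<in> surface X \<Longrightarrow> q \<in> surface X \<Longrightarrow> mdist X p q = 0 \<Longrightarrow> q = p"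
  by (metis exp_M_0 geodesic_to)

lemma mdist_triangle:
  assumes "p \<in> surface X" "q \<in> surface X" "m \<in> surface X"
  shows "mdist X p q \<le> mdist X p m + mdist X m q"
proof -
  obtain u where u: "u \<in> unit_tangents X m" "p = exp_M X m u (mdist X m p)" "0 \<le> mdist X m p"
    using geodesic_to assms by metis
  obtain v where v: "v \<in> unit_tangents X m" "q = exp_M X m v (mdist X m q)" "0 \<le> mdist X m q"
    using geodesic_to assms by metis
  have "mdist X p q = cosine_rule X (mdist X m p) (mdist X m q) (form X u v)"
    using mdist_exp_M[OF assms(3) u(1) v(1), of "mdist X m p" "mdist X m q"] u(2) v(2) by simp
  also have "\<dots> \<le> mdist X m p + mdist X m q"
    using u v unit_tangents_form[OF assms(3)] by (intro cosine_rule_le) auto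
  finally show ?thesis by (simp add: mdist_commute)
qed

lemma mdist_exp_M_le:
  assumes p: "p \<in> surface X" and u: "u \<in> unit_tangents X p" and "0 \<le> l"
  shows "mdist X p (exp_M X p u l) \<le> l"
  using mdist_exp_M[OF p u u, of 0 l] cosine_rule_le[of 0 l "form X u u" X] assms
  by (simp add: form_unit_tangent)

text \<open>Equality in the triangle inequality at the point of time \<open>s\<close> means a
  straight angle there by \<open>cosine_rule_eq\<close>, so the way to \<open>q\<close> continues
  the geodesic. This is the tool that forbids a projected geodesic to turn.\<close>

lemma geodesic_extension_unique:
  assumes p: "p \<in> surface X" and v: "v \<in> unit_tangents X p" and q: "q \<in> surface X"
    and ab: "0 < a" "0 < b" "a + b < pi"
    and d1: "mdist X (exp_M X p v s) q = b" and d2: "mdist X (exp_M X p v (s - a)) q = a + b"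
  shows "q = exp_M X p v (s + b)"
proof -
  let ?m = "exp_M X p v s" and ?w = "velocity X p v s"
  have m: "?m \<in> surface X" and w: "?w \<in> unit_tangents X ?m" using exp_M_surface[OF p v] by auto
  obtain u where u: "u \<in> unit_tangents X ?m" "q = exp_M X ?m u b"
    using geodesic_to[OF m q] d1 by metis
  have "mdist X (exp_M X ?m (- ?w) a) q = cosine_rule X a b (form X (- ?w) u)"
    unfolding u(2) using m w u by (intro mdist_exp_M unit_tangents_minus)
  then have "cosine_rule X a b (form X (- ?w) u) = a + b" using d2 by (simp add: exp_M_add)
  moreover have "\<bar>form X (- ?w) u\<bar> \<le> 1"
    using m w u by (intro unit_tangents_form unit_tangents_minus)
  ultimately have "form X (- ?w) u = -1" using ab cosine_rule_eq by blast
  then have "u = ?w" using unit_tangents_form(2)[OF m w u(1)] by (simp add: form_simps)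
  then show ?thesis using u(2) by (simp add: exp_M_add)
qed

lemma mdist_geodesic:
  assumes "x \<in> surface X" "v \<in> unit_tangents X x" "r \<le> r'" "r' - r \<le> pi"
  shows "mdist X (exp_M X x v r) (exp_M X x v r') = r' - r"
  using mdist_exp_M_base[OF exp_M_surface[OF assms(1,2)], of "r' - r" r] assms(3,4)
  by (simp add: exp_M_add)

section \<open>Topology\<close>

text \<open>Together with \<open>open_in_ball\<close> this relates metric balls to the topology of
  \<open>real^3\<close>, in which polygons are defined. Radii at most 1 keep distances from the
  centre below pi.\<close>

lemma ball_in_open:
  assumes y: "y \<in> surface X" and U: "open U" "y \<in> U"
  obtains e where "0 < e" "e \<le> 1" "\<And>z. z \<in> surface X \<Longrightarrow> mdist X y z < e \<Longrightarrow> z \<in> U"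
proof -
  obtain u where u: "u \<in> unit_tangents X y" using ex_unit_tangent[OF y] .
  obtain w where w: "w \<in> unit_tangents X y" "form X u w = 0" using ex_orthogonal_tangent[OF y u] .
  obtain r where r: "r > 0" "ball y r \<subseteq> U" using U open_contains_ball by blast
  \<comment> \<open>A bound for the displacement at distance \<open>d\<close> that is uniform in the
    direction, because every unit tangent at \<open>y\<close> has norm at most
    \<open>norm u + norm w\<close>.\<close>
  let ?h = "\<lambda>d. \<bar>cs X d - 1\<bar> * norm y + \<bar>sn X d\<bar> * (norm u + norm w)"
  have "continuous_on UNIV ?h" by (intro continuous_intros)
  then have "open {d. ?h d < r}" by (intro open_Collect_less continuous_on_const)
  moreover have "0 \<in> {d. ?h d < r}" using r by simp
  ultimately obtain e where e: "e > 0" "ball 0 e \<subseteq> {d. ?h d < r}" using open_contains_ball by blast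
  show thesis
  proof (rule that)
    show "0 < min e 1" "min e 1 \<le> 1" using e by auto
    fix z assume z: "z \<in> surface X" "mdist X y z < min e 1"
    obtain v where v: "v \<in> unit_tangents X y" "z = exp_M X y v (mdist X y z)" "0 \<le> mdist X y z"
      using geodesic_to[OF y z(1)] by metis
    obtain \<alpha> where \<alpha>: "v = cos \<alpha> *\<^sub>R u + sin \<alpha> *\<^sub>R w" using unit_tangent_polar[OF y u w v(1)] .
    have "norm v \<le> \<bar>cos \<alpha>\<bar> * norm u + \<bar>sin \<alpha>\<bar> * norm w"
      unfolding \<alpha> by (rule order_trans[OF norm_triangle_ineq]) simp
    also have "\<dots> \<le> norm u + norm w" by (intro add_mono mult_left_le_one_le) auto
    finally have nv: "norm v \<le> norm u + norm w" .
    have "z - y = (cs X (mdist X y z) - 1) *\<^sub>R y + sn X (mdist X y z) *\<^sub>R v"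
      using v(2) by (simp add: exp_M_eq algebra_simps)
    then have "norm (z - y) \<le> \<bar>cs X (mdist X y z) - 1\<bar> * norm y + \<bar>sn X (mdist X y z)\<bar> * norm v"
      by (metis norm_triangle_ineq norm_scaleR real_norm_def)
    also have "\<dots> \<le> ?h (mdist X y z)" using nv by (intro add_mono mult_left_mono) auto
    also have "\<dots> < r" using e z v(3) by (auto simp: subset_iff)
    finally show "z \<in> U" using r by (auto simp: subset_iff dist_norm norm_minus_commute)
  qed
qed

lemma open_in_ball:
  assumes y: "y \<in> surface X" and e: "0 < e" "e \<le> 1"
  obtains U where "open U" "y \<in> U" "\<And>z. z \<in> U \<Longrightarrow> z \<in> surface X \<Longrightarrow> mdist X y z < e"
proof -
  have C: "continuous_on UNIV (\<lambda>z. form X (y - z) (y - z))" "continuous_on UNIV (\<lambda>z. form X y z)"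
    by (auto simp: form_def intro!: continuous_intros)
  show thesis
  proof (cases X)
    case Euclidean
    show thesis
    proof (rule that)
      show "open {z. form X (y - z) (y - z) < e\<^sup>2}"
        by (rule open_Collect_less) (use C in auto)
      show "y \<in> {z. form X (y - z) (y - z) < e\<^sup>2}" using e by (simp add: form_simps)
      fix z assume "z \<in> {z. form X (y - z) (y - z) < e\<^sup>2}"
      then have "sqrt (form X (y - z) (y - z)) < e" using e by (simp add: real_sqrt_less_iff real_less_lsqrt)
      then show "mdist X y z < e" by (simp add: mdist_def Euclidean)
    qed
  next
    case Spherical
    show thesis
    proof (rule that)
      show "open {z. cos e < form X y z}" by (rule open_Collect_less) (use C in auto)
      have "cos e < cos 0" using e pi_gt3 by (intro cos_monotone_0_pi) auto
      then show "y \<in> {z. cos e < form X y z}" using y by (simp add: surface_Spherical Spherical)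
      fix z assume z: "z \<in> {z. cos e < form X y z}" "z \<in> surface X"
      obtain u where u: "z = exp_M X y u (mdist X y z)" "0 \<le> mdist X y z" "mdist X y z \<le> pi"
        using geodesic_to[OF y z(2)] Spherical by metis
      have "norm y = 1" "norm z = 1" using y z by (auto simp: Spherical surface_def)
      then have "\<bar>form X y z\<bar> \<le> 1" using Cauchy_Schwarz_ineq2[of y z] by (simp add: Spherical spherical_form)
      then have "cos (mdist X y z) = form X y z" by (simp add: mdist_def Spherical cos_arccos_abs)
      then have "cos e < cos (mdist X y z)" using z by simp
      then show "mdist X y z < e" using e u pi_gt3 cos_mono_less_eq[of e "mdist X y z"] by simp
    qed
  next
    case Hyperbolic
    show thesis
    proof (rule that)
      show "open {z. - form X y z < cosh e}" by (rule open_Collect_less) (use C in \<open>auto intro!: continuous_intros\<close>)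
      have "form X y y = -1" using y by (simp add: Hyperbolic surface_Hyperbolic)
      then show "y \<in> {z. - form X y z < cosh e}"
        using e cosh_real_nonneg_less_iff[of 0 e] by simp
      fix z assume z: "z \<in> {z. - form X y z < cosh e}" "z \<in> surface X"
      have "1 \<le> - form X y z" using hyperbolic_form_le(1)[of y z] y z(2) by (simp add: Hyperbolic)
      then have "arcosh (- form X y z) < arcosh (cosh e)" using z by (simp del: arcosh_cosh_real)
      then show "mdist X y z < e" using e by (simp add: mdist_def Hyperbolic arcosh_cosh_real)
    qed
  qed
qed

section \<open>Motions and reflections\<close>

definition motion :: "geometry \<Rightarrow> (point \<Rightarrow> point) \<Rightarrow> bool" where
  "motion X f \<longleftrightarrow> linear f \<and>
     (\<forall>z\<in>surface X. f z \<in> surface X \<and> (\<forall>u\<in>unit_tangents X z. f u \<in> unit_tangents X (f z)))"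

lemma motion_id: "motion X id"
  by (simp add: motion_def linear_ident[folded id_def])

lemma motion_comp: "motion X f \<Longrightarrow> motion X g \<Longrightarrow> motion X (f \<circ> g)"
  by (auto simp: motion_def intro: linear_compose)

lemma motion_exp_M: "motion X f \<Longrightarrow> f (exp_M X z u t) = exp_M X (f z) (f u) t"
  by (simp add: motion_def exp_M_linear)

lemma motion_surface: "motion X f \<Longrightarrow> z \<in> surface X \<Longrightarrow> f z \<in> surface X"
  by (simp add: motion_def)

lemma motion_unit_tangent:
  "motion X f \<Longrightarrow> z \<in> surface X \<Longrightarrow> u \<in> unit_tangents X z \<Longrightarrow> f u \<in> unit_tangents X (f z)"
  by (simp add: motion_def)

lemma motion_mdist:
  assumes f: "motion X f" and z: "z \<in> surface X" "z' \<in> surface X"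
  shows "mdist X (f z) (f z') = mdist X z z'"
proof -
  obtain u where u: "u \<in> unit_tangents X z" "z' = exp_M X z u (mdist X z z')"
    "0 \<le> mdist X z z'" "X = Spherical \<longrightarrow> mdist X z z' \<le> pi"
    using geodesic_to[OF z] .
  have "f z' = exp_M X (f z) (f u) (mdist X z z')" using motion_exp_M[OF f] u(2) by metis
  then show ?thesis
    using mdist_exp_M_base[OF motion_surface[OF f z(1)] motion_unit_tangent[OF f z(1) u(1)] u(3,4)]
    by simp
qed

text \<open>The sign tells on which side of the geodesic through \<open>p\<close> with normal \<open>w\<close> a point lies.
  The term \<open>y$3\<close> only matters in the Euclidean case, since \<open>form X p w = 0\<close> otherwise.\<close>

definition height :: "geometry \<Rightarrow> point \<Rightarrow> point \<Rightarrow> point \<Rightarrow> real" where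
  "height X p w y = form X (y - (y$3) *\<^sub>R p) w"

lemma frame_reflection_eq: "frame_reflection X p w y = y - (2 * height X p w y) *\<^sub>R w"
  by (simp add: frame_reflection_def height_def)

lemma linear_height: "linear (height X p w)"
  by (rule linearI) (simp_all add: height_def form_simps scaleR_add_left algebra_simps)

lemma height_exp_M: "height X p w (exp_M X z u t) = cs X t * height X p w z + sn X t * height X p w u"
  by (simp add: exp_M_eq linear_add[OF linear_height] linear_scale[OF linear_height])

lemma height_tangent:
  assumes "w \<in> unit_tangents X p" "z \<in> unit_tangents X q"
  shows "height X p w z = form X z w"
  using assms by (cases X) (simp_all add: height_def form_simps unit_tangents_def)

lemma height_base:
  assumes "p \<in> surface X" "w \<in> unit_tangents X p"
  shows "height X p w p = 0"
  using assms by (cases X) (simp_all add: height_def form_simps unit_tangents_def surface_Euclidean)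

lemma height_normal: "w \<in> unit_tangents X p \<Longrightarrow> height X p w w = 1"
  by (simp add: height_tangent form_unit_tangent)

lemma height_frame_reflection:
  assumes "w \<in> unit_tangents X p"
  shows "height X p w (frame_reflection X p w y) = - height X p w y"
  using assms by (simp add: frame_reflection_eq linear_diff[OF linear_height]
      linear_scale[OF linear_height] height_normal)

lemma frame_reflection_involution:
  assumes "w \<in> unit_tangents X p"
  shows "frame_reflection X p w (frame_reflection X p w y) = y"
  unfolding frame_reflection_eq[of X p w "frame_reflection X p w y"] height_frame_reflection[OF assms]
  by (simp add: frame_reflection_eq)

lemma frame_reflection_form:
  assumes "w \<in> unit_tangents X p" "X = Euclidean \<Longrightarrow> y$3 = 0 \<and> z$3 = 0"
  shows "form X (frame_reflection X p w y) (frame_reflection X p w z) = form X y z"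
proof -
  have h: "height X p w y = form X y w" "height X p w z = form X z w"
    using assms by (cases X; auto simp: height_def form_simps unit_tangents_def)+
  have "form X w w = 1" using assms by (simp add: form_unit_tangent)
  then show ?thesis by (simp add: frame_reflection_eq h form_simps form_commute[of X w z] algebra_simps)
qed

lemma motion_frame_reflection:
  assumes p: "p \<in> surface X" and w: "w \<in> unit_tangents X p"
  shows "motion X (frame_reflection X p w)"
proof -
  let ?R = "frame_reflection X p w"
  have lin: "linear ?R"
  proof -
    obtain u where "u \<in> unit_tangents X p" "form X w u = 0" using ex_orthogonal_tangent[OF p w] .
    then show ?thesis using frame_reflection_props(1)[OF p _ w] by (simp add: form_commute)
  qed
  have Rp: "?R p = p" by (simp add: frame_reflection_eq height_base[OF p w])
  have tan: "?R u \<in> unit_tangents X (?R z)" if "u \<in> unit_tangents X z" for u z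
  proof -
    have 1: "form X (?R u) (?R u) = 1"
      using frame_reflection_form[OF w, of u u] that by (auto simp: unit_tangents_def split: geometry.splits)
    show ?thesis
    proof (cases "X = Euclidean")
      case True
      then show ?thesis using 1 that w by (simp add: unit_tangents_def frame_reflection_eq)
    next
      case False
      then have "form X (?R z) (?R u) = 0"
        using frame_reflection_form[OF w, of z u] unit_tangent_orthogonal[OF that] by simp
      then show ?thesis using 1 False by (cases X) (auto simp: unit_tangents_def)
    qed
  qed
  have "?R z \<in> surface X" if z: "z \<in> surface X" for z
  proof -
    \<comment> \<open>Reaching \<open>z\<close> by a geodesic from the fixed point \<open>p\<close>
      reduces the claim to tangent vectors; on the hyperboloid this also settles on which sheet the
      image lies.\<close>
    obtain v where v: "v \<in> unit_tangents X p" "z = exp_M X p v (mdist X p z)"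
      using geodesic_to[OF p z] .
    have "?R z = exp_M X p (?R v) (mdist X p z)"
      using exp_M_linear[OF lin, of X p v "mdist X p z"] v(2) Rp by simp
    moreover have "?R v \<in> unit_tangents X p" using tan[OF v(1)] Rp by simp
    ultimately show ?thesis using exp_M_surface(1)[OF p] by metis
  qed
  then show ?thesis using lin tan by (simp add: motion_def)
qed

section \<open>Reflections in sides\<close>

lemma geodesic_segment_frame:
  assumes "geodesic_segment X a p q"
  obtains u w l where "p \<in> surface X" "u \<in> unit_tangents X p" "w \<in> unit_tangents X p"
    "form X u w = 0" "0 < l" "X = Spherical \<longrightarrow> l < 2 * pi" "a = exp_M X p u ` {0..l}"
    "q = exp_M X p u l" "side_reflection X a = frame_reflection X p w"
proof -
  obtain u l where u: "p \<in> surface X" "u \<in> unit_tangents X p" "0 < l" "X = Spherical \<longrightarrow> l < 2 * pi"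
    "a = exp_M X p u ` {0..l}" "q = exp_M X p u l"
    using assms by (auto simp: geodesic_segment_def)
  obtain w where w: "w \<in> unit_tangents X p" "form X u w = 0" using ex_orthogonal_tangent[OF u(1,2)] .
  show thesis using that[OF u(1,2) w u(3-6)] side_reflection_eq[OF u(1,2) w u(3)] u(5) by simp
qed

lemma height_geodesic:
  assumes "p \<in> surface X" "u \<in> unit_tangents X p" "w \<in> unit_tangents X p" "form X u w = 0"
  shows "height X p w (exp_M X p u s) = 0"
  using assms by (simp add: height_exp_M height_base height_tangent)

lemma frame_reflection_fixes: "height X p w y = 0 \<Longrightarrow> frame_reflection X p w y = y"
  by (simp add: frame_reflection_eq)

lemma side_reflection_motion: "geodesic_segment X a p q \<Longrightarrow> motion X (side_reflection X a)"
  by (metis geodesic_segment_frame motion_frame_reflection)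

lemma side_reflection_involution:
  "geodesic_segment X a p q \<Longrightarrow> side_reflection X a (side_reflection X a y) = y"
  by (metis geodesic_segment_frame frame_reflection_involution)

lemma side_reflection_fixes:
  assumes "geodesic_segment X a p q" "y \<in> a"
  shows "side_reflection X a y = y"
proof -
  obtain u w l where f: "p \<in> surface X" "u \<in> unit_tangents X p" "w \<in> unit_tangents X p"
    "form X u w = 0" "a = exp_M X p u ` {0..l}" "side_reflection X a = frame_reflection X p w"
    using geodesic_segment_frame[OF assms(1)] by metis
  then show ?thesis using assms(2) height_geodesic[OF f(1-4)] by (auto intro: frame_reflection_fixes)
qed

lemma frame_reflection_minus: "frame_reflection X p (- w) = frame_reflection X p w"
  by (simp add: frame_reflection_def fun_eq_iff form_simps algebra_simps)

text \<open>The reflection fixes the points of \<open>a\<close> in direction \<open>u\<close>, so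
  its normal is orthogonal to \<open>u\<close>, hence \<open>w\<close> or \<open>- w\<close>, and
  the sign does not affect the reflection. This allows the reflections in both sides of a corner to
  be written in one frame.\<close>

lemma side_reflection_at_endpoint:
  assumes a: "geodesic_segment X a p q" and u: "u \<in> directions X a p"
    and w: "w \<in> unit_tangents X p" and uw: "form X u w = 0"
  shows "side_reflection X a = frame_reflection X p w"
proof -
  obtain v where p: "p \<in> surface X" and v: "v \<in> unit_tangents X p"
    and R: "side_reflection X a = frame_reflection X p v"
    using geodesic_segment_frame[OF a] by metis
  obtain e where e: "e > 0" "\<forall>t\<in>{0..e}. exp_M X p u t \<in> a" and ut: "u \<in> unit_tangents X p"
    using u by (auto simp: directions_def)
  define t where "t = min e 1"
  have t: "0 < t" "t \<le> e" "t < pi" using e pi_gt3 by (auto simp: t_def)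
  have "frame_reflection X p v (exp_M X p u t) = exp_M X p u t"
    using side_reflection_fixes[OF a, of "exp_M X p u t"] e t R by simp
  moreover have "v \<noteq> 0" using form_unit_tangent[OF v] by (auto simp: form_simps)
  ultimately have "height X p v (exp_M X p u t) = 0" by (simp add: frame_reflection_eq)
  then have "sn X t * form X u v = 0"
    by (simp add: height_exp_M height_base[OF p v] height_tangent[OF v ut])
  then have uv: "form X u v = 0" using sn_pos[OF t(1,3)] by (metis mult_eq_0_iff less_irrefl)
  obtain \<alpha> where \<alpha>: "v = cos \<alpha> *\<^sub>R u + sin \<alpha> *\<^sub>R w" using unit_tangent_polar[OF p ut w uw v] .
  have "cos \<alpha> = 0" using uv form_unit_tangent[OF ut] uw by (simp add: \<alpha> form_simps)
  moreover from this have "sin \<alpha> = 1 \<or> sin \<alpha> = -1"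
    using sin_cos_squared_add[of \<alpha>] by (simp add: power2_eq_1_iff)
  ultimately have "v = w \<or> v = - w" by (auto simp: \<alpha>)
  then show ?thesis using R frame_reflection_minus by metis
qed

text \<open>Reflection in the line at angle \<theta>, whose normal stands at \<theta> + pi / 2,
  sends the angle \<phi> to 2 \<theta> - \<phi>.\<close>

lemma frame_reflection_polar:
  assumes p: "p \<in> surface X" and u: "u \<in> unit_tangents X p" and w: "w \<in> unit_tangents X p"
    and uw: "form X u w = 0"
  shows "frame_reflection X p (cos (\<theta> + pi / 2) *\<^sub>R u + sin (\<theta> + pi / 2) *\<^sub>R w)
      (cos \<phi> *\<^sub>R u + sin \<phi> *\<^sub>R w) = cos (2 * \<theta> - \<phi>) *\<^sub>R u + sin (2 * \<theta> - \<phi>) *\<^sub>R w"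
proof -
  let ?v = "\<lambda>\<phi>. cos \<phi> *\<^sub>R u + sin \<phi> *\<^sub>R w"
  have T: "?v \<phi> \<in> unit_tangents X p" for \<phi> by (rule polar_unit_tangent[OF u w uw])
  have "form X u u = 1" "form X w w = 1" "form X w u = 0"
    using u w uw by (auto simp: unit_tangents_def form_commute)
  then have "form X (?v \<phi>) (?v (\<theta> + pi / 2)) = cos \<phi> * cos (\<theta> + pi / 2) + sin \<phi> * sin (\<theta> + pi / 2)"
    using uw by (simp only: form_simps) simp
  also have "\<dots> = sin (\<phi> - \<theta>)" by (simp add: cos_add sin_add sin_diff)
  finally have "height X p (?v (\<theta> + pi / 2)) (?v \<phi>) = sin (\<phi> - \<theta>)"
    using height_tangent[OF T T] by simp
  moreover have "cos \<phi> - 2 * sin (\<phi> - \<theta>) * cos (\<theta> + pi / 2) = cos (2 * \<theta> - \<phi>)"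
    "sin \<phi> - 2 * sin (\<phi> - \<theta>) * sin (\<theta> + pi / 2) = sin (2 * \<theta> - \<phi>)"
  proof -
    have "2 * sin (\<phi> - \<theta>) * sin \<theta> = cos (\<phi> - 2 * \<theta>) - cos \<phi>"
      using sin_times_sin[of "\<phi> - \<theta>" \<theta>] by (simp add: algebra_simps)
    moreover have "cos (\<phi> - 2 * \<theta>) = cos (2 * \<theta> - \<phi>)" by (metis cos_minus minus_diff_eq)
    ultimately show "cos \<phi> - 2 * sin (\<phi> - \<theta>) * cos (\<theta> + pi / 2) = cos (2 * \<theta> - \<phi>)"
      by (simp add: cos_add)
    have "2 * sin (\<phi> - \<theta>) * cos \<theta> = sin \<phi> + sin (\<phi> - 2 * \<theta>)"
      using sin_times_cos[of "\<phi> - \<theta>" \<theta>] by (simp add: algebra_simps)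
    moreover have "sin (\<phi> - 2 * \<theta>) = - sin (2 * \<theta> - \<phi>)" by (metis sin_minus minus_diff_eq)
    ultimately show "sin \<phi> - 2 * sin (\<phi> - \<theta>) * sin (\<theta> + pi / 2) = sin (2 * \<theta> - \<phi>)"
      by (simp add: sin_add)
  qed
  moreover have "?v \<phi> - (2 * r) *\<^sub>R ?v \<psi>
      = (cos \<phi> - 2 * r * cos \<psi>) *\<^sub>R u + (sin \<phi> - 2 * r * sin \<psi>) *\<^sub>R w" for r \<psi>
    by (simp add: algebra_simps)
  ultimately show ?thesis by (simp only: frame_reflection_eq)
qed

text \<open>The product of the two reflections turns tangent vectors at the corner through \<open>- 2 \<theta>\<close>.\<close>

lemma corner_relation:
  assumes a: "p \<in> endpoints X a" and b: "p \<in> endpoints X b"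
    and \<theta>: "has_interior_angle X P p a b \<theta>" and n: "real n * \<theta> = of_int m * pi"
  shows "((side_reflection X a \<circ> side_reflection X b) ^^ n) = id"
proof -
  obtain qa qb where seg: "geodesic_segment X a p qa" "geodesic_segment X b p qb"
    using a b by (auto simp: endpoints_def)
  obtain u w where u: "u \<in> unit_tangents X p" and w: "w \<in> unit_tangents X p" and uw: "form X u w = 0"
    and ua: "u \<in> directions X a p" and ub: "cos \<theta> *\<^sub>R u + sin \<theta> *\<^sub>R w \<in> directions X b p"
    using \<theta> by (auto simp: has_interior_angle_def)
  have p: "p \<in> surface X" using seg(1) by (simp add: geodesic_segment_def)
  let ?v = "\<lambda>\<phi>. cos \<phi> *\<^sub>R u + sin \<phi> *\<^sub>R w"
  let ?F = "side_reflection X a \<circ> side_reflection X b"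
  have T: "?v \<phi> \<in> unit_tangents X p" for \<phi> by (rule polar_unit_tangent[OF u w uw])
  have f: "form X u u = 1" "form X w w = 1" "form X w u = 0"
    using u w uw by (auto simp: unit_tangents_def form_commute)
  have "form X (?v \<theta>) (?v (\<theta> + pi / 2)) = 0"
    using f uw by (simp add: form_simps cos_add sin_add)
  then have Rb: "side_reflection X b = frame_reflection X p (?v (\<theta> + pi / 2))"
    by (rule side_reflection_at_endpoint[OF seg(2) ub T])
  have "side_reflection X a = frame_reflection X p w"
    by (rule side_reflection_at_endpoint[OF seg(1) ua w uw])
  then have Ra: "side_reflection X a = frame_reflection X p (?v (0 + pi / 2))" by simp
  have F: "?F (?v \<phi>) = ?v (\<phi> - 2 * \<theta>)" for \<phi>
    unfolding Ra Rb comp_def frame_reflection_polar[OF p u w uw]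
    by (simp add: algebra_simps)
  have Fn: "(?F ^^ k) (?v \<phi>) = ?v (\<phi> - 2 * (real k * \<theta>))" for k \<phi>
  proof (induction k)
    case (Suc k)
    have "(?F ^^ Suc k) (?v \<phi>) = ?F (?v (\<phi> - 2 * (real k * \<theta>)))" by (simp only: funpow.simps comp_apply Suc.IH)
    also have "\<dots> = ?v (\<phi> - 2 * (real k * \<theta>) - 2 * \<theta>)" by (rule F)
    also have "\<phi> - 2 * (real k * \<theta>) - 2 * \<theta> = \<phi> - 2 * (real (Suc k) * \<theta>)" by (simp add: algebra_simps)
    finally show ?case .
  qed simp
  have per: "cos (\<phi> - 2 * (real n * \<theta>)) = cos \<phi>" "sin (\<phi> - 2 * (real n * \<theta>)) = sin \<phi>" for \<phi>
  proof -
    have "2 * (real n * \<theta>) = 2 * pi * of_int m" by (simp add: n)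
    then show "cos (\<phi> - 2 * (real n * \<theta>)) = cos \<phi>" "sin (\<phi> - 2 * (real n * \<theta>)) = sin \<phi>"
      by (simp_all only: cos_diff sin_diff cos_int_2pin sin_int_2pin)
  qed
  have "(?F ^^ n) (?v 0) = ?v 0" "(?F ^^ n) (?v (pi / 2)) = ?v (pi / 2)"
    by (simp_all only: Fn per)
  then have fuw: "(?F ^^ n) u = u" "(?F ^^ n) w = w" by simp_all
  have lin: "linear (side_reflection X a)" "linear (side_reflection X b)"
    using seg side_reflection_motion motion_def by metis+
  have linF: "linear (?F ^^ k)" for k
  proof (induction k)
    case (Suc k)
    show ?case unfolding funpow.simps by (rule linear_compose[OF Suc linear_compose[OF lin(2,1)]])
  qed (simp add: linear_ident id_def)
  have "?F p = p"
    unfolding Ra Rb comp_def by (simp only: frame_reflection_fixes height_base[OF p T])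
  then have fp: "(?F ^^ n) p = p" by (induction n) auto
  show ?thesis
  proof
    fix y
    obtain \<alpha> \<beta> \<gamma> where "y = \<alpha> *\<^sub>R p + \<beta> *\<^sub>R u + \<gamma> *\<^sub>R w" using frame_spans[OF p u w uw] .
    then show "(?F ^^ n) y = id y"
      using fuw fp by (simp add: linear_add[OF linF] linear_scale[OF linF] del: comp_apply)
  qed
qed

section \<open>Convexity and connectedness of half discs\<close>

lemma height_minus: "height X p (- w) z = - height X p w z"
  by (simp add: height_def form_simps)

text \<open>By \<open>exp_M_interpolate\<close> and linearity, a positive multiple of the height in
  between is a nonnegative combination of the heights at the two ends.\<close>

lemma height_chord_nonneg:
  assumes "0 \<le> r" "r \<le> d" "d < pi" "0 \<le> height X p w z" "0 \<le> height X p w (exp_M X z u d)"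
  shows "0 \<le> height X p w (exp_M X z u r)"
proof (cases "d = 0")
  case False
  have "height X p w (sn X d *\<^sub>R exp_M X z u r)
      = height X p w (sn X (d - r) *\<^sub>R z + sn X r *\<^sub>R exp_M X z u d)"
    by (rule arg_cong[OF exp_M_interpolate])
  then have "sn X d * height X p w (exp_M X z u r)
      = sn X (d - r) * height X p w z + sn X r * height X p w (exp_M X z u d)"
    by (simp add: linear_add[OF linear_height] linear_scale[OF linear_height])
  moreover have "0 < sn X d" "0 \<le> sn X (d - r)" "0 \<le> sn X r"
    using assms False by (auto intro: sn_pos sn_nonneg)
  ultimately show ?thesis using assms(4,5)
    by (metis add_nonneg_nonneg mult_nonneg_nonneg zero_le_mult_iff not_less)
qed (use assms in auto)

text \<open>In polar coordinates around \<open>y\<close> the half disc is the image of an open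
  rectangle. The height is taken with base \<open>p\<close>, the coordinates with base
  \<open>y\<close>; the vector \<open>w\<close> is tangent at both.\<close>

lemma connected_half_disc:
  assumes y: "y \<in> surface X" "height X p w y = 0"
    and u: "u \<in> unit_tangents X y" and wy: "w \<in> unit_tangents X y" and uw: "form X u w = 0"
    and wp: "w \<in> unit_tangents X p" and e: "e \<le> 1"
  shows "connected {z \<in> surface X. mdist X y z < e \<and> 0 < height X p w z}"
proof -
  let ?v = "\<lambda>\<alpha>. cos \<alpha> *\<^sub>R u + sin \<alpha> *\<^sub>R w"
  have T: "?v \<alpha> \<in> unit_tangents X y" for \<alpha> by (rule polar_unit_tangent[OF u wy uw])
  have h: "height X p w (exp_M X y (?v \<alpha>) d) = sn X d * sin \<alpha>" for \<alpha> d
    using uw form_unit_tangent[OF wp] height_tangent[OF wp T] y(2)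
    by (simp add: height_exp_M form_simps)
  let ?F = "\<lambda>q. exp_M X y (?v (fst q)) (snd q)"
  have "{z \<in> surface X. mdist X y z < e \<and> 0 < height X p w z} = ?F ` ({0<..<pi} \<times> {0<..<e})"
  proof (intro equalityI subsetI)
    fix z assume "z \<in> {z \<in> surface X. mdist X y z < e \<and> 0 < height X p w z}"
    then have z: "z \<in> surface X" "mdist X y z < e" "0 < height X p w z" by auto
    obtain v where v: "v \<in> unit_tangents X y" "z = exp_M X y v (mdist X y z)" "0 \<le> mdist X y z"
      using geodesic_to[OF y(1) z(1)] by metis
    obtain \<alpha> where \<alpha>: "v = ?v \<alpha>" using unit_tangent_polar[OF y(1) u wy uw v(1)] .
    have hz: "height X p w z = sn X (mdist X y z) * sin \<alpha>" using h v(2) \<alpha> by metis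
    have d: "0 < mdist X y z" using v(3) z(3) hz by (cases "mdist X y z = 0") auto
    moreover have "mdist X y z < pi" using z(2) e pi_gt3 by simp
    ultimately have "0 < sin \<alpha>" using hz z(3) sn_pos[of "mdist X y z" X]
      by (simp add: zero_less_mult_iff)
    \<comment> \<open>Replaces the angle by one in the range from 0 to pi with the same sine and
      cosine; positivity of the sine then excludes both ends.\<close>
    moreover obtain \<beta> where \<beta>: "0 \<le> \<beta>" "\<beta> \<le> pi" "cos \<alpha> = cos \<beta>" "sin \<alpha> = sin \<beta>"
      using sincos_total_pi[of "sin \<alpha>" "cos \<alpha>"] calculation by auto
    ultimately have "\<beta> \<noteq> 0" "\<beta> \<noteq> pi" by auto
    then have "(\<beta>, mdist X y z) \<in> {0<..<pi} \<times> {0<..<e}" using \<beta> d z by auto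
    moreover have "z = ?F (\<beta>, mdist X y z)" using v(2) \<alpha> \<beta> by simp
    ultimately show "z \<in> ?F ` ({0<..<pi} \<times> {0<..<e})" by (rule rev_image_eqI)
  next
    fix z assume "z \<in> ?F ` ({0<..<pi} \<times> {0<..<e})"
    then obtain \<alpha> d where z: "z = exp_M X y (?v \<alpha>) d" and ad: "0 < \<alpha>" "\<alpha> < pi" "0 < d" "d < e" by auto
    have "d < pi" using ad e pi_gt3 by simp
    then have "mdist X y z = d" unfolding z using ad by (intro mdist_exp_M_base y T) auto
    moreover have "0 < height X p w z"
      unfolding z h using ad \<open>d < pi\<close> by (intro mult_pos_pos sn_pos sin_gt_zero) auto
    moreover have "z \<in> surface X" unfolding z by (intro exp_M_surface y T)
    ultimately show "z \<in> {z \<in> surface X. mdist X y z < e \<and> 0 < height X p w z}" using ad by simp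
  qed
  moreover have "connected (?F ` ({0<..<pi} \<times> {0<..<e}))"
    by (intro connected_continuous_image continuous_intros connected_Times connected_Ioo)
  ultimately show ?thesis by simp
qed

section \<open>The Coxeter group and the covering space\<close>

locale polygon =
  fixes X :: geometry and P :: "point set" and A :: "side set"
  assumes polygon: "geodesic_polygon X P A"
begin

abbreviation "G \<equiv> coxeter_group X P A"
abbreviation "gen \<equiv> coxeter_gen X P A"
abbreviation "tile \<equiv> tile_point X P A"
abbreviation "words \<equiv> lists (A \<times> (UNIV :: bool set))"
abbreviation "element \<equiv> word_class A (coxeter_relators X P A)"
abbreviation "stabilizer y \<equiv> generate G (gen ` {a\<in>A. y \<in> a})"

lemma P_surface: "y \<in> P \<Longrightarrow> y \<in> surface X"
  using polygon by (auto simp: geodesic_polygon_def)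

lemma side_segment: "a \<in> A \<Longrightarrow> \<exists>p q. geodesic_segment X a p q"
  using polygon by (auto simp: geodesic_polygon_def)

lemma motion_side: "a \<in> A \<Longrightarrow> motion X (side_reflection X a)"
  using side_segment side_reflection_motion by blast

lemma side_involution: "a \<in> A \<Longrightarrow> side_reflection X a (side_reflection X a y) = y"
  using side_segment side_reflection_involution by blast

lemma side_fixes: "a \<in> A \<Longrightarrow> y \<in> a \<Longrightarrow> side_reflection X a y = y"
  using side_segment side_reflection_fixes by blast

section \<open>The action of the Coxeter group\<close>

lemma letter_act_eq: "a \<in> A \<Longrightarrow> letter_act X (a, b) = side_reflection X a"
  using side_involution by (auto simp: letter_act_def intro!: inv_unique_comp)

text \<open>The main point in showing that the action does not depend on the word representing a
  group element. For the angle m / n times pi, n times the angle is m pi, as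
  \<open>corner_relation\<close> demands.\<close>

lemma relator_trivial:
  assumes "r \<in> coxeter_relators X P A"
  shows "foldr (letter_act X) r = id"
  using assms unfolding coxeter_relators_def
proof (elim UnE CollectE exE conjE bexE)
  fix a assume "r = [(a, True), (a, True)]" "a \<in> A"
  then show ?thesis by (auto simp: letter_act_eq side_involution)
next
  fix a b q p
  let ?n = "nat (snd (quotient_of q))"
  assume r: "r = concat (replicate ?n [(a, True), (b, True)])" and ab: "a \<in> A" "b \<in> A"
    and p: "p \<in> endpoints X a \<inter> endpoints X b" "has_interior_angle X P p a b (of_rat q * pi)"
  obtain m n where mn: "quotient_of q = (m, n)" by force
  then have "0 < n" "q = of_int m / of_int n" by (auto simp: quotient_of_denom_pos quotient_of_div)
  then have "real ?n = of_int n" "(of_rat q :: real) = of_int m / of_int n"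
    using mn by (simp_all add: of_rat_divide)
  then have "real ?n * (of_rat q * pi) = of_int m * pi" using \<open>0 < n\<close> by (simp add: field_simps)
  then have "((side_reflection X a \<circ> side_reflection X b) ^^ ?n) = id"
    using p by (intro corner_relation) auto
  moreover have "foldr (letter_act X) (concat (replicate k [(a, True), (b, True)]))
      = (side_reflection X a \<circ> side_reflection X b) ^^ k" for k
    by (induction k) (auto simp: letter_act_eq ab)
  ultimately show ?thesis by (simp only: r)
qed

lemma presentation_eq_act:
  assumes "presentation_eq A (coxeter_relators X P A) u w"
  shows "foldr (letter_act X) u = foldr (letter_act X) w"
  using assms by induction (auto simp: relator_trivial letter_act_eq side_involution)

lemma act_element: "w \<in> words \<Longrightarrow> act X (element w) = foldr (letter_act X) w"
proof
  fix y assume w: "w \<in> words"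
  have "(\<lambda>u. foldr (letter_act X) u y) u = foldr (letter_act X) w y" if "u \<in> element w" for u
    using that presentation_eq_act[of w u] by (simp add: word_class_def)
  moreover have "w \<in> element w" using w by (simp add: word_class_def pres_refl)
  ultimately have "(\<lambda>u. foldr (letter_act X) u y) ` element w = {foldr (letter_act X) w y}" by blast
  then show "act X (element w) y = foldr (letter_act X) w y" by (simp add: act_def)
qed

lemma group_G: "group G"
  by (rule group_coxeter_group)

lemma carrier_G: "carrier G = element ` words"
  by (simp add: coxeter_group_def carrier_presented_group)

lemma act_mult:
  assumes "g \<in> carrier G" "h \<in> carrier G"
  shows "act X (g \<otimes>\<^bsub>G\<^esub> h) = act X g \<circ> act X h"
proof -
  obtain u w where uw: "u \<in> words" "w \<in> words" and gh: "g = element u" "h = element w"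
    using assms unfolding carrier_G by blast
  have "u @ w \<in> words" using uw by simp
  from act_element[OF this] show ?thesis
    using presented_mult[OF uw, of "coxeter_relators X P A"] act_element[OF uw(1)] act_element[OF uw(2)]
    by (simp only: gh coxeter_group_def foldr_append fun_eq_iff comp_apply simp_thms)
qed

lemma act_one: "act X \<one>\<^bsub>G\<^esub> = id"
  by (simp add: coxeter_group_def one_presented_group act_element)

lemma gen_closed: "a \<in> A \<Longrightarrow> gen a \<in> carrier G"
  by (auto simp: carrier_G coxeter_gen_def)

lemma act_gen: "a \<in> A \<Longrightarrow> act X (gen a) = side_reflection X a"
  by (simp add: coxeter_gen_def act_element letter_act_eq)

lemma gen_square:
  assumes "a \<in> A"
  shows "gen a \<otimes>\<^bsub>G\<^esub> gen a = \<one>\<^bsub>G\<^esub>"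
proof -
  have r: "[(a, True), (a, True)] \<in> coxeter_relators X P A" using assms by (auto simp: coxeter_relators_def)
  have "gen a \<otimes>\<^bsub>G\<^esub> gen a = element [(a, True), (a, True)]"
    using assms presented_mult[of "[(a, True)]" A "[(a, True)]"] by (simp add: coxeter_gen_def coxeter_group_def)
  also have "\<dots> = element []"
    using assms pres_relator[of "[]" A "[]" "[(a, True), (a, True)]" "coxeter_relators X P A"] r
    by (subst word_class_eq_iff) auto
  finally show ?thesis by (simp add: coxeter_group_def one_presented_group)
qed

lemma act_motion:
  assumes "g \<in> carrier G"
  shows "motion X (act X g)"
proof -
  have "motion X (foldr (letter_act X) w)" if "w \<in> words" for w
    using that
  proof (induction w)
    case (Cons l w)
    then obtain a b where "l = (a, b)" "a \<in> A" "w \<in> words" by auto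
    then show ?case using motion_comp[OF motion_side Cons.IH] by (simp add: letter_act_eq comp_def)
  qed (simp add: motion_id[unfolded id_def])
  moreover obtain w where "w \<in> words" "g = element w" using assms unfolding carrier_G by blast
  ultimately show ?thesis using act_element[of w] by metis
qed

lemma act_surface: "g \<in> carrier G \<Longrightarrow> y \<in> P \<Longrightarrow> act X g y \<in> surface X"
  using act_motion motion_surface P_surface by blast

lemma stabilizer_closed: "k \<in> stabilizer y \<Longrightarrow> k \<in> carrier G"
  using group.generate_in_carrier[OF group_G, of "gen ` {a\<in>A. y \<in> a}"] gen_closed by blast

lemma stabilizer_subgroup: "subgroup (stabilizer y) G"
  by (rule group.generate_is_subgroup[OF group_G]) (auto simp: gen_closed)

text \<open>The generators are reflections in sides through \<open>y\<close>. It follows that the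
  canonical map has a single value on each class of the covering space.\<close>

lemma stabilizer_fixes:
  assumes "k \<in> stabilizer y"
  shows "act X k y = y"
  using assms
proof (induction k rule: generate.induct)
  case (inv h)
  interpret group G by (rule group_G)
  obtain a where a: "a \<in> A" "y \<in> a" "h = gen a" using inv by auto
  have "inv\<^bsub>G\<^esub> h = h" unfolding a(3) by (intro inv_equality gen_square gen_closed a)
  then show ?case using a by (simp add: act_gen side_fixes)
next
  case (eng h1 h2)
  then show ?case using act_mult[of h1 h2] stabilizer_closed by simp
qed (auto simp: act_one act_gen side_fixes)

section \<open>Points of the covering space and the canonical map\<close>

lemma tile_mem:
  "(h, z) \<in> tile g y \<longleftrightarrow> g \<in> carrier G \<and> h \<in> carrier G \<and> y \<in> P \<and> z = y \<and> inv\<^bsub>G\<^esub> g \<otimes>\<^bsub>G\<^esub> h \<in> stabilizer y"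
  by (auto simp: tile_point_def cover_rel_def)

lemma tile_refl: "g \<in> carrier G \<Longrightarrow> y \<in> P \<Longrightarrow> (g, y) \<in> tile g y"
  by (simp add: tile_mem group.l_inv[OF group_G] generate.one)

text \<open>A class pairs its point with the elements of a left coset of the stabilizer, so equality
  of classes is equality of cosets.\<close>

lemma tile_eq_iff:
  assumes g: "g \<in> carrier G" and h: "h \<in> carrier G" and y: "y \<in> P"
  shows "tile h z = tile g y \<and> z \<in> P \<longleftrightarrow> z = y \<and> inv\<^bsub>G\<^esub> g \<otimes>\<^bsub>G\<^esub> h \<in> stabilizer y"
proof
  assume "tile h z = tile g y \<and> z \<in> P"
  then have "(h, z) \<in> tile g y" using tile_refl[OF h, of z] by simp
  then show "z = y \<and> inv\<^bsub>G\<^esub> g \<otimes>\<^bsub>G\<^esub> h \<in> stabilizer y" by (simp add: tile_mem)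
next
  interpret group G by (rule group_G)
  assume z: "z = y \<and> inv\<^bsub>G\<^esub> g \<otimes>\<^bsub>G\<^esub> h \<in> stabilizer y"
  have cancel: "a \<otimes>\<^bsub>G\<^esub> (inv\<^bsub>G\<^esub> a \<otimes>\<^bsub>G\<^esub> b) = b" if "a \<in> carrier G" "b \<in> carrier G" for a b
    using that by (simp add: m_assoc[symmetric])
  have K: "inv\<^bsub>G\<^esub> h \<otimes>\<^bsub>G\<^esub> k \<in> stabilizer y \<longleftrightarrow> inv\<^bsub>G\<^esub> g \<otimes>\<^bsub>G\<^esub> k \<in> stabilizer y" if k: "k \<in> carrier G" for k
  proof
    have "inv\<^bsub>G\<^esub> g \<otimes>\<^bsub>G\<^esub> k = (inv\<^bsub>G\<^esub> g \<otimes>\<^bsub>G\<^esub> h) \<otimes>\<^bsub>G\<^esub> (inv\<^bsub>G\<^esub> h \<otimes>\<^bsub>G\<^esub> k)"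
      using g h k cancel[OF h k] by (simp add: m_assoc)
    then show "inv\<^bsub>G\<^esub> g \<otimes>\<^bsub>G\<^esub> k \<in> stabilizer y" if "inv\<^bsub>G\<^esub> h \<otimes>\<^bsub>G\<^esub> k \<in> stabilizer y"
      using subgroup.m_closed[OF stabilizer_subgroup conjunct2[OF z] that] by simp
    have "inv\<^bsub>G\<^esub> h \<otimes>\<^bsub>G\<^esub> k = inv\<^bsub>G\<^esub> (inv\<^bsub>G\<^esub> g \<otimes>\<^bsub>G\<^esub> h) \<otimes>\<^bsub>G\<^esub> (inv\<^bsub>G\<^esub> g \<otimes>\<^bsub>G\<^esub> k)"
      using g h k cancel[OF g k] by (simp add: inv_mult_group m_assoc)
    then show "inv\<^bsub>G\<^esub> h \<otimes>\<^bsub>G\<^esub> k \<in> stabilizer y" if "inv\<^bsub>G\<^esub> g \<otimes>\<^bsub>G\<^esub> k \<in> stabilizer y"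
      using subgroup.m_closed[OF stabilizer_subgroup
          subgroup.m_inv_closed[OF stabilizer_subgroup conjunct2[OF z]] that] by simp
  qed
  have "p \<in> tile h y \<longleftrightarrow> p \<in> tile g y" for p
    using K[of "fst p"] g h y by (cases p) (auto simp: tile_mem)
  then show "tile h z = tile g y \<and> z \<in> P" using z y by blast
qed

text \<open>The gluing of neighbouring tiles. It lets a curve change its tile while standing still,
  at a billiard hit or where a short segment crosses a side.\<close>

lemma tile_side:
  assumes "g \<in> carrier G" "y \<in> P" "a \<in> A" "y \<in> a"
  shows "tile (g \<otimes>\<^bsub>G\<^esub> gen a) y = tile g y"
proof -
  interpret group G by (rule group_G)
  have "inv\<^bsub>G\<^esub> g \<otimes>\<^bsub>G\<^esub> (g \<otimes>\<^bsub>G\<^esub> gen a) = gen a"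
    using assms gen_closed by (simp add: m_assoc[symmetric])
  also have "\<dots> \<in> stabilizer y" using assms by (auto intro: generate.incl)
  finally show ?thesis using tile_eq_iff[of g "g \<otimes>\<^bsub>G\<^esub> gen a" y y] assms gen_closed by simp
qed

lemma cover_eq: "cover X P A = (\<Union>g\<in>carrier G. tile g ` P)"
  by (auto simp: cover_def quotient_def tile_point_def)

lemma tile_in_cover: "g \<in> carrier G \<Longrightarrow> y \<in> P \<Longrightarrow> tile g y \<in> cover X P A"
  by (auto simp: cover_eq)

lemma cover_map_tile:
  assumes g: "g \<in> carrier G" and y: "y \<in> P"
  shows "cover_map X (tile g y) = act X g y"
proof -
  interpret group G by (rule group_G)
  have "act X h z = act X g y" if "(h, z) \<in> tile g y" for h z
  proof -
    have h: "h \<in> carrier G" "z = y" and k: "inv\<^bsub>G\<^esub> g \<otimes>\<^bsub>G\<^esub> h \<in> stabilizer y" using that by (auto simp: tile_mem)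
    have "h = g \<otimes>\<^bsub>G\<^esub> (inv\<^bsub>G\<^esub> g \<otimes>\<^bsub>G\<^esub> h)" using g h by (simp add: m_assoc[symmetric])
    then have "act X h y = act X g (act X (inv\<^bsub>G\<^esub> g \<otimes>\<^bsub>G\<^esub> h) y)"
      using act_mult[of g "inv\<^bsub>G\<^esub> g \<otimes>\<^bsub>G\<^esub> h"] g h by simp
    then show ?thesis using stabilizer_fixes[OF k] h by simp
  qed
  then have "(\<lambda>(g, x). act X g x) p = (\<lambda>(g, x). act X g x) (g, y)" if "p \<in> tile g y" for p
    using that by (cases p) simp
  then have "the_elem ((\<lambda>(g, x). act X g x) ` tile g y) = (\<lambda>(g, x). act X g x) (g, y)"
    using tile_refl[OF g y] by (intro the_elem_image_unique) blast+
  then show ?thesis by (simp add: cover_map_def)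
qed

lemma cover_map_surface: "q \<in> cover X P A \<Longrightarrow> cover_map X q \<in> surface X"
  by (auto simp: cover_eq cover_map_tile act_surface)

section \<open>The distance of the covering space\<close>

abbreviation "broken \<equiv> broken_geodesic X P A"

lemma broken_cover:
  assumes "broken p q L"
  shows "p \<in> cover X P A" "q \<in> cover X P A" "0 \<le> L"
proof -
  have "p \<in> cover X P A \<and> q \<in> cover X P A \<and> 0 \<le> L"
    using assms by induction (auto intro!: tile_in_cover)
  then show "p \<in> cover X P A" "q \<in> cover X P A" "0 \<le> L" by auto
qed

lemma broken_trans:
  assumes "broken q r L'" "broken p q L"
  shows "broken p r (L + L')"
  using assms
proof induction
  case (broken_step g y L' u l)
  then have "broken p (tile g (exp_M X y u l)) ((L + L') + l)"
    by (intro broken_geodesic.broken_step) auto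
  then show ?case by (simp add: add.assoc)
qed simp

lemma broken_tile:
  assumes "g \<in> carrier G" "y \<in> P" "u \<in> unit_tangents X y" "0 \<le> l" "\<forall>s\<in>{0..l}. exp_M X y u s \<in> P"
  shows "broken (tile g y) (tile g (exp_M X y u l)) l"
  using broken_geodesic.broken_step[OF broken_geodesic.broken_refl, of X P A g y u l] assms tile_in_cover
  by simp

lemma broken_sym:
  assumes "broken p q L"
  shows "broken q p L"
  using assms
proof induction
  case (broken_step g y L u l)
  let ?z = "exp_M X y u l" and ?w = "- velocity X y u l"
  have "exp_M X ?z ?w l = y" "\<forall>s\<in>{0..l}. exp_M X ?z ?w s \<in> P"
    using broken_step.hyps by (auto simp: exp_M_add)
  moreover have "?w \<in> unit_tangents X ?z"
    using broken_step.hyps P_surface by (intro unit_tangents_minus exp_M_surface)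
  moreover have "?z \<in> P" using broken_step.hyps by auto
  ultimately have "broken (tile g ?z) (tile g y) l"
    using broken_tile[of g ?z ?w l] broken_step.hyps by simp
  from broken_trans[OF broken_step.IH this] show ?case by (simp add: add.commute)
qed (rule broken_geodesic.broken_refl)

lemma mdist_le_broken:
  assumes "broken p q L"
  shows "mdist X (cover_map X p) (cover_map X q) \<le> L"
  using assms
proof induction
  case broken_refl
  then show ?case by (simp add: mdist_self cover_map_surface)
next
  case (broken_step g y L u l)
  let ?z = "exp_M X y u l"
  have z: "?z \<in> P" using broken_step.hyps by auto
  have y: "y \<in> surface X" using P_surface broken_step.hyps by blast
  have m: "motion X (act X g)" by (rule act_motion[OF broken_step.hyps(2)])
  have "mdist X (act X g y) (act X g ?z) \<le> l"
    unfolding motion_exp_M[OF m] using broken_step.hyps y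
    by (intro mdist_exp_M_le motion_surface[OF m] motion_unit_tangent[OF m]) auto
  moreover have "mdist X (cover_map X p) (act X g ?z)
      \<le> mdist X (cover_map X p) (act X g y) + mdist X (act X g y) (act X g ?z)"
    using broken_step.hyps z broken_cover[OF broken_step.hyps(1)]
    by (intro mdist_triangle cover_map_surface act_surface) auto
  ultimately show ?case
    using broken_step.IH broken_step.hyps z by (simp add: cover_map_tile)
qed

lemma cover_dist_le: "broken p q L \<Longrightarrow> cover_dist X P A p q \<le> L"
  unfolding cover_dist_def by (rule cInf_lower) (auto intro!: bdd_belowI[of _ 0] broken_cover)

text \<open>The infimum of the empty set is a junk value, hence the premise that \<open>p\<close> and \<open>q\<close> are joined.\<close>

lemma mdist_le_cover_dist:
  "broken p q L \<Longrightarrow> mdist X (cover_map X p) (cover_map X q) \<le> cover_dist X P A p q"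
  unfolding cover_dist_def by (rule cInf_greatest) (auto intro: mdist_le_broken)


lemma cover_dist_commute: "cover_dist X P A p q = cover_dist X P A q p"
proof -
  have "{L. broken p q L} = {L. broken q p L}" using broken_sym by blast
  then show ?thesis by (simp add: cover_dist_def)
qed

section \<open>Lifting billiard orbits\<close>

text \<open>The invariant carried along a billiard orbit. Broken curves of exact length are demanded
  on every subinterval, because they bound each distance from above while the projection bounds it
  from below.\<close>

definition lift :: "point \<Rightarrow> point \<Rightarrow> real \<Rightarrow> (real \<Rightarrow> cover_point) \<Rightarrow> bool" where
  "lift x v T c \<longleftrightarrow>
     (\<forall>r r'. 0 \<le> r \<longrightarrow> r \<le> r' \<longrightarrow> r' \<le> T \<longrightarrow> broken (c r) (c r') (r' - r)) \<and>
     (\<forall>r\<in>{0..T}. cover_map X (c r) = exp_M X x v r) \<and>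
     (\<forall>r\<in>{0<..<T}. c r \<notin> cover_vertices X P A) \<and>
     cover_initial X P A x v T c"

lemma tile_not_vertex:
  assumes "g \<in> carrier G" "y \<in> P" "y \<notin> corners X A"
  shows "tile g y \<notin> cover_vertices X P A"
proof
  assume "tile g y \<in> cover_vertices X P A"
  then obtain h z where "tile g y = tile h z" "z \<in> corners X A" by (auto simp: cover_vertices_def)
  moreover have "(g, y) \<in> tile g y" using assms by (simp add: tile_refl)
  ultimately show False using assms(3) by (simp add: tile_mem)
qed

text \<open>Common to moves and hits: only the tile \<open>g\<close> and the velocity
  \<open>w\<close> of the new segment differ. At t = 0 the old curve is a single point and the new
  segment supplies the initial vector, hence the premise \<open>init\<close>; later the old curve
  already has it.\<close>

lemma lift_extend:
  assumes c: "lift x v t c" "c t = tile g y" and t: "0 \<le> t"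
    and g: "g \<in> carrier G" and w: "w \<in> unit_tangents X y"
    and corner: "t = 0 \<or> y \<notin> corners X A" and free: "free_segment X P A y w s"
    and init: "t = 0 \<Longrightarrow> g = \<one>\<^bsub>G\<^esub> \<and> y = x \<and> w = v"
    and act: "act X g y = exp_M X x v t" "act X g w = velocity X x v t"
  shows "\<exists>c'. lift x v (t + s) c' \<and> c' (t + s) = tile g (exp_M X y w s)"
proof (intro exI conjI)
  have s: "0 < s" and inP: "\<And>r. 0 \<le> r \<Longrightarrow> r \<le> s \<Longrightarrow> exp_M X y w r \<in> P"
    and nc: "\<And>r. 0 < r \<Longrightarrow> r < s \<Longrightarrow> exp_M X y w r \<notin> corners X A"
    using free by (auto simp: free_segment_def)
  have y: "y \<in> P" using inP[of 0] s by simp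
  have ys: "y \<in> surface X" using y by (rule P_surface)
  \<comment> \<open>Both branches agree at time \<open>t\<close>, since \<open>c t\<close> is the
    start of the new segment; the case distinctions below rely on this.\<close>
  define c' where "c' r = (if r \<le> t then c r else tile g (exp_M X y w (r - t)))" for r
  have c1: "c' r = c r" if "r \<le> t" for r using that by (simp add: c'_def)
  have c2: "c' r = tile g (exp_M X y w (r - t))" if "t \<le> r" for r
    using that c(2) by (cases "r = t") (auto simp: c'_def)
  have b2: "broken (c' r) (c' r') (r' - r)" if "t \<le> r" "r \<le> r'" "r' \<le> t + s" for r r'
  proof -
    have "broken (tile g (exp_M X y w (r - t)))
        (tile g (exp_M X (exp_M X y w (r - t)) (velocity X y w (r - t)) (r' - r))) (r' - r)"
      using that inP by (intro broken_tile g exp_M_surface ys w) (auto simp: exp_M_add)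
    then show ?thesis using that by (simp add: c2 exp_M_add)
  qed
  have "broken (c' r) (c' r') (r' - r)" if "0 \<le> r" "r \<le> r'" "r' \<le> t + s" for r r'
  proof -
    consider "r' \<le> t" | "t \<le> r" | "r < t" "t < r'" by linarith
    then show ?thesis
    proof cases
      case 1
      then show ?thesis using c(1) that by (auto simp: c1 lift_def)
    next
      case 2
      then show ?thesis using b2 that by blast
    next
      case 3
      have "broken (c' r) (c' t) (t - r)" using c(1) that 3 by (auto simp: c1 lift_def)
      then show ?thesis using broken_trans[OF b2[of t r']] 3 that by fastforce
    qed
  qed
  moreover have "cover_map X (c' r) = exp_M X x v r" if "r \<in> {0..t + s}" for r
  proof (cases "r \<le> t")
    case True
    then show ?thesis using c(1) that by (auto simp: c1 lift_def)
  next
    case False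
    then show ?thesis using that inP g act
      by (simp add: c2 cover_map_tile motion_exp_M[OF act_motion[OF g]] exp_M_add)
  qed
  moreover have "c' r \<notin> cover_vertices X P A" if "r \<in> {0<..<t + s}" for r
  proof -
    consider "r < t" | "r = t" | "t < r" by linarith
    then show ?thesis
    proof cases
      case 1
      then show ?thesis using c(1) that by (auto simp: c1 lift_def)
    next
      case 2
      then show ?thesis using corner that tile_not_vertex[OF g y] by (auto simp: c1 c(2))
    next
      case 3
      then show ?thesis using that nc[of "r - t"] inP[of "r - t"] tile_not_vertex[OF g] by (simp add: c2)
    qed
  qed
  moreover have "cover_initial X P A x v (t + s) c'"
  proof (cases "t = 0")
    case True
    then show ?thesis using init inP s unfolding cover_initial_def
      by (intro exI[of _ s]) (auto simp: c2 base_point_def)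
  next
    case False
    obtain e where "e > 0" "\<forall>r\<in>{0..e} \<inter> {0..t}. exp_M X x v r \<in> P \<and> c r = base_point X P A (exp_M X x v r)"
      using c(1) by (auto simp: lift_def cover_initial_def)
    then show ?thesis using False t unfolding cover_initial_def
      by (intro exI[of _ "min e t"]) (auto simp: c1)
  qed
  ultimately show "lift x v (t + s) c'" by (auto simp: lift_def)
  show "c' (t + s) = tile g (exp_M X y w s)" using s by (simp add: c2)
qed

lemma foldr_side_reflection: "set as \<subseteq> A \<Longrightarrow>
    foldr (side_reflection X) as = act X (element (map (\<lambda>a. (a, True)) as))"
proof -
  assume as: "set as \<subseteq> A"
  then have "map (\<lambda>a. (a, True)) as \<in> words" by auto
  moreover have "foldr (letter_act X) (map (\<lambda>a. (a, True)) bs) = foldr (side_reflection X) bs" for bs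
    by (induction bs) (auto simp: letter_act_def)
  ultimately show ?thesis by (simp only: act_element)
qed

text \<open>At a hit the velocity is reflected in \<open>a\<close> while the word grows by
  \<open>a\<close>; the two reflections cancel, so the unfolded position and velocity continue
  unchanged along the geodesic of \<open>M\<close>.\<close>

lemma billiard_lift:
  assumes "billiard X P A x v t y w as" and v: "v \<in> directions X P x"
  shows "set as \<subseteq> A \<and> 0 \<le> t \<and> (t = 0 \<longrightarrow> y = x \<and> w = v \<and> as = []) \<and> y \<in> P \<and> w \<in> unit_tangents X y \<and>
    foldr (side_reflection X) as y = exp_M X x v t \<and>
    foldr (side_reflection X) as w = velocity X x v t \<and>
    (\<exists>c. lift x v t c \<and> c t = tile (element (map (\<lambda>a. (a, True)) as)) y)"
  using assms(1)
proof induction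
  case billiard_start
  have G1: "element [] = \<one>\<^bsub>G\<^esub>" "\<one>\<^bsub>G\<^esub> \<in> carrier G"
    using group.is_monoid[OF group_G, THEN monoid.one_closed]
    by (auto simp: coxeter_group_def one_presented_group)
  let ?c = "\<lambda>r::real. base_point X P A x"
  have "broken (?c r) (?c r') (r' - r)" if "0 \<le> r" "r \<le> r'" "r' \<le> 0" for r r'
  proof -
    have "r' - r = 0" using that by simp
    then show ?thesis using billiard_start G1
      by (simp add: base_point_def broken_geodesic.broken_refl tile_in_cover)
  qed
  then have "lift x v 0 ?c"
    using billiard_start G1
    by (auto simp: lift_def base_point_def cover_map_tile act_one cover_initial_def intro!: exI[of _ 1])
  then show ?case using billiard_start G1 by (auto simp: directions_def base_point_def)
next
  case (billiard_move t y w as s)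
  let ?g = "element (map (\<lambda>a. (a, True)) as)"
  from billiard_move.IH obtain c where c: "lift x v t c" "c t = tile ?g y" by blast
  have as: "set as \<subseteq> A" and y: "y \<in> P" and w: "w \<in> unit_tangents X y" and t: "0 \<le> t"
    and F: "foldr (side_reflection X) as y = exp_M X x v t" "foldr (side_reflection X) as w = velocity X x v t"
    using billiard_move.IH by blast+
  have act: "act X ?g y = exp_M X x v t" "act X ?g w = velocity X x v t"
    using F unfolding foldr_side_reflection[OF as] by auto
  have "map (\<lambda>a. (a, True)) as \<in> words" using as by auto
  then have g: "?g \<in> carrier G" unfolding carrier_G by (rule imageI)
  have s: "0 < s" "exp_M X y w s \<in> P" using billiard_move.hyps by (auto simp: free_segment_def)
  have m: "motion X (act X ?g)" by (rule act_motion[OF g])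
  have "\<exists>c'. lift x v (t + s) c' \<and> c' (t + s) = tile ?g (exp_M X y w s)"
    using billiard_move.IH billiard_move.hyps act
    by (intro lift_extend[OF c t g w]) (auto simp: coxeter_group_def one_presented_group)
  moreover have "act X ?g (exp_M X y w s) = exp_M X x v (t + s)"
    by (simp add: motion_exp_M[OF m] act exp_M_add)
  moreover have "act X ?g (velocity X y w s) = velocity X x v (t + s)"
    using m by (simp add: motion_def velocity_linear act velocity_add)
  ultimately show ?case
    using s as t exp_M_surface(2)[OF P_surface[OF y] w] by (auto simp: foldr_side_reflection[OF as])
next
  case (billiard_hit t y w as a w' s)
  let ?h = "element (map (\<lambda>a. (a, True)) as)"
  let ?g = "element (map (\<lambda>a. (a, True)) (as @ [a]))"
  from billiard_hit.IH obtain c where c: "lift x v t c" "c t = tile ?h y" by blast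
  have as: "set as \<subseteq> A" and y: "y \<in> P" and w: "w \<in> unit_tangents X y" and t: "0 \<le> t"
    and F: "foldr (side_reflection X) as y = exp_M X x v t" "foldr (side_reflection X) as w = velocity X x v t"
    using billiard_hit.IH by blast+
  have act: "act X ?h y = exp_M X x v t" "act X ?h w = velocity X x v t"
    using F unfolding foldr_side_reflection[OF as] by auto
  have as': "set (as @ [a]) \<subseteq> A" using as billiard_hit.hyps by simp
  have W: "map (\<lambda>a. (a, True)) as \<in> words" "[(a, True)] \<in> words" using as' by auto
  then have W': "map (\<lambda>a. (a, True)) (as @ [a]) \<in> words" by simp
  have h: "?h \<in> carrier G" and g: "?g \<in> carrier G" using W(1) W' unfolding carrier_G by (blast intro: imageI)+
  have gh: "?g = ?h \<otimes>\<^bsub>G\<^esub> gen a"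
    using presented_mult[OF W, of "coxeter_relators X P A"] by (simp add: coxeter_group_def coxeter_gen_def)
  have a: "a \<in> A" "y \<in> a" by fact+
  have w': "w' \<in> unit_tangents X y"
    using motion_unit_tangent[OF motion_side[OF a(1)] P_surface[OF y] w] billiard_hit.hyps
    by (simp add: side_fixes)
  have s: "0 < s" "exp_M X y w' s \<in> P" using billiard_hit.hyps by (auto simp: free_segment_def)
  have m: "motion X (act X ?g)" by (rule act_motion[OF g])
  have act': "act X ?g y = exp_M X x v t" "act X ?g w' = velocity X x v t"
    using act_mult[OF h gen_closed[OF a(1)]] act billiard_hit.hyps
    unfolding gh by (simp_all add: act_gen side_fixes side_involution)
  \<comment> \<open>A hit requires a velocity pointing out of \<open>P\<close>, whereas
    \<open>v\<close> points into \<open>P\<close>; so the first segment always lies in the base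
    tile.\<close>
  have t0: "t \<noteq> 0" using billiard_hit.IH billiard_hit.hyps v by auto
  \<comment> \<open>The hit point lies on \<open>a\<close> and thus belongs to the old and the new
    tile.\<close>
  have "c t = tile ?g y" using c(2) tile_side[OF h y a] unfolding gh by simp
  then have "\<exists>c'. lift x v (t + s) c' \<and> c' (t + s) = tile ?g (exp_M X y w' s)"
    using billiard_hit.hyps act' t0
    by (intro lift_extend[OF c(1) _ t g w']) auto
  moreover have "act X ?g (exp_M X y w' s) = exp_M X x v (t + s)"
    by (simp only: motion_exp_M[OF m] act' exp_M_add)
  moreover have "act X ?g (velocity X y w' s) = velocity X x v (t + s)"
    using m by (simp only: motion_def velocity_linear act' velocity_add)
  ultimately show ?case
    using s as' t exp_M_surface(2)[OF P_surface[OF y] w'] by (simp only: foldr_side_reflection[OF as']) simp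
qed

lemma lift_geodesic:
  assumes c: "lift x v T c" and x: "x \<in> surface X" "v \<in> unit_tangents X x"
  shows "cover_geodesic X P A T c"
proof -
  have b: "broken (c r) (c r') (r' - r)" if "0 \<le> r" "r \<le> r'" "r' \<le> T" for r r'
    using c that by (auto simp: lift_def)
  have f: "cover_map X (c r) = exp_M X x v r" if "r \<in> {0..T}" for r
    using c that by (auto simp: lift_def)
  \<comment> \<open>Two times in a ball of radius 1 differ by less than 2 < pi, so the arc of
    \<open>M\<close> between them is shortest even on the sphere.\<close>
  have le: "cover_dist X P A (c r) (c r') = r' - r" if "0 \<le> r" "r \<le> r'" "r' \<le> T" "r' - r < 2" for r r'
  proof (rule antisym)
    show "cover_dist X P A (c r) (c r') \<le> r' - r" using b that by (intro cover_dist_le) auto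
    have "r' - r = mdist X (cover_map X (c r)) (cover_map X (c r'))"
      using mdist_geodesic[OF x, of r r'] that pi_gt3 f by simp
    also have "\<dots> \<le> cover_dist X P A (c r) (c r')" by (rule mdist_le_cover_dist[OF b]) (use that in auto)
    finally show "r' - r \<le> cover_dist X P A (c r) (c r')" .
  qed
  have "cover_dist X P A (c r) (c r') = \<bar>r - r'\<bar>"
    if "r \<in> {0..T} \<inter> ball s 1" "r' \<in> {0..T} \<inter> ball s 1" for r r' s
  proof (cases "r \<le> r'")
    case True
    then show ?thesis using le[of r r'] that by (auto simp: dist_real_def)
  next
    case False
    then show ?thesis using le[of r' r] that cover_dist_commute by (auto simp: dist_real_def)
  qed
  then have "\<forall>s\<in>{0..T}. \<exists>e>0. \<forall>r\<in>{0..T} \<inter> ball s e. \<forall>r'\<in>{0..T} \<inter> ball s e.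
        cover_dist X P A (c r) (c r') = \<bar>r - r'\<bar>"
    using zero_less_one by blast
  moreover have "c s \<in> cover X P A" if "s \<in> {0..T}" for s
    using broken_cover(1)[OF b[of s s]] that by auto
  ultimately show ?thesis using c by (auto simp: cover_geodesic_def lift_def)
qed


section \<open>The polygon near a point that is not a corner\<close>

abbreviation "T \<equiv> top_of_set (surface X)"

lemma interior_closure: "T closure_of (T interior_of P) = P"
  and frontier: "T frontier_of P = \<Union>A"
  using polygon by (auto simp: geodesic_polygon_def)

lemma frontier_eq: "\<Union>A = P - T interior_of P"
proof -
  have "closedin T P" using interior_closure closedin_closure_of by metis
  then show ?thesis using frontier by (simp add: frontier_of_def closure_of_closedin)
qed

lemma side_subset: "a \<in> A \<Longrightarrow> a \<subseteq> P"
  using frontier_eq by blast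

text \<open>The sides that avoid \<open>y\<close> form a finite union of compact sets, whose
  complement is an open neighbourhood of \<open>y\<close>.\<close>

lemma ball_near_other_sides:
  assumes y: "y \<in> P"
  obtains e where "0 < e" "e \<le> 1"
    "\<And>z b. z \<in> surface X \<Longrightarrow> mdist X y z < e \<Longrightarrow> b \<in> A \<Longrightarrow> z \<in> b \<Longrightarrow> y \<in> b"
proof -
  have "closed b" if b: "b \<in> A" for b
  proof -
    obtain p q where "geodesic_segment X b p q" using side_segment[OF b] by blast
    then obtain u l where "b = exp_M X p u ` {0..l}" by (auto simp: geodesic_segment_def)
    then show ?thesis
      by (auto intro!: compact_imp_closed compact_continuous_image continuous_intros)
  qed
  moreover have "finite A" using polygon by (simp add: geodesic_polygon_def)
  ultimately have "open (- \<Union>{b\<in>A. y \<notin> b})" by (intro open_Compl closed_Union) auto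
  then obtain e where "0 < e" "e \<le> 1" "\<And>z. z \<in> surface X \<Longrightarrow> mdist X y z < e \<Longrightarrow> z \<in> - \<Union>{b\<in>A. y \<notin> b}"
    using ball_in_open[OF P_surface[OF y], of "- \<Union>{b\<in>A. y \<notin> b}"] by auto
  then show thesis by (intro that) auto
qed

lemma interior_ball:
  assumes y: "y \<in> P" "y \<notin> \<Union>A"
  obtains e where "0 < e" "e \<le> 1" "\<And>z. z \<in> surface X \<Longrightarrow> mdist X y z < e \<Longrightarrow> z \<in> P"
proof -
  have "y \<in> T interior_of P" using y frontier_eq by blast
  moreover obtain U where U: "open U" "T interior_of P = surface X \<inter> U"
    using openin_interior_of openin_open by metis
  ultimately obtain e where e: "0 < e" "e \<le> 1" "\<And>z. z \<in> surface X \<Longrightarrow> mdist X y z < e \<Longrightarrow> z \<in> U"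
    using ball_in_open[OF P_surface[OF y(1)], of U] by auto
  have "z \<in> P" if "z \<in> surface X" "mdist X y z < e" for z
    using e(3)[OF that] that U(2) interior_of_subset[of T P] by blast
  then show thesis using that e by blast
qed

text \<open>The normal \<open>w\<close> at the end \<open>p\<close> of the side stays normal all
  along it, so one height function with base \<open>p\<close> describes the side near the inner
  point \<open>y\<close>, while \<open>u\<close> and \<open>w\<close> form a frame at
  \<open>y\<close> itself.\<close>

lemma side_frame:
  assumes a: "a \<in> A" and y: "y \<in> a" "y \<notin> corners X A"
  obtains p u w e where "p \<in> surface X" "w \<in> unit_tangents X p" "side_reflection X a = frame_reflection X p w"
    "u \<in> unit_tangents X y" "w \<in> unit_tangents X y" "form X u w = 0"
    "\<And>z. z \<in> a \<Longrightarrow> height X p w z = 0" "0 < e" "e \<le> 1"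
    "\<And>z. z \<in> surface X \<Longrightarrow> mdist X y z < e \<Longrightarrow> height X p w z = 0 \<Longrightarrow> z \<in> a"
proof -
  obtain p q where seg: "geodesic_segment X a p q" using side_segment[OF a] by blast
  obtain u w l where p: "p \<in> surface X" and u: "u \<in> unit_tangents X p" and w: "w \<in> unit_tangents X p"
    and uw: "form X u w = 0" and l: "0 < l" "X = Spherical \<longrightarrow> l < 2 * pi"
    and al: "a = exp_M X p u ` {0..l}" and q: "q = exp_M X p u l"
    and R: "side_reflection X a = frame_reflection X p w"
    using geodesic_segment_frame[OF seg] .
  obtain s where s: "0 \<le> s" "s \<le> l" "y = exp_M X p u s" using y al by auto
  \<comment> \<open>Running the side backwards shows that \<open>q\<close> is a corner too, so
    \<open>y\<close> lies strictly between the ends.\<close>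
  have "geodesic_segment X a q p"
  proof -
    have "a = exp_M X q (- velocity X p u l) ` {0..l}"
    proof (intro equalityI subsetI)
      fix z assume "z \<in> a"
      then obtain r where "r \<in> {0..l}" "z = exp_M X p u r" using al by blast
      then show "z \<in> exp_M X q (- velocity X p u l) ` {0..l}"
        by (intro image_eqI[of _ _ "l - r"]) (auto simp: q exp_M_add)
    next
      fix z assume "z \<in> exp_M X q (- velocity X p u l) ` {0..l}"
      then show "z \<in> a" by (auto simp: q exp_M_add al)
    qed
    moreover have "p = exp_M X q (- velocity X p u l) l" by (simp add: q exp_M_add)
    moreover have "q \<in> surface X" "- velocity X p u l \<in> unit_tangents X q"
      using exp_M_surface[OF p u] by (auto simp: q intro: unit_tangents_minus)
    ultimately show ?thesis using l unfolding geodesic_segment_def by blast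
  qed
  then have "p \<in> corners X A" "q \<in> corners X A" using seg a by (auto simp: corners_def endpoints_def)
  then have "s \<noteq> 0" "s \<noteq> l" using y(2) s(3) q by auto
  then have s': "0 < s" "s < l" using s by auto
  let ?U = "velocity X p u s"
  have ys: "y \<in> surface X" and U: "?U \<in> unit_tangents X y" using exp_M_surface[OF p u] s(3) by auto
  have wu: "form X w u = 0" using uw by (simp add: form_commute)
  have wy: "w \<in> unit_tangents X y" and Uw: "form X ?U w = 0"
    using w uw wu p u unfolding s(3)
    by (cases X; simp add: exp_M_unfold form_simps form_commute[of _ w p])+
  have ha: "height X p w z = 0" if "z \<in> a" for z using that height_geodesic[OF p u w uw] by (auto simp: al)
  \<comment> \<open>A zero of the height in this ball lies on the geodesic of the side at parameter
    distance at most \<open>s\<close> and \<open>l - s\<close> from \<open>y\<close>, hence within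
    the side.\<close>
  define e where "e = min 1 (min s (l - s))"
  have e: "0 < e" "e \<le> 1" "e \<le> s" "e \<le> l - s" using s' by (auto simp: e_def)
  have "z \<in> a" if z: "z \<in> surface X" "mdist X y z < e" "height X p w z = 0" for z
  proof -
    obtain v where v: "v \<in> unit_tangents X y" "z = exp_M X y v (mdist X y z)" "0 \<le> mdist X y z"
      using geodesic_to[OF ys z(1)] by metis
    let ?d = "mdist X y z"
    have d: "?d < pi" using z(2) e(2) pi_gt3 by simp
    have "height X p w (exp_M X y v ?d) = sn X ?d * form X v w"
      using ha[OF y(1)] by (simp add: height_exp_M height_tangent[OF w v(1)])
    then have 0: "sn X ?d * form X v w = 0" using v(2) z(3) by simp
    show ?thesis
    proof (cases "?d = 0")
      case True
      then show ?thesis using v(2) y(1) by simp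
    next
      case False
      then have "form X v w = 0" using 0 sn_pos[of ?d X] v(3) d by simp
      obtain \<alpha> where \<alpha>: "v = cos \<alpha> *\<^sub>R ?U + sin \<alpha> *\<^sub>R w" using unit_tangent_polar[OF ys U wy Uw v(1)] .
      have "sin \<alpha> = 0" using \<open>form X v w = 0\<close> form_unit_tangent[OF w] Uw by (simp add: \<alpha> form_simps)
      then have "cos \<alpha> = 1 \<or> cos \<alpha> = -1" using sin_cos_squared_add[of \<alpha>] by (simp add: power2_eq_1_iff)
      then have "z = exp_M X p u (s + ?d) \<or> z = exp_M X p u (s - ?d)"
        using v(2) \<open>sin \<alpha> = 0\<close> by (auto simp: \<alpha> s(3) exp_M_add)
      moreover have "s + ?d \<in> {0..l}" "s - ?d \<in> {0..l}" using e z(2) s' v(3) by auto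
      ultimately show ?thesis unfolding al by blast
    qed
  qed
  then show thesis using that[OF p w R U wy Uw ha e(1,2)] by blast
qed

lemma unique_side:
  assumes "y \<notin> corners X A" "a \<in> A" "y \<in> a" "b \<in> A" "y \<in> b"
  shows "b = a"
proof (rule ccontr)
  assume "b \<noteq> a"
  moreover have "\<forall>a\<in>A. \<forall>b\<in>A. a \<noteq> b \<longrightarrow> a \<inter> b \<subseteq> endpoints X a \<inter> endpoints X b"
    using polygon unfolding geodesic_polygon_def by blast
  ultimately have "y \<in> endpoints X a" using assms by blast
  then show False using assms by (auto simp: corners_def)
qed

text \<open>The two open half discs are connected and miss the frontier of \<open>P\<close>, so each of them lies in
  \<open>P\<close> or outside. Both inside would make \<open>y\<close> an interior point, and both outside would contradict
  that \<open>P\<close> is the closure of its interior.\<close>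

lemma half_disc:
  assumes y: "y \<in> P" "y \<notin> corners X A" and a: "a \<in> A" "y \<in> a"
  obtains p w e where "0 < e" "e \<le> 1" "p \<in> surface X" "w \<in> unit_tangents X p"
    "side_reflection X a = frame_reflection X p w"
    "\<And>z. z \<in> surface X \<Longrightarrow> mdist X y z < e \<Longrightarrow> z \<in> P \<longleftrightarrow> 0 \<le> height X p w z"
    "\<And>z. z \<in> surface X \<Longrightarrow> mdist X y z < e \<Longrightarrow> z \<in> a \<longleftrightarrow> height X p w z = 0"
proof -
  have ys: "y \<in> surface X" using y(1) by (rule P_surface)
  obtain p u w e1 where p: "p \<in> surface X" and w: "w \<in> unit_tangents X p"
    and R: "side_reflection X a = frame_reflection X p w"
    and f: "u \<in> unit_tangents X y" "w \<in> unit_tangents X y" "form X u w = 0"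
    and h: "\<And>z. z \<in> a \<Longrightarrow> height X p w z = 0" and e1: "0 < e1" "e1 \<le> 1"
    and ha: "\<And>z. z \<in> surface X \<Longrightarrow> mdist X y z < e1 \<Longrightarrow> height X p w z = 0 \<Longrightarrow> z \<in> a"
    using side_frame[OF a y(2)] by metis
  obtain e2 where e2: "0 < e2" "\<And>z b. z \<in> surface X \<Longrightarrow> mdist X y z < e2 \<Longrightarrow> b \<in> A \<Longrightarrow> z \<in> b \<Longrightarrow> y \<in> b"
    using ball_near_other_sides[OF y(1)] by metis
  define e where "e = min e1 e2"
  have e: "0 < e" "e \<le> 1" using e1 e2 by (auto simp: e_def)
  have only: "b = a" if "b \<in> A" "y \<in> b" for b using unique_side[OF y(2) a that] .
  have fr: "height X p w z = 0" if "z \<in> surface X" "mdist X y z < e" "z \<in> \<Union>A" for z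
    using that e2(2) only h by (fastforce simp: e_def)
  define D where "D v = {z \<in> surface X. mdist X y z < e \<and> 0 < height X p v z}" for v
  have side: "D v \<subseteq> P \<or> D v \<inter> P = {}" if v: "v \<in> {w, - w}" for v
  proof -
    have "connected (D v)"
      unfolding D_def using v f w e ys a(2) h
      by (intro connected_half_disc[of _ _ _ _ u]) (auto simp: unit_tangents_minus height_minus form_simps)
    then have "connectedin T (D v)"
      by (auto simp: connectedin_subtopology connectedin_iff_connected D_def)
    moreover have "z \<notin> T frontier_of P" if "z \<in> D v" for z
    proof -
      have "height X p w z \<noteq> 0" "z \<in> surface X" "mdist X y z < e"
        using v that by (auto simp: D_def height_minus)
      then show ?thesis using fr unfolding frontier by blast
    qed
    then have "D v \<inter> T frontier_of P = {}" by blast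
    ultimately show ?thesis using connectedin_Int_frontier_of[of T "D v" P] by blast
  qed
  obtain N where N: "open N" "y \<in> N" "\<And>z. z \<in> N \<Longrightarrow> z \<in> surface X \<Longrightarrow> mdist X y z < e"
    using open_in_ball[OF ys e] by metis
  have oN: "openin T (surface X \<inter> N)" using N(1) by (simp add: openin_open_Int)
  have cover: "z \<in> D w \<or> z \<in> D (- w) \<or> z \<in> a" if "z \<in> surface X" "mdist X y z < e" for z
    using ha[of z] that by (cases "height X p w z" "0 :: real" rule: linorder_cases)
      (auto simp: D_def height_minus e_def)
  have "\<not> (D w \<subseteq> P \<and> D (- w) \<subseteq> P)"
  proof
    assume "D w \<subseteq> P \<and> D (- w) \<subseteq> P"
    then have "surface X \<inter> N \<subseteq> P" using cover N(3) side_subset[OF a(1)] by blast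
    then have "y \<in> T interior_of P" using interior_of_maximal[OF _ oN] N(2) ys by blast
    then show False using a frontier_eq by blast
  qed
  moreover have "\<not> (D w \<inter> P = {} \<and> D (- w) \<inter> P = {})"
  proof
    assume D: "D w \<inter> P = {} \<and> D (- w) \<inter> P = {}"
    have "y \<in> T closure_of (T interior_of P)" using y(1) interior_closure by simp
    then obtain z where z: "z \<in> T interior_of P" "z \<in> surface X \<inter> N"
      using oN N(2) ys by (auto simp: in_closure_of)
    then have "z \<in> P" using interior_of_subset[of T P] by blast
    then have "z \<in> a" using D cover[of z] N(3)[of z] z by blast
    then show False using a(1) z(1) frontier_eq by blast
  qed
  moreover have "D w \<subseteq> P \<or> D w \<inter> P = {}" "D (- w) \<subseteq> P \<or> D (- w) \<inter> P = {}"
    by (rule side, simp)+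
  \<comment> \<open>The double minus makes both alternatives instances of one statement about
    \<open>v\<close>, the normal that points into \<open>P\<close>.\<close>
  ultimately have "(D w \<subseteq> P \<and> D (- w) \<inter> P = {}) \<or> (D (- w) \<subseteq> P \<and> D (- (- w)) \<inter> P = {})"
    by auto
  then obtain v where v: "v \<in> {w, - w}" "D v \<subseteq> P" "D (- v) \<inter> P = {}" by blast
  show thesis
  proof (rule that)
    show "0 < e" "e \<le> 1" "p \<in> surface X" by (fact e p)+
    show "v \<in> unit_tangents X p" using v(1) w by (auto intro: unit_tangents_minus)
    show "side_reflection X a = frame_reflection X p v" using v(1) R frame_reflection_minus by auto
    fix z assume z: "z \<in> surface X" "mdist X y z < e"
    show za: "z \<in> a \<longleftrightarrow> height X p v z = 0"
      using h ha[of z] z v(1) by (auto simp: height_minus e_def)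
    show "z \<in> P \<longleftrightarrow> 0 \<le> height X p v z"
    proof
      assume "z \<in> P"
      then show "0 \<le> height X p v z" using v(3) z by (force simp: D_def height_minus)
    next
      assume "0 \<le> height X p v z"
      then show "z \<in> P" using v(2) z za side_subset[OF a(1)] by (cases "height X p v z = 0") (auto simp: D_def)
    qed
  qed
qed


text \<open>Records what is needed about \<open>P\<close> near \<open>y\<close> in terms of
  geodesics only, so that interior points and points of a side are treated alike. For a point of a
  side, the fourth property is the convexity of a half disc and the last one the intermediate value
  theorem for the height.\<close>

lemma chart:
  assumes y: "y \<in> P" "y \<notin> corners X A"
  obtains e where "0 < e" "e \<le> 1"
    "\<forall>z\<in>surface X. \<forall>b\<in>A. mdist X y z < e \<longrightarrow> z \<in> b \<longrightarrow> y \<in> b"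
    "\<forall>z\<in>P. \<forall>u\<in>unit_tangents X z. \<forall>d\<ge>0. d < pi \<longrightarrow> (\<forall>r\<in>{0..d}. mdist X y (exp_M X z u r) < e) \<longrightarrow>
       exp_M X z u d \<in> P \<longrightarrow> (\<forall>r\<in>{0..d}. exp_M X z u r \<in> P)"
    "\<forall>a\<in>A. y \<in> a \<longrightarrow> (\<forall>z\<in>P. \<forall>u\<in>unit_tangents X z. \<forall>d\<ge>0.
       (\<forall>r\<in>{0..d}. mdist X y (exp_M X z u r) < e) \<longrightarrow>
       side_reflection X a (exp_M X z u d) \<in> P \<longrightarrow> (\<exists>r\<in>{0..d}. exp_M X z u r \<in> a))"
proof -
  obtain e1 where e1: "0 < e1" "e1 \<le> 1"
    "\<And>z b. z \<in> surface X \<Longrightarrow> mdist X y z < e1 \<Longrightarrow> b \<in> A \<Longrightarrow> z \<in> b \<Longrightarrow> y \<in> b"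
    using ball_near_other_sides[OF y(1)] by metis
  show thesis
  proof (cases "y \<in> \<Union>A")
    case False
    obtain e2 where e2: "0 < e2" "\<And>z. z \<in> surface X \<Longrightarrow> mdist X y z < e2 \<Longrightarrow> z \<in> P"
      using interior_ball[OF y(1) False] by metis
    show thesis
    proof (rule that[of "min e1 e2"])
      show "\<forall>z\<in>P. \<forall>u\<in>unit_tangents X z. \<forall>d\<ge>0. d < pi \<longrightarrow>
          (\<forall>r\<in>{0..d}. mdist X y (exp_M X z u r) < min e1 e2) \<longrightarrow>
          exp_M X z u d \<in> P \<longrightarrow> (\<forall>r\<in>{0..d}. exp_M X z u r \<in> P)"
        using e2(2) exp_M_surface(1) P_surface by simp
    qed (use e1 e2 False in auto)
  next
    case True
    then obtain a where a: "a \<in> A" "y \<in> a" by blast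
    obtain p w e2 where e2: "0 < e2" "p \<in> surface X" "w \<in> unit_tangents X p"
      and R: "side_reflection X a = frame_reflection X p w"
      and hP: "\<And>z. z \<in> surface X \<Longrightarrow> mdist X y z < e2 \<Longrightarrow> z \<in> P \<longleftrightarrow> 0 \<le> height X p w z"
      and ha: "\<And>z. z \<in> surface X \<Longrightarrow> mdist X y z < e2 \<Longrightarrow> z \<in> a \<longleftrightarrow> height X p w z = 0"
      using half_disc[OF y a] by metis
    show thesis
    proof (rule that[of "min e1 e2"], goal_cases)
      case 4
      show ?case
      proof (intro ballI allI impI)
        fix z u d r assume z: "z \<in> P" "u \<in> unit_tangents X z" and d: "0 \<le> d" "d < pi"
          and b: "\<forall>r\<in>{0..d}. mdist X y (exp_M X z u r) < min e1 e2"
          and z': "exp_M X z u d \<in> P" and r: "r \<in> {0..d}"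
        have S: "exp_M X z u r \<in> surface X" for r using z P_surface exp_M_surface(1) by blast
        have "mdist X y z < e2" "mdist X y (exp_M X z u d) < e2"
          using bspec[OF b, of 0] bspec[OF b, of d] d by auto
        then have "0 \<le> height X p w z" "0 \<le> height X p w (exp_M X z u d)"
          using hP[OF S, of 0] hP[OF S, of d] z z' by auto
        then have "0 \<le> height X p w (exp_M X z u r)"
          using r d height_chord_nonneg[of r d X p w z u] by simp
        then show "exp_M X z u r \<in> P" using hP[OF S] b r by simp
      qed
    next
      case 5
      show ?case
      proof (intro ballI allI impI)
        fix a' z u d assume "a' \<in> A" "y \<in> a'" and z: "z \<in> P" "u \<in> unit_tangents X z" and d: "0 \<le> d"
          and b: "\<forall>r\<in>{0..d}. mdist X y (exp_M X z u r) < min e1 e2"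
          and z': "side_reflection X a' (exp_M X z u d) \<in> P"
        then have a': "a' = a" using unique_side[OF y(2) a] by blast
        have S: "exp_M X z u r \<in> surface X" for r using z P_surface exp_M_surface(1) by blast
        have m: "motion X (side_reflection X a)" by (rule motion_side[OF a(1)])
        have bd: "mdist X y z < e2" "mdist X y (exp_M X z u d) < e2"
          using bspec[OF b, of 0] bspec[OF b, of d] d by auto
        \<comment> \<open>The reflection fixes \<open>y\<close>, so the mirrored end lies in the
          same ball, where the sign of the height decides membership in \<open>P\<close>.\<close>
        have "mdist X y (side_reflection X a (exp_M X z u d)) = mdist X y (exp_M X z u d)"
          using motion_mdist[OF m P_surface[OF y(1)] S[of d]] side_fixes[OF a] by simp
        then have "0 \<le> height X p w (side_reflection X a (exp_M X z u d))"
          using hP[OF P_surface[OF z']] z' bd by (simp add: a')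
        then have "height X p w (exp_M X z u d) \<le> 0"
          by (simp add: R height_frame_reflection[OF e2(3)])
        moreover have "0 \<le> height X p w (exp_M X z u 0)" using hP[OF S, of 0] bd z by simp
        moreover have "continuous_on {0..d} (\<lambda>r. height X p w (exp_M X z u r))"
          unfolding height_exp_M by (intro continuous_intros)
        ultimately obtain r where "0 \<le> r" "r \<le> d" "height X p w (exp_M X z u r) = 0"
          using IVT2'[of "\<lambda>r. height X p w (exp_M X z u r)" d 0 0] d by auto
        then show "\<exists>r\<in>{0..d}. exp_M X z u r \<in> a'" using ha[OF S, of r] b by (auto simp: a')
      qed
    qed (use e1 e2 in auto)
  qed
qed

section \<open>Geodesics of the covering space\<close>

text \<open>Only one side can pass through \<open>y\<close>, and its generator is an involution, so
  at most two tiles meet there.\<close>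

lemma stabilizer_cases:
  assumes y: "y \<notin> corners X A" and k: "k \<in> stabilizer y"
  shows "k = \<one>\<^bsub>G\<^esub> \<or> (\<exists>a\<in>A. y \<in> a \<and> k = gen a)"
  using k
proof (induction k rule: generate.induct)
  case (inv h)
  interpret group G by (rule group_G)
  obtain a where a: "a \<in> A" "y \<in> a" "h = gen a" using inv by auto
  have "inv\<^bsub>G\<^esub> h = h" unfolding a(3) by (intro inv_equality gen_square gen_closed a)
  then show ?case using a by blast
next
  case (eng h1 h2)
  interpret group G by (rule group_G)
  from eng.IH show ?case
  proof (elim disjE bexE conjE)
    fix a b assume ab: "a \<in> A" "y \<in> a" "h1 = gen a" "b \<in> A" "y \<in> b" "h2 = gen b"
    then have "b = a" using unique_side[OF y] by blast
    then show ?thesis using ab gen_square by simp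
  qed (auto simp: gen_closed)
qed auto

lemma neighbour_tiles:
  assumes y: "y \<notin> corners X A" and g: "g \<in> carrier G" "h \<in> carrier G" "h' \<in> carrier G"
    and k: "inv\<^bsub>G\<^esub> g \<otimes>\<^bsub>G\<^esub> h \<in> stabilizer y" "inv\<^bsub>G\<^esub> g \<otimes>\<^bsub>G\<^esub> h' \<in> stabilizer y"
  shows "h' = h \<or> (\<exists>a\<in>A. y \<in> a \<and> h' = h \<otimes>\<^bsub>G\<^esub> gen a)"
proof -
  interpret group G by (rule group_G)
  have "inv\<^bsub>G\<^esub> h \<otimes>\<^bsub>G\<^esub> h' = inv\<^bsub>G\<^esub> (inv\<^bsub>G\<^esub> g \<otimes>\<^bsub>G\<^esub> h) \<otimes>\<^bsub>G\<^esub> (inv\<^bsub>G\<^esub> g \<otimes>\<^bsub>G\<^esub> h')"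
  proof -
    have "g \<otimes>\<^bsub>G\<^esub> (inv\<^bsub>G\<^esub> g \<otimes>\<^bsub>G\<^esub> h') = h'" using g by (simp add: m_assoc[symmetric])
    then show ?thesis using g by (simp add: inv_mult_group m_assoc)
  qed
  then have "inv\<^bsub>G\<^esub> h \<otimes>\<^bsub>G\<^esub> h' \<in> stabilizer y"
    using subgroup.m_closed[OF stabilizer_subgroup
          subgroup.m_inv_closed[OF stabilizer_subgroup k(1)] k(2)] by simp
  moreover have "h' = h \<otimes>\<^bsub>G\<^esub> (inv\<^bsub>G\<^esub> h \<otimes>\<^bsub>G\<^esub> h')" using g by (simp add: m_assoc[symmetric])
  ultimately show ?thesis using stabilizer_cases[OF y, of "inv\<^bsub>G\<^esub> h \<otimes>\<^bsub>G\<^esub> h'"] g by auto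
qed

text \<open>A curve shorter than \<open>e\<close> meets only sides through \<open>y\<close>, so each
  change of tile multiplies by an element of the stabilizer of \<open>y\<close>. The claim ranges
  over all representatives of the end point, because every step may start from a different
  one.\<close>

lemma broken_near:
  assumes e: "\<forall>z\<in>surface X. \<forall>b\<in>A. mdist X y z < e \<longrightarrow> z \<in> b \<longrightarrow> y \<in> b"
    and g: "g \<in> carrier G" and y: "y \<in> P"
  shows "broken (tile g y) q L \<Longrightarrow> L < e \<Longrightarrow> q = tile h z \<Longrightarrow> h \<in> carrier G \<Longrightarrow> z \<in> P \<Longrightarrow>
    mdist X y z \<le> L \<and> inv\<^bsub>G\<^esub> g \<otimes>\<^bsub>G\<^esub> h \<in> stabilizer y"
proof (induction arbitrary: h z rule: broken_geodesic.induct)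
  case broken_refl
  then have "z = y \<and> inv\<^bsub>G\<^esub> g \<otimes>\<^bsub>G\<^esub> h \<in> stabilizer y" using tile_eq_iff[OF g broken_refl.prems(3) y, of z] by simp
  then show ?case using mdist_self[OF P_surface[OF y]] by simp
next
  case (broken_step g1 y1 L u l)
  interpret group G by (rule group_G)
  let ?z = "exp_M X y1 u l"
  have z1: "?z \<in> P" using broken_step.hyps by auto
  have IH: "mdist X y y1 \<le> L" "inv\<^bsub>G\<^esub> g \<otimes>\<^bsub>G\<^esub> g1 \<in> stabilizer y"
    using broken_step.IH[of g1 y1] broken_step.hyps broken_step.prems by auto
  have z: "z = ?z" and k: "inv\<^bsub>G\<^esub> g1 \<otimes>\<^bsub>G\<^esub> h \<in> stabilizer ?z"
    using tile_eq_iff[OF broken_step.hyps(2) broken_step.prems(3) z1, of z] broken_step.prems by auto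
  have "mdist X y ?z \<le> mdist X y y1 + mdist X y1 ?z"
    by (intro mdist_triangle P_surface y z1 broken_step.hyps)
  also have "mdist X y1 ?z \<le> l" by (intro mdist_exp_M_le P_surface broken_step.hyps)
  finally have d: "mdist X y ?z \<le> L + l" using IH(1) by simp
  then have "stabilizer ?z \<subseteq> stabilizer y"
    using e P_surface[OF z1] broken_step.prems(1) by (intro mono_generate image_mono) auto
  then have "inv\<^bsub>G\<^esub> g1 \<otimes>\<^bsub>G\<^esub> h \<in> stabilizer y" using k by blast
  from subgroup.m_closed[OF stabilizer_subgroup IH(2) this]
  have "(inv\<^bsub>G\<^esub> g \<otimes>\<^bsub>G\<^esub> g1) \<otimes>\<^bsub>G\<^esub> (inv\<^bsub>G\<^esub> g1 \<otimes>\<^bsub>G\<^esub> h) \<in> stabilizer y" .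
  moreover have "g1 \<otimes>\<^bsub>G\<^esub> (inv\<^bsub>G\<^esub> g1 \<otimes>\<^bsub>G\<^esub> h) = h"
    using broken_step.hyps(2) broken_step.prems(3) by (simp add: m_assoc[symmetric])
  ultimately have "inv\<^bsub>G\<^esub> g \<otimes>\<^bsub>G\<^esub> h \<in> stabilizer y"
    using g broken_step.hyps(2) broken_step.prems(3) by (simp add: m_assoc)
  then show ?case using d z by simp
qed

text \<open>Ends within e / 3 of \<open>y\<close> are less than 2 e / 3 apart, so the whole segment
  stays within e / 3 + 2 e / 3 of \<open>y\<close>.\<close>

lemma short_segment:
  assumes s: "y \<in> surface X" "z \<in> surface X" "z' \<in> surface X"
    and d: "mdist X y z < e / 3" "mdist X y z' < e / 3" and e: "e \<le> 1"
  obtains u where "u \<in> unit_tangents X z" "z' = exp_M X z u (mdist X z z')"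
    "0 \<le> mdist X z z'" "mdist X z z' < pi"
    "\<forall>r\<in>{0..mdist X z z'}. mdist X y (exp_M X z u r) < e"
proof -
  obtain u where u: "u \<in> unit_tangents X z" "z' = exp_M X z u (mdist X z z')" "0 \<le> mdist X z z'"
    using geodesic_to[OF s(2,3)] by metis
  have l: "mdist X z z' < 2 * e / 3"
    using mdist_triangle[OF s(2,3,1)] d by (simp add: mdist_commute[of X z y])
  have "mdist X y (exp_M X z u r) < e" if r: "r \<in> {0..mdist X z z'}" for r
  proof -
    have "mdist X y (exp_M X z u r) \<le> mdist X y z + mdist X z (exp_M X z u r)"
      using s u exp_M_surface by (intro mdist_triangle) auto
    moreover have "mdist X z (exp_M X z u r) \<le> r" using s u r by (intro mdist_exp_M_le) auto
    ultimately show ?thesis using r l d by simp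
  qed
  moreover have "mdist X z z' < pi" using l e pi_gt3 by simp
  ultimately show thesis using that u by blast
qed

text \<open>Short curves from a point that is not a vertex stay in the at most two tiles around it, which
  the canonical map sends to a disc or to the two halves of a disc.\<close>

lemma local_isometry:
  assumes g: "g \<in> carrier G" and y: "y \<in> P" "y \<notin> corners X A"
  obtains e where "0 < e"
    "\<And>q q' L L'. broken (tile g y) q L \<Longrightarrow> L < e \<Longrightarrow> broken (tile g y) q' L' \<Longrightarrow> L' < e \<Longrightarrow>
       broken q q' (mdist X (cover_map X q) (cover_map X q'))"
proof -
  interpret group G by (rule group_G)
  obtain e where e: "0 < e" "e \<le> 1"
    and near: "\<forall>z\<in>surface X. \<forall>b\<in>A. mdist X y z < e \<longrightarrow> z \<in> b \<longrightarrow> y \<in> b"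
    and convex: "\<forall>z\<in>P. \<forall>u\<in>unit_tangents X z. \<forall>d\<ge>0. d < pi \<longrightarrow> (\<forall>r\<in>{0..d}. mdist X y (exp_M X z u r) < e) \<longrightarrow>
       exp_M X z u d \<in> P \<longrightarrow> (\<forall>r\<in>{0..d}. exp_M X z u r \<in> P)"
    and cross: "\<forall>a\<in>A. y \<in> a \<longrightarrow> (\<forall>z\<in>P. \<forall>u\<in>unit_tangents X z. \<forall>d\<ge>0.
       (\<forall>r\<in>{0..d}. mdist X y (exp_M X z u r) < e) \<longrightarrow>
       side_reflection X a (exp_M X z u d) \<in> P \<longrightarrow> (\<exists>r\<in>{0..d}. exp_M X z u r \<in> a))"
    using chart[OF y] .
  have ys: "y \<in> surface X" using y(1) by (rule P_surface)
  have same: "broken (tile h z) (tile h z') (mdist X z z')"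
    if h: "h \<in> carrier G" and z: "z \<in> P" "z' \<in> P" "mdist X y z < e / 3" "mdist X y z' < e / 3" for h z z'
  proof -
    obtain u where u: "u \<in> unit_tangents X z" "z' = exp_M X z u (mdist X z z')"
      "0 \<le> mdist X z z'" "mdist X z z' < pi"
      "\<forall>r\<in>{0..mdist X z z'}. mdist X y (exp_M X z u r) < e"
      using short_segment[OF ys P_surface[OF z(1)] P_surface[OF z(2)] z(3,4) e(2)] .
    have "exp_M X z u (mdist X z z') \<in> P" using u(2) z(2) by simp
    then have "\<forall>r\<in>{0..mdist X z z'}. exp_M X z u r \<in> P"
      using convex z(1) u(1,3,4,5) by blast
    from broken_tile[OF h z(1) u(1,3) this] show ?thesis using u(2) by simp
  qed
  \<comment> \<open>Mirroring \<open>z'\<close> in \<open>a\<close> develops the second tile next to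
    the first. The straight segment from \<open>z\<close> to the mirror image meets
    \<open>a\<close>, and its part beyond that point is folded back into \<open>P\<close>.\<close>
  have adjacent: "broken (tile h z) (tile (h \<otimes>\<^bsub>G\<^esub> gen a) z') (mdist X z (side_reflection X a z'))"
    if h: "h \<in> carrier G" and z: "z \<in> P" "z' \<in> P" "mdist X y z < e / 3" "mdist X y z' < e / 3"
      and a: "a \<in> A" "y \<in> a" for h z z' a
  proof -
    let ?R = "side_reflection X a" let ?z = "?R z'" let ?d = "mdist X z ?z"
    have m: "motion X ?R" by (rule motion_side[OF a(1)])
    have zs: "z \<in> surface X" "?z \<in> surface X"
      using z P_surface motion_surface[OF m] by auto
    have Ry: "mdist X y (?R q) = mdist X y q" if "q \<in> surface X" for q
      using motion_mdist[OF m ys that] side_fixes[OF a] by simp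
    have zz: "mdist X y ?z < e / 3" using Ry[OF P_surface[OF z(2)]] z by simp
    obtain u where u: "u \<in> unit_tangents X z" "?z = exp_M X z u ?d" "0 \<le> ?d" "?d < pi"
      "\<forall>r\<in>{0..?d}. mdist X y (exp_M X z u r) < e"
      using short_segment[OF ys zs z(3) zz e(2)] .
    have Rz: "?R (exp_M X z u ?d) = z'" using u(2) side_involution[OF a(1)] by simp
    have RzP: "?R (exp_M X z u ?d) \<in> P" using Rz z(2) by simp
    obtain r0 where r0: "r0 \<in> {0..?d}" and ma: "exp_M X z u r0 \<in> a"
      using cross a z(1) u(1,3,5) RzP by blast
    let ?m = "exp_M X z u r0" let ?w = "?R (velocity X z u r0)"
    have mP: "?m \<in> P" using ma side_subset[OF a(1)] by blast
    have w: "?w \<in> unit_tangents X ?m"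
      using motion_unit_tangent[OF m exp_M_surface[OF zs(1) u(1), of r0]] side_fixes[OF a(1) ma] by simp
    have mw: "exp_M X ?m ?w r = ?R (exp_M X z u (r0 + r))" for r
      using motion_exp_M[OF m, of ?m "velocity X z u r0" r] side_fixes[OF a(1) ma] by (simp add: exp_M_add)
    have "\<forall>r\<in>{0..r0}. exp_M X z u r \<in> P"
    proof -
      have "0 \<le> r0" "r0 < pi" using r0 u(4) by auto
      moreover have "\<forall>r\<in>{0..r0}. mdist X y (exp_M X z u r) < e" using u(5) r0 by simp
      ultimately show ?thesis using convex z(1) u(1) mP by blast
    qed
    then have 1: "broken (tile h z) (tile h ?m) r0"
      using r0 by (intro broken_tile h z u) auto
    have "\<forall>r\<in>{0..?d - r0}. exp_M X ?m ?w r \<in> P"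
    proof -
      have "0 \<le> ?d - r0" "?d - r0 < pi" using r0 u(4) by auto
      moreover have "exp_M X ?m ?w (?d - r0) \<in> P" using z(2) Rz by (simp add: mw)
      moreover have "\<forall>r\<in>{0..?d - r0}. mdist X y (exp_M X ?m ?w r) < e"
        unfolding mw using Ry[OF exp_M_surface(1)[OF zs(1) u(1)]] u(5) r0 by simp
      ultimately show ?thesis using convex mP w by blast
    qed
    then have "broken (tile (h \<otimes>\<^bsub>G\<^esub> gen a) ?m) (tile (h \<otimes>\<^bsub>G\<^esub> gen a) (exp_M X ?m ?w (?d - r0))) (?d - r0)"
      using r0 h gen_closed[OF a(1)] by (intro broken_tile mP w) auto
    then have "broken (tile h ?m) (tile (h \<otimes>\<^bsub>G\<^esub> gen a) z') (?d - r0)"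
      using tile_side[OF h mP a(1) ma] Rz by (simp add: mw)
    from broken_trans[OF this 1] show ?thesis by simp
  qed
  show thesis
  proof (rule that[of "e / 3"])
    show "0 < e / 3" using e by simp
    fix q q' L L' assume q: "broken (tile g y) q L" "L < e / 3" and q': "broken (tile g y) q' L'" "L' < e / 3"
    obtain h z where hz: "q = tile h z" "h \<in> carrier G" "z \<in> P"
      using broken_cover(2)[OF q(1)] by (auto simp: cover_eq)
    obtain h' z' where hz': "q' = tile h' z'" "h' \<in> carrier G" "z' \<in> P"
      using broken_cover(2)[OF q'(1)] by (auto simp: cover_eq)
    have n: "mdist X y z \<le> L \<and> inv\<^bsub>G\<^esub> g \<otimes>\<^bsub>G\<^esub> h \<in> stabilizer y"
      by (rule broken_near[OF near g y(1) q(1) _ hz]) (use q(2) e in auto)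
    have n': "mdist X y z' \<le> L' \<and> inv\<^bsub>G\<^esub> g \<otimes>\<^bsub>G\<^esub> h' \<in> stabilizer y"
      by (rule broken_near[OF near g y(1) q'(1) _ hz']) (use q'(2) e in auto)
    have zz: "mdist X y z < e / 3" "mdist X y z' < e / 3" using n n' q q' by auto
    have m: "motion X (act X h)" by (rule act_motion[OF hz(2)])
    consider "h' = h" | a where "a \<in> A" "y \<in> a" "h' = h \<otimes>\<^bsub>G\<^esub> gen a"
      using neighbour_tiles[OF y(2) g hz(2) hz'(2)] n n' by blast
    then show "broken q q' (mdist X (cover_map X q) (cover_map X q'))"
    proof cases
      case 1
      then have "mdist X (cover_map X q) (cover_map X q') = mdist X z z'"
        using hz hz' motion_mdist[OF m] P_surface by (simp add: cover_map_tile)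
      then show ?thesis using same[OF hz(2,3) hz'(3) zz] hz hz' 1 by simp
    next
      case 2
      have "act X h' z' = act X h (side_reflection X a z')"
        using act_mult[OF hz(2) gen_closed[OF 2(1)]] 2 by (simp add: act_gen)
      then have "mdist X (cover_map X q) (cover_map X q') = mdist X z (side_reflection X a z')"
        using hz hz' motion_mdist[OF m] P_surface motion_surface[OF motion_side[OF 2(1)]]
        by (simp add: cover_map_tile)
      then show ?thesis using adjacent[OF hz(2,3) hz'(3) zz 2(1,2)] hz hz' 2 by simp
    qed
  qed
qed


text \<open>The infimum of the empty set is one fixed number, so it equals \<open>\<bar>r - r'\<bar>\<close> for no \<open>r\<close>, \<open>r'\<close>
  that are distinct and close together.\<close>

lemma cover_geodesic_joined:
  assumes c: "cover_geodesic X P A L c" and s: "s \<in> {0..L}"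
  obtains e where "0 < e"
    "\<forall>r\<in>{0..L} \<inter> ball s e. \<forall>r'\<in>{0..L} \<inter> ball s e.
       cover_dist X P A (c r) (c r') = \<bar>r - r'\<bar> \<and> (\<exists>l. broken (c r) (c r') l)"
proof -
  obtain e where e: "0 < e" and
    dist: "\<forall>r\<in>{0..L} \<inter> ball s e. \<forall>r'\<in>{0..L} \<inter> ball s e. cover_dist X P A (c r) (c r') = \<bar>r - r'\<bar>"
    using c s unfolding cover_geodesic_def by blast
  define \<kappa> where "\<kappa> = Inf ({} :: real set)"
  \<comment> \<open>Two times in this ball differ by less than \<bar>\<kappa>\<bar> unless \<kappa>
    = 0. In that case the equation forces r = r', and a point is joined to itself by the trivial
    curve.\<close>
  define e' where "e' = (if \<kappa> = 0 then e else min e (\<bar>\<kappa>\<bar> / 2))"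
  have e': "0 < e'" "e' \<le> e" using e by (auto simp: e'_def)
  have "\<exists>l. broken (c r) (c r') l" if r: "r \<in> {0..L} \<inter> ball s e'" "r' \<in> {0..L} \<inter> ball s e'" for r r'
  proof (rule ccontr)
    assume n: "\<nexists>l. broken (c r) (c r') l"
    then have "cover_dist X P A (c r) (c r') = \<kappa>" by (simp add: cover_dist_def \<kappa>_def)
    moreover have "cover_dist X P A (c r) (c r') = \<bar>r - r'\<bar>" using dist r e'(2) by auto
    ultimately have k: "\<kappa> = \<bar>r - r'\<bar>" by simp
    have "r = r'"
    proof (cases "\<kappa> = 0")
      case False
      have "\<bar>r - r'\<bar> < 2 * e'" using r by (auto simp: dist_real_def)
      also have "\<dots> \<le> \<bar>\<kappa>\<bar>" using False by (simp add: e'_def)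
      finally show ?thesis using k by simp
    qed (use k in simp)
    moreover have "c r \<in> cover X P A" using c r(1) by (auto simp: cover_geodesic_def)
    ultimately show False using n broken_geodesic.broken_refl by metis
  qed
  then show thesis using that[OF e'(1)] dist e'(2) by auto
qed

text \<open>Continuation up to the supremum \<open>s0\<close> of the times until which projection
  and geodesic agree. Agreement passes to \<open>s0\<close> because the projection is Lipschitz,
  even if \<open>c s0\<close> is a vertex. If \<open>s0\<close> were below \<open>L\<close>,
  \<open>local_isometry\<close> would make the projection distance-preserving around
  \<open>s0\<close>, and \<open>geodesic_extension_unique\<close> would carry the agreement
  further.\<close>

lemma cover_geodesic_projection:
  assumes c: "cover_geodesic X P A L c" and init: "cover_initial X P A x v L c"
    and x: "x \<in> surface X" "v \<in> unit_tangents X x" and L: "0 \<le> L"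
  shows "cover_map X (c L) = exp_M X x v L"
proof -
  let ?p = "\<lambda>s. cover_map X (c s)" and ?\<gamma> = "exp_M X x v"
  have one: "\<one>\<^bsub>G\<^esub> \<in> carrier G" using group.is_monoid[OF group_G] by (rule monoid.one_closed)
  have cs: "c s \<in> cover X P A" if "s \<in> {0..L}" for s using c that by (auto simp: cover_geodesic_def)
  have ps: "?p s \<in> surface X" if "s \<in> {0..L}" for s using cs[OF that] by (rule cover_map_surface)
  have gs: "?\<gamma> s \<in> surface X" for s by (rule exp_M_surface(1)[OF x])
  obtain e0 where e0: "0 < e0" "\<forall>s\<in>{0..e0} \<inter> {0..L}. ?\<gamma> s \<in> P \<and> c s = base_point X P A (?\<gamma> s)"
    using init unfolding cover_initial_def by blast
  have start: "?p s = ?\<gamma> s" if "s \<in> {0..L}" "s \<le> e0" for s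
    using e0(2) that one by (simp add: base_point_def cover_map_tile act_one)
  define K where "K = {s \<in> {0..L}. \<forall>r\<in>{0..s}. ?p r = ?\<gamma> r}"
  \<comment> \<open>Besides showing that \<open>K\<close> is nonempty, this makes \<open>s0\<close>
    positive when \<open>L\<close> is, so there is a time before \<open>s0\<close> from which to
    detect a turn.\<close>
  have K0: "min e0 L \<in> K" using start e0(1) L by (auto simp: K_def)
  have bdd: "bdd_above K" by (auto simp: K_def intro!: bdd_aboveI[of _ L])
  define s0 where "s0 = Sup K"
  have "\<And>k. k \<in> K \<Longrightarrow> k \<le> L" by (simp add: K_def)
  then have s0: "min e0 L \<le> s0" "s0 \<le> L"
    unfolding s0_def using cSup_upper[OF K0 bdd] cSup_least[of K L] K0 by auto
  have s0I: "s0 \<in> {0..L}" using s0 e0(1) L by auto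
  have below: "?p r = ?\<gamma> r" if r: "0 \<le> r" "r < s0" for r
  proof -
    obtain k where "k \<in> K" "r < k" using r(2) less_cSup_iff[OF _ bdd] K0 unfolding s0_def by blast
    then show ?thesis using r(1) by (auto simp: K_def)
  qed
  obtain e where e: "0 < e" and near: "\<forall>r\<in>{0..L} \<inter> ball s0 e. \<forall>r'\<in>{0..L} \<inter> ball s0 e.
       cover_dist X P A (c r) (c r') = \<bar>r - r'\<bar> \<and> (\<exists>l. broken (c r) (c r') l)"
    using cover_geodesic_joined[OF c s0I] .
  have short: "mdist X (?p r) (?p r') \<le> \<bar>r - r'\<bar>"
    if r: "r \<in> {0..L} \<inter> ball s0 e" "r' \<in> {0..L} \<inter> ball s0 e" for r r'
  proof -
    have d: "cover_dist X P A (c r) (c r') = \<bar>r - r'\<bar>" and "\<exists>l. broken (c r) (c r') l"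
      using near r by blast+
    then obtain l where "broken (c r) (c r') l" by blast
    from mdist_le_cover_dist[OF this] show ?thesis by (simp add: d)
  qed
  have at: "?p s0 = ?\<gamma> s0"
  proof (cases "s0 = 0")
    case True
    then show ?thesis using start[of 0] L e0(1) by simp
  next
    case False
    then have pos: "0 < s0" using s0I by simp
    let ?D = "mdist X (?\<gamma> s0) (?p s0)"
    have "?D = 0"
    proof (rule ccontr)
      assume "?D \<noteq> 0"
      then have D: "0 < ?D" using mdist_nonneg[OF gs ps[OF s0I], of s0] by simp
      \<comment> \<open>Going back by \<delta> and forward again gives ?D \<le> 2 \<delta> \<le> ?D
        / 2, a contradiction; the bound 1 keeps the arc shortest.\<close>
      define \<delta> where "\<delta> = min (min (e / 2) s0) (min (?D / 4) 1)"
      have \<delta>: "0 < \<delta>" "\<delta> < e" "\<delta> \<le> s0" "\<delta> \<le> ?D / 4" "\<delta> \<le> 1"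
        using e pos D by (auto simp: \<delta>_def)
      let ?r = "s0 - \<delta>"
      have r: "?r \<in> {0..L}" using \<delta> s0I by auto
      have "?D \<le> mdist X (?\<gamma> s0) (?\<gamma> ?r) + mdist X (?\<gamma> ?r) (?p s0)"
        by (intro mdist_triangle gs ps s0I)
      also have "mdist X (?\<gamma> s0) (?\<gamma> ?r) = \<delta>"
        using mdist_geodesic[OF x, of ?r s0] \<delta> pi_gt3 by (simp add: mdist_commute)
      also have "mdist X (?\<gamma> ?r) (?p s0) \<le> \<delta>"
        using short[of ?r s0] below[of ?r] r s0I \<delta> e by (simp add: dist_real_def)
      finally show False using \<delta> D by simp
    qed
    then show ?thesis by (rule mdist_0_eq[OF gs ps[OF s0I]])
  qed
  have "s0 = L"
  proof (rule ccontr)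
    assume "s0 \<noteq> L"
    then have s0L: "s0 < L" "0 < s0" using s0 e0(1) L by auto
    then have nv: "c s0 \<notin> cover_vertices X P A" using c by (auto simp: cover_geodesic_def)
    obtain g y where gy: "c s0 = tile g y" "g \<in> carrier G" "y \<in> P" using cs[OF s0I] by (auto simp: cover_eq)
    then have "y \<notin> corners X A" using nv by (auto simp: cover_vertices_def)
    then obtain e1 where e1: "0 < e1" and iso: "\<And>q q' l l'. broken (c s0) q l \<Longrightarrow> l < e1 \<Longrightarrow>
        broken (c s0) q' l' \<Longrightarrow> l' < e1 \<Longrightarrow> broken q q' (mdist X (cover_map X q) (cover_map X q'))"
      using local_isometry[OF gy(2,3)] unfolding gy(1) by blast
    \<comment> \<open>\<open>short\<close> gives one inequality. The other holds because
      \<open>iso\<close> supplies a curve in the covering space whose length is the distance of the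
      projections.\<close>
    have isom: "mdist X (?p r) (?p r') = \<bar>r - r'\<bar>"
      if r: "r \<in> {0..L} \<inter> ball s0 (min e e1)" "r' \<in> {0..L} \<inter> ball s0 (min e e1)" for r r'
    proof -
      have near_s0: "\<exists>l. broken (c s0) (c q) l \<and> l < e1" if q: "q \<in> {0..L} \<inter> ball s0 (min e e1)" for q
      proof -
        have "cover_dist X P A (c s0) (c q) = \<bar>s0 - q\<bar>" and ne: "\<exists>l. broken (c s0) (c q) l"
          using near q s0I e by auto
        \<comment> \<open>\<open>iso\<close> is about curves, not distances, so a curve shorter than
          \<open>e1\<close> is extracted from the infimum.\<close>
        then have "Inf {l. broken (c s0) (c q) l} < e1"
          using q by (simp add: cover_dist_def dist_real_def)
        then obtain l where "l \<in> {l. broken (c s0) (c q) l}" "l < e1"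
          using cInf_lessD[of "{l. broken (c s0) (c q) l}" e1] ne by auto
        then show ?thesis by blast
      qed
      obtain l l' where "broken (c s0) (c r) l" "l < e1" "broken (c s0) (c r') l'" "l' < e1"
        using near_s0 r by metis
      from cover_dist_le[OF iso[OF this]] have "cover_dist X P A (c r) (c r') \<le> mdist X (?p r) (?p r')" .
      then have "\<bar>r - r'\<bar> \<le> mdist X (?p r) (?p r')" using near r by auto
      then show ?thesis using short[of r r'] r by auto
    qed
    \<comment> \<open>Both \<open>s0 - \<delta>\<close> and \<open>s0 + \<delta>\<close> stay in the
      ball and in the time interval, and \<delta> + b \<le> 2 < pi, as the extension lemma
      requires.\<close>
    define \<delta> where "\<delta> = min (min (min e e1 / 2) s0) (min (L - s0) 1)"
    have \<delta>: "0 < \<delta>" "\<delta> < min e e1" "\<delta> \<le> s0" "\<delta> \<le> L - s0" "\<delta> \<le> 1"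
      using e e1 s0L by (auto simp: \<delta>_def)
    have above: "?p (s0 + b) = ?\<gamma> (s0 + b)" if b: "0 < b" "b \<le> \<delta>" for b
    proof (rule geodesic_extension_unique[OF x])
      have I: "s0 - \<delta> \<in> {0..L} \<inter> ball s0 (min e e1)" "s0 \<in> {0..L} \<inter> ball s0 (min e e1)"
        "s0 + b \<in> {0..L} \<inter> ball s0 (min e e1)"
        using \<delta> b s0L e e1 by (auto simp: dist_real_def)
      show "?p (s0 + b) \<in> surface X" using I by (intro ps) auto
      show "mdist X (?\<gamma> s0) (?p (s0 + b)) = b" using isom[OF I(2,3)] at b by simp
      show "mdist X (?\<gamma> (s0 - \<delta>)) (?p (s0 + b)) = \<delta> + b"
        using isom[OF I(1,3)] below[of "s0 - \<delta>"] \<delta> b by simp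
      show "0 < \<delta>" "0 < b" "\<delta> + b < pi" using \<delta> b pi_gt3 by auto
    qed
    have "?p r = ?\<gamma> r" if "r \<in> {0..s0 + \<delta>}" for r
      using that below[of r] at above[of "r - s0"] by (cases r s0 rule: linorder_cases) auto
    then have "s0 + \<delta> \<in> K" using \<delta> s0L by (auto simp: K_def)
    then have "s0 + \<delta> \<le> s0" unfolding s0_def using bdd by (rule cSup_upper)
    then show False using \<delta>(1) by simp
  qed
  then show ?thesis using at by simp
qed

end

theorem proposition6:
  fixes X :: geometry and P :: "(real^3) set" and A :: "(real^3) set set"
    and x v :: "real^3" and t :: real
  assumes "geodesic_polygon X P A"
    and "connected P"
    and "x \<in> P"
    and "v \<in> directions X P x"
    and "0 \<le> t"
    and "billiard_defined X P A x v t"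
  shows "unfold_op X P A x v t (exp_P X P A x v t) = cover_map X (exp_C X P A x v t)"
proof -
  interpret polygon X P A by unfold_locales (fact assms(1))
  have x: "x \<in> surface X" using assms(3) by (rule P_surface)
  have v: "v \<in> unit_tangents X x" using assms(4) by (simp add: directions_def)
  obtain y w as where st: "billiard_state X P A x v t = (y, w, as)" by (metis prod_cases3)
  \<comment> \<open>The chosen position and list of sides come from the same derivation, which is
    all that \<open>billiard_lift\<close> needs.\<close>
  have "\<exists>s. case s of (y, w, as) \<Rightarrow> billiard X P A x v t y w as"
    using assms(6) by (auto simp: billiard_defined_def)
  from someI_ex[OF this] have "billiard X P A x v t y w as"
    using st by (simp add: billiard_state_def)
  from billiard_lift[OF this assms(4)] obtain c where
    unfold: "foldr (side_reflection X) as y = exp_M X x v t" and c: "lift x v t c" by blast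
  \<comment> \<open>The lift only guarantees that the choice in \<open>exp_C\<close> has a
    candidate; the chosen geodesic may be another one, but its end projects to the same
    point.\<close>
  have "\<exists>q c. cover_geodesic X P A t c \<and> cover_initial X P A x v t c \<and> q = c t"
    using lift_geodesic[OF c x v] c by (auto simp: lift_def)
  from someI_ex[OF this] obtain c' where c': "cover_geodesic X P A t c'" "cover_initial X P A x v t c'"
    "exp_C X P A x v t = c' t"
    unfolding exp_C_def by blast
  have "cover_map X (exp_C X P A x v t) = exp_M X x v t"
    unfolding c'(3) by (rule cover_geodesic_projection[OF c'(1,2) x v assms(5)])
  then show ?thesis using unfold by (simp add: unfold_op_def exp_P_def sides_hit_def st)
qed

end
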